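(* Let $k$ be a negative integer and $N$ a positive integer. Let $f,g$ be functions on $\mathbb H$ given by the Fourier series $$f(\tau)=\sum_{n\ge 0}c_f^+(n)q^n+c_f^-(0)v^{1-k}+\sum_{n<0}c_f^-(n)\Gamma(1-k,-4\pi nv)q^n,$$ $$g(\tau)=\sum_{n\ge 0}c_g^+(n)q^n+c_g^-(0)v^{1-k}+\sum_{n<0}c_g^-(n)\Gamma(1-k,-4\pi nv)q^n,$$ with $c_f^{\pm}(n),c_g^{\pm}(n)=O(|n|^{\alpha})$, $n\in\mathbb Z$, for some $\alpha\ge0$. Then the following two statements are equivalent. (1) $g=f|_k\omega(N)$. (2) Each of $\Lambda_N(f,s),\Lambda_N(g,s),\Omega_N(f,s),\Omega_N(g,s)$ admits a meromorphic continuation to the whole complex plane, and $$\Lambda_N(f,s)=i^k\Lambda_N(g,k-s),\qquad \Omega_N(f,s)=-i^k\Omega_N(g,k-s).$$ Moreover, each of the following functions is entire and bounded in vertical strips: $$\Lambda_N^*(f,s)=\Lambda_N(f,s)+\frac{c_f^+(0)}{s}+\frac{c_g^+(0)i^k}{k-s}+\frac{c_f^-(0)}{N^{\frac{1-k}{2}}}\frac{1}{s-k+1}+\frac{c_g^-(0)i^k}{N^{\frac{1-k}{2}}}\frac{1}{1-s},$$ $$\Lambda_N^*(g,s)=\Lambda_N(g,s)+\frac{c_g^+(0)}{s}+\frac{c_f^+(0)i^{-k}}{k-s}+\frac{c_g^-(0)}{N^{\frac{1-k}{2}}}\frac{1}{s-k+1}+\frac{c_f^-(0)i^{-k}}{N^{\frac{1-k}{2}}}\frac{1}{1-s},$$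 $$\Omega_N^*(f,s)=\Omega_N(f,s)+k\left(\frac{c_f^+(0)}{s}-\frac{c_g^+(0)i^k}{k-s}+\frac{c_f^-(0)}{N^{\frac{1-k}{2}}}\frac{1}{s-k+1}-\frac{c_g^-(0)i^k}{N^{\frac{1-k}{2}}}\frac{1}{1-s}\right),$$ $$\Omega_N^*(g,s)=\Omega_N(g,s)+k\left(\frac{c_g^+(0)}{s}-\frac{c_f^+(0)i^{-k}}{k-s}+\frac{c_g^-(0)}{N^{\frac{1-k}{2}}}\frac{1}{s-k+1}-\frac{c_f^-(0)i^{-k}}{N^{\frac{1-k}{2}}}\frac{1}{1-s}\right).$$
   Context: Notation: $\tau=u+iv\in\mathbb H$ (upper half-plane), $q=e^{2\pi i\tau}$. $\Gamma(s,x)=\int_x^\infty e^{-t}t^{s-1}dt$ is the incomplete gamma function. $\omega(N)=\begin{pmatrix}0&-1\\N&0\end{pmatrix}$ and $(f|_k\omega(N))(\tau)=N^{k/2}(N\tau)^{-k}f(-1/(N\tau))$. For $\mathrm{Re}(s)>0$, $W_\nu(s)=\int_0^\infty\Gamma(\nu,2x)e^{x}x^{s}\frac{dx}{x}$. Put $L^+(f,s)=\sum_{n\ge1}c_f^+(n)n^{-s}$, $L^-(f,s)=\sum_{n\ge1}c_f^-(-n)n^{-s}$, and (initially for $\mathrm{Re}(s)$ large) $$\Lambda_N(f,s)=\left(\tfrac{\sqrt N}{2\pi}\right)^s[\Gamma(s)L^+(f,s)+W_{1-k}(s)L^-(f,s)],$$ $$\Xi_N(f,s)=\left(\tfrac{\sqrt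 N}{2\pi}\right)^s[\Gamma(s+1)L^+(f,s)-W_{1-k}(s+1)L^-(f,s)],$$ $$\Omega_N(f,s)=-2\,\Xi_N(f,s)+k\Lambda_N(f,s),$$ and similarly for $g$. *)

theory Defs
  imports "HOL-Complex_Analysis.Complex_Analysis" "HOL-Library.Landau_Symbols"
begin

definition inc_Gamma :: "complex \<Rightarrow> real \<Rightarrow> complex" where
  "inc_Gamma s x = (LBINT t:{x..}. of_real (exp (- t)) * of_real t powr (s - 1))"

definition W :: "complex \<Rightarrow> complex \<Rightarrow> complex" where
  "W \<nu> s = (LBINT x:{0<..}. inc_Gamma \<nu> (2 * x) * of_real (exp x) * of_real x powr s / of_real x)"

text \<open>The coefficients \<open>c\<^sup>+(n)\<close>, \<open>n \<ge> 0\<close>, and \<open>c\<^sup>-(n)\<close>, \<open>n \<le> 0\<close>, are given as functions \<open>cp\<close>, \<open>cm\<close>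
  on all integers; the values of \<open>cp\<close> at \<open>n < 0\<close> and of \<open>cm\<close> at \<open>n > 0\<close> are never used.\<close>

definition fourier_series :: "int \<Rightarrow> (int \<Rightarrow> complex) \<Rightarrow> (int \<Rightarrow> complex) \<Rightarrow> complex \<Rightarrow> complex" where
  "fourier_series k cp cm \<tau> =
     (let v = Im \<tau>; q = exp (2 * of_real pi * \<i> * \<tau>) in
       (\<Sum>\<^sub>\<infinity>n\<in>{0..}. cp n * q powi n)
       + cm 0 * of_real (v powi (1 - k))
       + (\<Sum>\<^sub>\<infinity>n\<in>{..<0}. cm n * inc_Gamma (of_int (1 - k)) (- 4 * pi * of_int n * v) * q powi n))"

definition slash_omega :: "int \<Rightarrow> nat \<Rightarrow> (complex \<Rightarrow> complex) \<Rightarrow> complex \<Rightarrow> complex" where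
  "slash_omega k N f \<tau> =
     of_real (real N powr (of_int k / 2)) * (of_nat N * \<tau>) powi (- k) * f (- 1 / (of_nat N * \<tau>))"

definition L_plus :: "(int \<Rightarrow> complex) \<Rightarrow> complex \<Rightarrow> complex" where
  "L_plus cp s = (\<Sum>\<^sub>\<infinity>n\<in>{1..}. cp n * of_int n powr (- s))"

definition L_minus :: "(int \<Rightarrow> complex) \<Rightarrow> complex \<Rightarrow> complex" where
  "L_minus cm s = (\<Sum>\<^sub>\<infinity>n\<in>{1..}. cm (- n) * of_int n powr (- s))"

text \<open>The following three are meaningful only for \<open>Re s\<close> large, where the Dirichlet series converge.\<close>

definition Lambda :: "int \<Rightarrow> nat \<Rightarrow> (int \<Rightarrow> complex) \<Rightarrow> (int \<Rightarrow> complex) \<Rightarrow> complex \<Rightarrow> complex" where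
  "Lambda k N cp cm s = of_real (sqrt (real N) / (2 * pi)) powr s *
     (Gamma s * L_plus cp s + W (of_int (1 - k)) s * L_minus cm s)"

definition Xi :: "int \<Rightarrow> nat \<Rightarrow> (int \<Rightarrow> complex) \<Rightarrow> (int \<Rightarrow> complex) \<Rightarrow> complex \<Rightarrow> complex" where
  "Xi k N cp cm s = of_real (sqrt (real N) / (2 * pi)) powr s *
     (Gamma (s + 1) * L_plus cp s - W (of_int (1 - k)) (s + 1) * L_minus cm s)"

definition Omega :: "int \<Rightarrow> nat \<Rightarrow> (int \<Rightarrow> complex) \<Rightarrow> (int \<Rightarrow> complex) \<Rightarrow> complex \<Rightarrow> complex" where
  "Omega k N cp cm s = - 2 * Xi k N cp cm s + of_int k * Lambda k N cp cm s"

text \<open>\<open>G\<close> is the meromorphic continuation to the whole plane of a function \<open>F\<close> given on some right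
  half-plane. By \<open>nicely_meromorphic_on\<close>, \<open>G\<close> is normalised to be continuous away from its
  poles and zero at its poles. Hence \<open>G\<close> is unique, and an identity such as
  \<open>G s = c * G' (k - s)\<close> between meromorphic functions holds at every point \<open>s\<close>.\<close>

definition meromorphic_continuation :: "(complex \<Rightarrow> complex) \<Rightarrow> (complex \<Rightarrow> complex) \<Rightarrow> bool" where
  "meromorphic_continuation F G \<longleftrightarrow>
     G nicely_meromorphic_on UNIV \<and> (\<exists>\<sigma>::real. \<forall>s. Re s > \<sigma> \<longrightarrow> G s = F s)"

text \<open>For a meromorphic \<open>F\<close> given by an expression whose terms may have cancelling poles: the
  pointwise value of the expression at such a pole is an artefact of \<open>x / 0 = 0\<close>, so \<open>F\<close> is
  replaced by its continuous extension there. At a genuine pole \<open>remove_sings F\<close> is not continuous.\<close>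

definition entire_bounded_in_strips :: "(complex \<Rightarrow> complex) \<Rightarrow> bool" where
  "entire_bounded_in_strips F \<longleftrightarrow>
     remove_sings F holomorphic_on UNIV \<and>
     (\<forall>a b. bounded (remove_sings F ` {s. a \<le> Re s \<and> Re s \<le> b}))"

end

theory Submission
  imports Defs
begin

text \<open>Since \<open>k\<close> is a negative integer, \<open>\<Gamma>(1 - k, x)\<close> is \<open>e\<^sup>-\<^sup>x\<close> times a polynomial in \<open>x\<close>. Hence on the
imaginary axis \<open>f\<close> and \<open>\<partial>f/\<partial>u\<close> are, up to two monomials, finite sums of exponential sums
\<open>\<Sum>\<^sub>n c(n) (\<lambda>nt)\<^sup>j e\<^sup>-\<^sup>\<lambda>\<^sup>n\<^sup>t\<close>, whose Mellin transforms are gamma factors times Dirichlet series. Up to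
scaling, \<open>\<Lambda>\<^sub>N(f, s)\<close> is the Mellin transform of \<open>f\<close> on the axis without its two monomials, and
\<open>\<Omega>\<^sub>N(f, s)\<close> is that of \<open>-2 (v/i) \<partial>f/\<partial>u + k f\<close>, again without its monomials (lemma \<open>completed_functions_are_mellin\<close>). The theorem
splits into two independent parts.

Hecke's correspondence (theorem \<open>hecke_correspondence\<close>). Let \<open>F(t) = a + b t\<^sup>1\<^sup>-\<^sup>k + P(t)\<close> and
\<open>G(t) = a' + b' t\<^sup>1\<^sup>-\<^sup>k + Q(t)\<close> with \<open>P\<close>, \<open>Q\<close> rapidly decreasing at infinity and of at most polynomial
growth at 0. The relation \<open>F(1/t) = \<epsilon> t\<^sup>k G(t)\<close> is equivalent to continuation, functional equation and
boundedness in strips of the Mellin transforms. Fold the half-line onto \<open>(0, 1]\<close> and let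
\<open>\<rho>(x) = F(x) - \<epsilon> x\<^sup>-\<^sup>k G(1/x)\<close> be the defect of the relation. For \<open>Re s\<close> large,
\<open>\<integral>\<^sub>0\<^sup>1 \<rho>(x) x\<^sup>s\<^sup>-\<^sup>1 dx\<close> is the Mellin transform of \<open>P\<close>, plus its polar part, minus an entire function bounded
in vertical strips. If \<open>\<rho> = 0\<close>, this gives the continuation. Conversely, by the hypotheses on the
continuation this integral extends to an entire function \<open>h\<close>: it is bounded in a right half-plane as an
integral, in a left half-plane by the functional equation, and in the strip between by hypothesis.
By Liouville's theorem \<open>h\<close> is constant, and it tends to 0 along the positive reals, so \<open>h = 0\<close>. Thus
all high moments of \<open>\<rho>\<close> vanish, and \<open>\<rho> = 0\<close> by Weierstrass approximation. This replaces Mellin inversion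
and the Phragmen-Lindelof principle by Liouville's theorem.

From the imaginary axis to the half-plane (lemmas \<open>vanishing_criterion\<close> and \<open>invariance_criterion\<close>).
Applied to \<open>f\<close> and to the combination with \<open>\<partial>f/\<partial>u\<close>, the correspondence translates the analytic conditions into
the vanishing on the imaginary axis of \<open>D = g - f|\<^sub>k\<omega>(N)\<close> and of \<open>\<partial>D/\<partial>u\<close>. Replacing \<open>\<tau>\<close> and its
conjugate by independent variables \<open>z\<close>, \<open>w\<close> turns \<open>D\<close> into a function \<open>D(z, w)\<close> holomorphic in each
variable, and harmonicity says that \<open>\<partial>D/\<partial>w = (z - w)\<^sup>-\<^sup>k B(w)\<close> with \<open>B\<close> holomorphic in \<open>w\<close> alone. If \<open>D\<close> and
\<open>\<partial>D/\<partial>u\<close> vanish on the axis, so does \<open>\<partial>D/\<partial>w\<close>, hence \<open>B\<close> vanishes on a ray and therefore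
identically. So \<open>D(z, w)\<close> does not depend on \<open>w\<close>, and being holomorphic in \<open>z\<close> and zero on a ray it is zero.\<close>

section \<open>Mellin transforms over the unit interval\<close>

lemma powr_integral_01:
  assumes "a > (0::real)"
  shows "set_integrable lborel {0<..1} (\<lambda>x. x powr (a - 1))"
    and "(LBINT x:{0<..1}. x powr (a - 1)) = 1 / a"
proof -
  have hi: "((\<lambda>x. x powr (a - 1)) has_integral 1 / a) {0..1}"
    using has_integral_powr_from_0[of "a - 1" 1] assms by simp
  have "(\<lambda>x. x powr (a - 1)) absolutely_integrable_on {0..1}"
    by (rule nonnegative_absolutely_integrable_1) (use hi in auto)
  then have "set_integrable lebesgue {0..1} (\<lambda>x. x powr (a - 1))" .
  then have "set_integrable lebesgue {0<..1} (\<lambda>x. x powr (a - 1))"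
    by (rule set_integrable_subset) auto
  then show i: "set_integrable lborel {0<..1} (\<lambda>x. x powr (a - 1))"
    unfolding set_integrable_def
    by (subst (asm) integrable_completion) auto
  have "((\<lambda>x. x powr (a - 1)) has_integral 1 / a) {0<..1}"
  proof (rule iffD1[OF has_integral_spike_set_eq hi])
    have "{x \<in> {0..1} - {0<..1}. x powr (a - 1) \<noteq> 0} \<subseteq> {0}" by auto
    then show "negligible {x \<in> {0..1} - {0<..1}. x powr (a - 1) \<noteq> 0}"
      by (rule negligible_subset[OF negligible_sing])
    have "{x \<in> {0<..1} - {0..1}. x powr (a - 1) \<noteq> 0} = {}" by auto
    then show "negligible {x \<in> {0<..1} - {0..1}. x powr (a - 1) \<noteq> 0}" by (simp only: negligible_empty)
  qed
  then show "(LBINT x:{0<..1}. x powr (a - 1)) = 1 / a"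
    using set_borel_integral_eq_integral(2)[OF i] by (simp add: integral_unique)
qed

definition mellin01 :: "(real \<Rightarrow> complex) \<Rightarrow> complex \<Rightarrow> complex" where
  "mellin01 r s = (LBINT x:{0<..1}. r x * of_real x powr (s - 1))"

lemma mellin01_bound:
  assumes cont: "continuous_on {0<..1} r"
    and bnd: "\<And>x. 0 < x \<Longrightarrow> x \<le> 1 \<Longrightarrow> norm (r x) \<le> C * x powr A" and s: "Re s + A > 0"
  shows "set_integrable lborel {0<..1} (\<lambda>x. r x * of_real x powr (s - 1))"
    and "norm (mellin01 r s) \<le> C / (Re s + A)"
proof -
  let ?g = "\<lambda>x. C * x powr (Re s + A - 1)"
  have gi: "set_integrable lborel {0<..1} ?g"
    using powr_integral_01(1)[OF s] by simp
  have c: "continuous_on {0<..1} (\<lambda>x. r x * of_real x powr (s - 1))"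
    by (intro continuous_intros cont) (auto simp: complex_nonpos_Reals_iff)
  have le: "norm (r x * of_real x powr (s - 1)) \<le> ?g x" if "0 < x" "x \<le> 1" for x
  proof -
    have "norm (r x * of_real x powr (s - 1)) \<le> C * x powr A * x powr (Re s - 1)"
      using bnd[OF that] that by (auto simp: norm_mult norm_powr_real_powr intro!: mult_right_mono)
    also have "\<dots> = ?g x" by (simp add: powr_add[symmetric] algebra_simps)
    finally show ?thesis .
  qed
  show i: "set_integrable lborel {0<..1} (\<lambda>x. r x * of_real x powr (s - 1))"
  proof (rule set_integrable_bound[OF gi])
    show "set_borel_measurable lborel {0<..1} (\<lambda>x. r x * of_real x powr (s - 1))"
      unfolding set_borel_measurable_def
      using borel_measurable_continuous_on_indicator[OF _ c] by (simp add: mult.commute)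
    show "AE x in lborel. x \<in> {0<..1} \<longrightarrow> norm (r x * of_real x powr (s - 1)) \<le> norm (?g x)"
      using le by (intro AE_I2) (use order.trans abs_ge_self in fastforce)
  qed
  have "norm (mellin01 r s) \<le> (LBINT x:{0<..1}. norm (r x * of_real x powr (s - 1)))"
    unfolding mellin01_def by (rule set_integral_norm_bound[OF i])
  also have "\<dots> \<le> (LBINT x:{0<..1}. ?g x)"
    by (rule set_integral_mono) (use le gi set_integrable_norm[OF i] in auto)
  also have "\<dots> = C / (Re s + A)"
    using powr_integral_01(2)[OF s] by simp
  finally show "norm (mellin01 r s) \<le> C / (Re s + A)" .
qed

text \<open>Away from 0 the integrand is jointly smooth, so differentiation under the integral sign applies. The
half-plane with parameter \<open>A\<close> is the domain on which the limit \<open>a \<rightarrow> 0\<close> is taken afterwards.\<close>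

lemma truncated_mellin_holomorphic:
  assumes cont: "continuous_on {0<..1} r" and a: "a > 0"
  shows "(\<lambda>s. integral (cbox a 1) (\<lambda>x. r x * of_real x powr (s - 1))) holomorphic_on {s. Re s + A > 0}"
proof (rule leibniz_rule_holomorphic)
  have cr: "continuous_on (cbox a 1) r"
    by (rule continuous_on_subset[OF cont]) (use a in auto)
  show "((\<lambda>s. r x * of_real x powr (s - 1)) has_field_derivative
      r x * (of_real x powr (s - 1) * Ln (of_real x))) (at s within {s. Re s + A > 0})"
    if "x \<in> cbox a 1" for s x
  proof -
    have "((\<lambda>s. of_real x powr (s - 1)) has_field_derivative
        (Ln (of_real x) * of_real x powr (s - 1)) * 1) (at s within {s. Re s + A > 0})"
      by (rule DERIV_chain2[OF has_field_derivative_powr_right])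
         (use that a in \<open>auto intro!: derivative_eq_intros\<close>)
    then show ?thesis
      by (intro DERIV_cmult) (simp add: mult.commute)
  qed
  show "(\<lambda>x. r x * of_real x powr (s - 1)) integrable_on cbox a 1" for s
    by (intro integrable_continuous continuous_intros cr) (use a in \<open>auto simp: complex_nonpos_Reals_iff\<close>)
  show "continuous_on ({s. 0 < Re s + A} \<times> cbox a 1)
     (\<lambda>(s, x). r x * (of_real x powr (s - 1) * Ln (of_real x)))"
    unfolding split_beta
    by (intro continuous_intros continuous_on_compose2[OF cr])
       (use a in \<open>auto simp: complex_nonpos_Reals_iff\<close>)
  show "convex {s. 0 < Re s + A}"
  proof -
    have "{s. 0 < Re s + A} = {s. - A < Re s}" by auto
    then show ?thesis using convex_halfspace_Re_gt[of "- A"] by simp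
  qed
qed

text \<open>The integral is the locally uniform limit of the integrals over \<open>[1/n, 1]\<close>, because the tail over
\<open>(0, 1/n)\<close> is small uniformly in \<open>s\<close> as long as \<open>Re s + A\<close> stays away from 0.\<close>

lemma mellin01_holomorphic:
  assumes cont: "continuous_on {0<..1} r"
    and bnd: "\<And>x. 0 < x \<Longrightarrow> x \<le> 1 \<Longrightarrow> norm (r x) \<le> C * x powr A"
  shows "mellin01 r holomorphic_on {s. Re s + A > 0}"
proof (rule holomorphic_uniform_sequence)
  define F where "F n s = integral (cbox (1 / real (Suc n)) 1) (\<lambda>x. r x * of_real x powr (s - 1))" for n s
  show op: "open {s. Re s + A > 0}"
    by (intro open_Collect_less continuous_intros)
  show "F n holomorphic_on {s. Re s + A > 0}" for n
    unfolding F_def by (rule truncated_mellin_holomorphic[OF cont]) auto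
  show "\<exists>d>0. cball z d \<subseteq> {s. 0 < Re s + A} \<and> uniform_limit (cball z d) F (mellin01 r) sequentially"
    if z: "z \<in> {s. 0 < Re s + A}" for z
  proof (intro exI conjI)
    define d where "d = (Re z + A) / 2"
    show "d > 0" using z by (simp add: d_def)
    have lb: "Re s + A \<ge> d" if "s \<in> cball z d" for s
      using that abs_Re_le_cmod[of "z - s"] by (auto simp: dist_norm d_def field_simps)
    show "cball z d \<subseteq> {s. 0 < Re s + A}" using lb \<open>d > 0\<close> by fastforce
    have C0: "C \<ge> 0" using bnd[of 1] norm_ge_zero[of "r 1"] by (simp del: norm_ge_zero)
    \<comment> \<open>On the disc the exponent \<open>Re s + A\<close> is at least \<open>d\<close>. Half of \<open>d\<close> makes the tail integrable,
      the other half makes it tend to 0.\<close>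
    have est: "norm (mellin01 r s - F n s) \<le> C / (d/2) * (1 / real (Suc n)) powr (d/2)" if s: "s \<in> cball z d" for s n
    proof -
      let ?h = "\<lambda>x. r x * of_real x powr (s - 1)" and ?e = "1 / real (Suc n)"
      have s0: "Re s + A > 0" using lb[OF s] \<open>d > 0\<close> by linarith
      have d2: "d / 2 > 0" using \<open>d > 0\<close> by simp
      note i = mellin01_bound(1)[OF cont bnd s0]
      have e01: "0 < ?e" "?e \<le> 1" by simp_all
      have "{0<..<e} \<subseteq> {0<..1} \<and> {e..1} \<subseteq> {0<..1} \<and> {0<..1} = {0<..<e} \<union> {e..1}"
        if "0 < e" "e \<le> 1" for e :: real using that by auto
      from this[OF e01] have sub: "{0<..<?e} \<subseteq> {0<..1::real}" "{?e..1} \<subseteq> {0<..1::real}"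
        and un: "{0<..1} = {0<..<?e} \<union> {?e..1}" by blast+
      have i1: "set_integrable lborel {0<..<?e} ?h" and i2: "set_integrable lborel {?e..1} ?h"
        using set_integrable_subset[OF i] sub by auto
      have ind: "indicat_real {0<..<e} x *\<^sub>R a \<le> indicat_real {0<..1} x *\<^sub>R b"
        if "0 < x \<Longrightarrow> x < e \<Longrightarrow> a \<le> b" "b \<ge> 0" "e \<le> 1" for a b e x :: real
        using that by (auto simp: indicator_def)
      have "mellin01 r s = (LBINT x:{0<..<?e}. ?h x) + (LBINT x:{?e..1}. ?h x)"
        unfolding mellin01_def un by (rule set_integral_Un) (use i1 i2 in auto)
      also have "(LBINT x:{?e..1}. ?h x) = F n s"
        using set_borel_integral_eq_integral(2)[OF i2] by (simp add: F_def)
      finally have "norm (mellin01 r s - F n s) = norm (LBINT x:{0<..<?e}. ?h x)" by simp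
      also have "\<dots> \<le> (LBINT x:{0<..<?e}. norm (?h x))"
        by (rule set_integral_norm_bound[OF i1])
      also have "\<dots> \<le> (LBINT x:{0<..1}. C * ?e powr (d/2) * x powr (d/2 - 1))"
        unfolding set_lebesgue_integral_def
      proof (rule integral_mono)
        show "integrable lborel (\<lambda>x. indicat_real {0<..<?e} x *\<^sub>R norm (?h x))"
          using set_integrable_norm[OF i1] by (simp add: set_integrable_def)
        show "integrable lborel (\<lambda>x. indicat_real {0<..1} x *\<^sub>R (C * ?e powr (d/2) * x powr (d/2 - 1)))"
          using set_integrable_mult_right[OF powr_integral_01(1)[OF d2], of "C * ?e powr (d/2)"]
          by (simp add: set_integrable_def)
        fix x :: real
        have "norm (?h x) \<le> C * ?e powr (d/2) * x powr (d/2 - 1)" if x: "0 < x" "x < ?e"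
        proof -
          have x1: "x \<le> 1" using x e01 by linarith
          have "norm (?h x) \<le> C * x powr A * x powr (Re s - 1)"
            using bnd[OF x(1) x1] x by (auto simp: norm_mult norm_powr_real_powr intro!: mult_right_mono)
          also have "\<dots> = C * x powr (Re s + A - d/2) * x powr (d/2 - 1)"
            by (simp add: powr_add[symmetric] algebra_simps)
          also have "\<dots> \<le> C * x powr (d/2) * x powr (d/2 - 1)"
            using x x1 lb[OF s] C0 by (intro mult_right_mono mult_left_mono powr_mono') auto
          also have "\<dots> \<le> C * ?e powr (d/2) * x powr (d/2 - 1)"
            using x C0 \<open>d > 0\<close> by (intro mult_right_mono mult_left_mono powr_mono2) auto
          finally show ?thesis .
        qed
        then show "indicat_real {0<..<?e} x *\<^sub>R norm (?h x)
            \<le> indicat_real {0<..1} x *\<^sub>R (C * ?e powr (d/2) * x powr (d/2 - 1))"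
          using ind[OF _ _ e01(2), where a = "norm (?h x)" and b = "C * ?e powr (d/2) * x powr (d/2 - 1)"] C0
          by simp
      qed
      also have "\<dots> = C / (d/2) * ?e powr (d/2)"
        using powr_integral_01(2)[OF d2] by simp
      finally show ?thesis .
    qed
    have "(\<lambda>n. C / (d/2) * (1 / real (Suc n)) powr (d/2)) \<longlonglongrightarrow> C / (d/2) * 0"
    proof (intro tendsto_mult tendsto_const)
      have "(\<lambda>n. 1 / real (Suc n)) \<longlonglongrightarrow> 0" using lim_inverse_n' LIMSEQ_Suc by blast
      then show "(\<lambda>n. (1 / real (Suc n)) powr (d/2)) \<longlonglongrightarrow> 0"
        by (rule tendsto_zero_powrI[OF _ tendsto_const]) (use \<open>d > 0\<close> in auto)
    qed
    then have lim: "(\<lambda>n. C / (d/2) * (1 / real (Suc n)) powr (d/2)) \<longlonglongrightarrow> 0" by simp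
    show "uniform_limit (cball z d) F (mellin01 r) sequentially"
    proof (rule uniform_limitI)
      fix e :: real assume "e > 0"
      have "\<forall>\<^sub>F n in sequentially. C / (d/2) * (1 / real (Suc n)) powr (d/2) < e"
        using order_tendstoD(2)[OF lim \<open>e > 0\<close>] .
      then show "\<forall>\<^sub>F n in sequentially. \<forall>s\<in>cball z d. dist (F n s) (mellin01 r s) < e"
      proof eventually_elim
        case (elim n)
        show ?case
          using le_less_trans[OF est elim] by (simp add: dist_norm norm_minus_commute del: of_nat_Suc)
      qed
    qed
  qed
qed

section \<open>Inversion of the variable and determination by moments\<close>

lemma inversion_integral_real:
  fixes f :: "real \<Rightarrow> real"
  assumes cont: "continuous_on {1..} f"
    and i: "set_integrable lborel {0<..1} (\<lambda>x. f (1 / x) / x\<^sup>2)"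
  shows "set_integrable lborel {1..} f" "(LBINT t:{1..}. f t) = (LBINT x:{0<..1}. f (1 / x) / x\<^sup>2)"
proof -
  have img: "(\<lambda>x. 1 / x) ` {0<..1} = {1::real..}"
  proof (intro equalityI subsetI)
    fix y :: real assume "y \<in> {1..}"
    then show "y \<in> (\<lambda>x. 1 / x) ` {0<..1}" by (intro image_eqI[of _ _ "1 / y"]) auto
  qed auto
  have ai: "(\<lambda>x. \<bar>- (1 / x\<^sup>2)\<bar> * f (1 / x)) absolutely_integrable_on {0<..1}"
    using set_integrable_subset[OF i] i unfolding set_integrable_def
    by (simp add: integrable_completion mult.commute divide_inverse borel_measurable_integrable)
  have "f absolutely_integrable_on ((\<lambda>x. 1 / x) ` {0<..1}) \<and>
      integral ((\<lambda>x. 1 / x) ` {0<..1}) f = integral {0<..1} (\<lambda>x. \<bar>- (1 / x\<^sup>2)\<bar> * f (1 / x))"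
  proof (subst has_absolute_integral_change_of_variables_1'[symmetric])
    show "((\<lambda>x. 1 / x) has_real_derivative - (1 / x\<^sup>2)) (at x within {0<..1})" if "x \<in> {0<..1}" for x :: real
      using that by (auto intro!: derivative_eq_intros simp: power2_eq_square)
    show "inj_on (\<lambda>x::real. 1 / x) {0<..1}" by (auto simp: inj_on_def)
    show "{0<..1::real} \<in> sets lebesgue" by simp
  qed (use ai in auto)
  then have a: "f absolutely_integrable_on {1..}" 
    and e: "integral {1..} f = integral {0<..1} (\<lambda>x. \<bar>- (1 / x\<^sup>2)\<bar> * f (1 / x))"
    unfolding img by auto
  show si: "set_integrable lborel {1..} f"
    using a unfolding set_integrable_def
    by (subst (asm) integrable_completion)
       (use borel_measurable_continuous_on_indicator[OF _ cont] in \<open>simp_all\<close>)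
  show "(LBINT t:{1..}. f t) = (LBINT x:{0<..1}. f (1 / x) / x\<^sup>2)"
    using set_borel_integral_eq_integral(2)[OF si] set_borel_integral_eq_integral(2)[OF i] e
    by (simp add: mult.commute)
qed

lemma inversion_integral:
  fixes f :: "real \<Rightarrow> complex"
  assumes cont: "continuous_on {1..} f"
    and i: "set_integrable lborel {0<..1} (\<lambda>x. f (1 / x) / of_real (x\<^sup>2))"
  shows "set_integrable lborel {1..} f" "(LBINT t:{1..}. f t) = (LBINT x:{0<..1}. f (1 / x) / of_real (x\<^sup>2))"
proof -
  have iR: "set_integrable lborel {0<..1} (\<lambda>x. Re (f (1 / x)) / x\<^sup>2)"
    using integrable_Re[OF i[unfolded set_integrable_def]] by (simp add: set_integrable_def flip: of_real_power)
  have iI: "set_integrable lborel {0<..1} (\<lambda>x. Im (f (1 / x)) / x\<^sup>2)"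
    using integrable_Im[OF i[unfolded set_integrable_def]] by (simp add: set_integrable_def flip: of_real_power)
  note R = inversion_integral_real[OF continuous_on_Re[OF cont] iR]
  note I = inversion_integral_real[OF continuous_on_Im[OF cont] iI]
  have "set_integrable lborel {1..} (\<lambda>t. complex_of_real (Re (f t)) + \<i> * complex_of_real (Im (f t)))"
  proof (intro set_integral_add set_integrable_mult_right impI)
    show "set_integrable lborel {1..} (\<lambda>t. complex_of_real (Re (f t)))"
      using integrable_of_real[OF R(1)[unfolded set_integrable_def], where 'a = complex]
      by (simp add: set_integrable_def scaleR_conv_of_real)
    show "set_integrable lborel {1..} (\<lambda>t. complex_of_real (Im (f t)))"
      using integrable_of_real[OF I(1)[unfolded set_integrable_def], where 'a = complex]
      by (simp add: set_integrable_def scaleR_conv_of_real)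
  qed
  then show fi: "set_integrable lborel {1..} f"
    by (simp add: complex_eq[symmetric])
  show "(LBINT t:{1..}. f t) = (LBINT x:{0<..1}. f (1 / x) / of_real (x\<^sup>2))" 
  proof (rule complex_eqI)
    show "Re (LBINT t:{1..}. f t) = Re (LBINT x:{0<..1}. f (1 / x) / of_real (x\<^sup>2))"
      using R(2) integral_Re[OF fi[unfolded set_integrable_def]] integral_Re[OF i[unfolded set_integrable_def]]
      by (simp add: set_lebesgue_integral_def flip: of_real_power)
    show "Im (LBINT t:{1..}. f t) = Im (LBINT x:{0<..1}. f (1 / x) / of_real (x\<^sup>2))"
      using I(2) integral_Im[OF fi[unfolded set_integrable_def]] integral_Im[OF i[unfolded set_integrable_def]]
      by (simp add: set_lebesgue_integral_def flip: of_real_power)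
  qed
qed

text \<open>By Weierstrass, \<open>u\<close> is a uniform limit of polynomials \<open>p\<close>, and \<open>\<integral> u p = 0\<close>; hence \<open>\<integral> u\<^sup>2 = 0\<close>.\<close>

lemma moments_zero_real:
  fixes u :: "real \<Rightarrow> real"
  assumes cont: "continuous_on {0..1} u" and mom: "\<And>n::nat. integral {0..1} (\<lambda>x. u x * x ^ n) = 0"
    and x: "x \<in> {0..1}"
  shows "u x = 0"
proof -
  have ui: "(\<lambda>x. u x * p x) integrable_on {0..1}" if "continuous_on {0..1} p" for p
    by (intro integrable_continuous_real continuous_intros cont that)
  have pz: "integral {0..1} (\<lambda>x. u x * p x) = 0" if "real_polynomial_function p" for p
  proof -
    from that obtain a n where p: "p = (\<lambda>x. \<Sum>i\<le>n. a i * x ^ i)"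
      using real_polynomial_function_iff_sum by blast
    have "integral {0..1} (\<lambda>x. u x * p x) = integral {0..1} (\<lambda>x. \<Sum>i\<le>n. a i * (u x * x ^ i))"
      unfolding p by (simp add: sum_distrib_left mult_ac)
    also have "\<dots> = (\<Sum>i\<le>n. integral {0..1} (\<lambda>x. a i * (u x * x ^ i)))"
      by (intro integral_sum) (auto intro!: integrable_continuous_real continuous_intros cont)
    also have "\<dots> = 0" using mom by simp
    finally show ?thesis .
  qed
  obtain M where M: "\<And>x. x \<in> {0..1} \<Longrightarrow> \<bar>u x\<bar> \<le> M" and "M > 0"
    using compact_imp_bounded[OF compact_continuous_image[OF cont]] unfolding bounded_pos by fastforce
  have "integral {0..1} (\<lambda>x. u x * u x) \<le> 0"
  proof (rule field_le_epsilon)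
    fix e :: real assume e: "e > 0"
    obtain p where p: "real_polynomial_function p" "\<And>x. x \<in> {0..1} \<Longrightarrow> \<bar>u x - p x\<bar> < e / M"
      using Stone_Weierstrass_real_polynomial_function[OF _ cont, of "e / M"] e \<open>M > 0\<close> by auto
    have pc: "continuous_on {0..1} p"
      by (intro continuous_at_imp_continuous_on ballI continuous_real_polymonial_function p(1))
    have "integral {0..1} (\<lambda>x. u x * u x) = integral {0..1} (\<lambda>x. u x * (u x - p x))"
      using integral_diff[OF ui[OF cont] ui[OF pc]] pz[OF p(1)] by (simp add: algebra_simps)
    also have "\<dots> \<le> integral {0..1} (\<lambda>x::real. e)"
    proof (rule integral_le)
      show "(\<lambda>x. u x * (u x - p x)) integrable_on {0..1}" by (intro ui continuous_intros cont pc)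
      fix x :: real assume x: "x \<in> {0..1}"
      have "u x * (u x - p x) \<le> \<bar>u x\<bar> * \<bar>u x - p x\<bar>" by (metis abs_ge_self abs_mult)
      also have "\<dots> \<le> M * (e / M)" using M[OF x] p(2)[OF x] \<open>M > 0\<close> by (intro mult_mono) auto
      finally show "u x * (u x - p x) \<le> e" using \<open>M > 0\<close> by simp
    qed auto
    finally show "integral {0..1} (\<lambda>x. u x * u x) \<le> 0 + e" by simp
  qed
  moreover have "integral {0..1} (\<lambda>x. u x * u x) \<ge> 0"
    by (rule integral_nonneg) (use ui[OF cont] in auto)
  ultimately have "((\<lambda>x. u x * u x) has_integral 0) (cbox 0 1)"
    using integrable_integral[OF ui[OF cont]] by simp
  then have "u x * u x = 0"
    using x by (intro has_integral_0_cbox_imp_0[of 0 1 "\<lambda>x. u x * u x"]) (auto intro!: continuous_intros cont)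
  then show ?thesis by simp
qed

section \<open>Calculus and uniqueness for truncated Mellin transforms\<close>

text \<open>Integrability and value are carried together, since the value of a sum is the sum of the values only
under integrability.\<close>

definition has_mellin01 :: "(real \<Rightarrow> complex) \<Rightarrow> complex \<Rightarrow> complex \<Rightarrow> bool" where
  "has_mellin01 r s v \<longleftrightarrow>
     set_integrable lborel {0<..1} (\<lambda>x. r x * of_real x powr (s - 1)) \<and> mellin01 r s = v"

lemma has_mellin01_cong:
  assumes "\<And>x. 0 < x \<Longrightarrow> x \<le> 1 \<Longrightarrow> r x = r' x"
  shows "has_mellin01 r s v \<longleftrightarrow> has_mellin01 r' s v"
  unfolding has_mellin01_def mellin01_def
  by (intro arg_cong2[of _ _ _ _ "(\<and>)"] set_integrable_cong arg_cong2[of _ _ _ _ "(=)"] set_lebesgue_integral_cong)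
     (use assms in auto)

lemma has_mellin01_add:
  "has_mellin01 r s v \<Longrightarrow> has_mellin01 r' s v' \<Longrightarrow> has_mellin01 (\<lambda>x. r x + r' x) s (v + v')"
  unfolding has_mellin01_def mellin01_def by (auto simp: distrib_right set_integral_add)

lemma has_mellin01_cmult:
  "has_mellin01 r s v \<Longrightarrow> has_mellin01 (\<lambda>x. c * r x) s (c * v)"
  unfolding has_mellin01_def mellin01_def by (auto simp: mult.assoc)

lemma has_mellin01_shift:
  assumes "has_mellin01 r (s + c) v"
  shows "has_mellin01 (\<lambda>x. of_real x powr c * r x) s v"
proof -
  have "of_real x powr c * r x * of_real x powr (s - 1) = r x * of_real x powr (s + c - 1)" for x :: real
    by (simp add: powr_add powr_diff add_diff_eq[symmetric])
  then show ?thesis using assms by (simp only: has_mellin01_def mellin01_def)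
qed

lemma has_mellin01_one:
  assumes s: "Re s > 0"
  shows "has_mellin01 (\<lambda>_. 1) s (1 / s)"
proof -
  have s0: "s \<noteq> 0" using s by auto
  have i: "set_integrable lborel {0<..1} (\<lambda>x. 1 * complex_of_real x powr (s - 1))"
    by (rule mellin01_bound(1)[where C = 1 and A = 0]) (use s in \<open>auto intro: continuous_intros\<close>)
  have "((\<lambda>x. of_real x powr (s - 1)) has_integral
      (complex_of_real 1 powr s / s - complex_of_real 0 powr s / s)) {0..1}"
  proof (rule fundamental_theorem_of_calculus_interior)
    show "continuous_on {0..1} (\<lambda>x. complex_of_real x powr s / s)"
      by (intro continuous_intros continuous_on_powr_complex) (use s s0 in auto)
    show "((\<lambda>x. complex_of_real x powr s / s) has_vector_derivative of_real x powr (s - 1)) (at x)"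
      if "x \<in> {0<..<1}" for x
    proof -
      have "((\<lambda>z. z powr s / s) has_field_derivative of_real x powr (s - 1)) (at (of_real x))"
        using that s0 by (auto intro!: derivative_eq_intros simp: complex_nonpos_Reals_iff)
      then show ?thesis
        by (rule has_vector_derivative_real_field)
    qed
  qed auto
  then have hi: "((\<lambda>x. of_real x powr (s - 1)) has_integral 1 / s) {0..1}" by simp
  have "((\<lambda>x. of_real x powr (s - 1)) has_integral 1 / s) {0<..1}"
  proof (rule iffD1[OF has_integral_spike_set_eq hi])
    have "{x \<in> {0..1} - {0<..1}. complex_of_real x powr (s - 1) \<noteq> 0} \<subseteq> {0}" by auto
    then show "negligible {x \<in> {0..1} - {0<..1}. complex_of_real x powr (s - 1) \<noteq> 0}"
      by (rule negligible_subset[OF negligible_sing])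
    have "{x \<in> {0<..1} - {0..1}. complex_of_real x powr (s - 1) \<noteq> 0} = {}" by auto
    then show "negligible {x \<in> {0<..1} - {0..1}. complex_of_real x powr (s - 1) \<noteq> 0}"
      by (simp only: negligible_empty)
  qed
  then show ?thesis
    using i set_borel_integral_eq_integral(2)[OF i]
    by (simp add: has_mellin01_def mellin01_def integral_unique)
qed

lemma has_mellin01_powi:
  assumes "Re s + of_int n > 0"
  shows "has_mellin01 (\<lambda>x. of_real (x powi n)) s (1 / (s + of_int n))"
proof -
  have "has_mellin01 (\<lambda>x. of_real x powr of_int n * 1) s (1 / (s + of_int n))"
    by (rule has_mellin01_shift, rule has_mellin01_one) (use assms in simp)
  then show ?thesis
    by (subst has_mellin01_cong[where r' = "\<lambda>x. of_real x powr of_int n * 1"])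
       (auto simp: complex_powr_of_int)
qed

text \<open>The transform at \<open>s = M + n + 1\<close> is the \<open>n\<close>-th moment of \<open>r(x) x\<^sup>M\<close>, which for \<open>M\<close> large is continuous on
the closed interval.\<close>

lemma mellin01_eq_0_imp_eq_0:
  fixes r :: "real \<Rightarrow> complex"
  assumes cont: "continuous_on {0<..} r"
    and bnd: "\<And>x. 0 < x \<Longrightarrow> x \<le> 1 \<Longrightarrow> norm (r x) \<le> C * x powr A"
    and zero: "\<And>s. Re s > \<sigma> \<Longrightarrow> has_mellin01 r s 0"
    and x: "0 < x" "x \<le> 1"
  shows "r x = 0"
proof -
  \<comment> \<open>Large enough for the evaluation points to lie right of \<open>\<sigma>\<close> and for \<open>r(x) x\<^sup>M\<close> to be \<open>O(x)\<close> at 0.\<close>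
  define M where "M = nat \<lceil>max \<bar>\<sigma>\<bar> \<bar>A\<bar>\<rceil> + 1"
  have M: "real M \<ge> \<bar>\<sigma>\<bar> + 1" "real M \<ge> \<bar>A\<bar> + 1" unfolding M_def by linarith+
  define u where "u x = r x * of_real x ^ M" for x
  have C0: "C \<ge> 0" using bnd[of 1] norm_ge_zero[of "r 1"] by (simp del: norm_ge_zero)
  have u_le: "norm (u x) \<le> C * x" if "0 \<le> x" "x \<le> 1" for x
  proof (cases "x = 0")
    case True
    then show ?thesis by (simp add: u_def M_def)
  next
    case False
    then have x: "x > 0" using that by simp
    have "norm (u x) \<le> C * x powr A * x powr (real M)"
      using bnd[OF x that(2)] x by (auto simp: u_def norm_mult norm_power powr_realpow intro!: mult_right_mono)
    also have "\<dots> = C * x powr (A + M)" by (simp add: powr_add)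
    also have "\<dots> \<le> C * x powr 1"
      using x that M C0 by (intro mult_left_mono powr_mono') auto
    finally show ?thesis using x by simp
  qed
  have uc: "continuous_on {0..1} u"
    unfolding continuous_on_eq_continuous_within
  proof
    fix x :: real assume x: "x \<in> {0..1}"
    show "continuous (at x within {0..1}) u"
    proof (cases "x = 0")
      case True
      have "(u \<longlongrightarrow> 0) (at 0 within {0..1})"
      proof (rule Lim_null_comparison)
        show "\<forall>\<^sub>F x in at 0 within {0..1}. norm (u x) \<le> C * x"
          using u_le by (auto simp: eventually_at_filter)
        show "((\<lambda>x. C * x) \<longlongrightarrow> 0) (at 0 within {0..1})"
          by (auto intro!: tendsto_eq_intros)
      qed
      then show ?thesis using True by (simp add: continuous_within u_def M_def)
    next
      case False
      then have "isCont r x" using cont x by (simp add: continuous_on_eq_continuous_at)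
      then have "isCont u x" unfolding u_def by (intro continuous_intros)
      then show ?thesis by (rule continuous_at_imp_continuous_within)
    qed
  qed
  have mom: "integral {0..1} (\<lambda>x. u x * of_real x ^ n) = 0" for n
  proof -
    let ?s = "of_nat (M + n) + 1 :: complex"
    have h: "has_mellin01 r ?s 0" using M by (intro zero) auto
    then have i: "set_integrable lborel {0<..1} (\<lambda>x. r x * of_real x powr (?s - 1))"
      and z: "mellin01 r ?s = 0" by (auto simp: has_mellin01_def)
    have "integral {0..1} (\<lambda>x. u x * of_real x ^ n) = integral {0<..1} (\<lambda>x. u x * of_real x ^ n)"
    proof (rule integral_spike_set)
      have "{x \<in> {0..1} - {0<..1}. u x * of_real x ^ n \<noteq> 0} \<subseteq> {0}" by auto
      then show "negligible {x \<in> {0..1} - {0<..1}. u x * of_real x ^ n \<noteq> 0}"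
        by (rule negligible_subset[OF negligible_sing])
      have "{x \<in> {0<..1} - {0..1}. u x * of_real x ^ n \<noteq> 0} = {}" by auto
      then show "negligible {x \<in> {0<..1} - {0..1}. u x * of_real x ^ n \<noteq> 0}"
        by (simp only: negligible_empty)
    qed
    also have "\<dots> = integral {0<..1} (\<lambda>x. r x * of_real x powr (?s - 1))"
    proof (rule integral_cong)
      fix x :: real assume "x \<in> {0<..1}"
      then have "of_real x powr (?s - 1) = (of_real x :: complex) ^ (M + n)"
        using powr_nat'[of "of_real x" "M + n"] by simp
      then show "u x * of_real x ^ n = r x * of_real x powr (?s - 1)"
        by (simp only: u_def power_add mult.assoc)
    qed
    also have "\<dots> = 0"
      using z set_borel_integral_eq_integral(2)[OF i] by (simp add: mellin01_def)
    finally show ?thesis .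
  qed
  have ui: "(\<lambda>x. u x * of_real x ^ n) integrable_on {0..1}" for n
    by (intro integrable_continuous_real continuous_intros uc)
  have "Re (u x) = 0"
  proof (rule moments_zero_real[of "\<lambda>x. Re (u x)"])
    show "integral {0..1} (\<lambda>x. Re (u x) * x ^ n) = 0" for n
      using integral_linear[OF ui bounded_linear_Re, of n] mom[of n] by (simp add: o_def flip: of_real_power)
  qed (use x in \<open>auto intro!: continuous_intros uc\<close>)
  moreover have "Im (u x) = 0"
  proof (rule moments_zero_real[of "\<lambda>x. Im (u x)"])
    show "integral {0..1} (\<lambda>x. Im (u x) * x ^ n) = 0" for n
      using integral_linear[OF ui bounded_linear_Im, of n] mom[of n] by (simp add: o_def flip: of_real_power)
  qed (use x in \<open>auto intro!: continuous_intros uc\<close>)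
  ultimately have "u x = 0" by (simp add: complex_eq_iff)
  then show ?thesis using x by (simp add: u_def)
qed

section \<open>Functions of rapid decay on the half-line\<close>

text \<open>One condition expresses both rapid decay at infinity (large \<open>B\<close>) and polynomial growth at 0 (one
fixed \<open>B\<close>). In this form it is inherited by sums, and it can be checked for a series by a single
estimate of its terms.\<close>

definition rapid_decay :: "(real \<Rightarrow> complex) \<Rightarrow> bool" where
  "rapid_decay P \<longleftrightarrow> continuous_on {0<..} P \<and>
     (\<exists>A. \<forall>B\<ge>A. \<exists>C. \<forall>t>0. norm (P t) \<le> C * t powr (- B))"

lemma rapid_decay_add:
  assumes "rapid_decay P" "rapid_decay Q"
  shows "rapid_decay (\<lambda>t. P t + Q t)"
proof -
  from assms obtain A A' where
    A: "\<And>B. B \<ge> A \<Longrightarrow> \<exists>C. \<forall>t>0. norm (P t) \<le> C * t powr (- B)" and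
    A': "\<And>B. B \<ge> A' \<Longrightarrow> \<exists>C. \<forall>t>0. norm (Q t) \<le> C * t powr (- B)"
    unfolding rapid_decay_def by metis
  have "\<exists>C. \<forall>t>0. norm (P t + Q t) \<le> C * t powr (- B)" if "B \<ge> max A A'" for B
  proof -
    obtain C C' where "\<And>t. t > 0 \<Longrightarrow> norm (P t) \<le> C * t powr (- B)"
        "\<And>t. t > 0 \<Longrightarrow> norm (Q t) \<le> C' * t powr (- B)"
      using A[of B] A'[of B] \<open>B \<ge> max A A'\<close> by auto
    then show ?thesis
      by (intro exI[of _ "C + C'"]) (auto simp: distrib_right intro!: norm_triangle_le add_mono)
  qed
  then show ?thesis
    using assms unfolding rapid_decay_def by (intro conjI continuous_intros exI[of _ "max A A'"]) auto
qed

lemma rapid_decay_cmult: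
  assumes "rapid_decay P"
  shows "rapid_decay (\<lambda>t. c * P t)"
proof -
  from assms obtain A where
    A: "\<And>B. B \<ge> A \<Longrightarrow> \<exists>C. \<forall>t>0. norm (P t) \<le> C * t powr (- B)"
    unfolding rapid_decay_def by metis
  have "\<exists>C. \<forall>t>0. norm (c * P t) \<le> C * t powr (- B)" if "B \<ge> A" for B
  proof -
    obtain C where "\<And>t. t > 0 \<Longrightarrow> norm (P t) \<le> C * t powr (- B)"
      using A[OF \<open>B \<ge> A\<close>] by auto
    then show ?thesis
      by (intro exI[of _ "norm c * C"]) (auto simp: norm_mult mult.assoc intro!: mult_left_mono)
  qed
  then show ?thesis
    using assms unfolding rapid_decay_def by (intro conjI continuous_intros exI[of _ A]) auto
qed

lemma rapid_decay_0: "rapid_decay (\<lambda>_. 0)"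
  unfolding rapid_decay_def by (auto intro!: exI[of _ 0])

lemma rapid_decay_sum: "finite I \<Longrightarrow> (\<And>i. i \<in> I \<Longrightarrow> rapid_decay (P i)) \<Longrightarrow> rapid_decay (\<lambda>t. \<Sum>i\<in>I. P i t)"
  by (induction I rule: finite_induct) (auto intro: rapid_decay_0 rapid_decay_add)

lemma rapid_decay_bound_near_0:
  assumes "rapid_decay P"
  obtains C A where "\<And>t. 0 < t \<Longrightarrow> norm (P t) \<le> C * t powr (- A)"
  using assms unfolding rapid_decay_def by (metis order.refl)

lemma rapid_decay_inverse_bound:
  assumes "rapid_decay P"
  obtains C where "\<And>x. 0 < x \<Longrightarrow> x \<le> 1 \<Longrightarrow> norm (P (1 / x)) \<le> C * x powr r"
proof -
  from assms obtain A where
    A: "\<And>B. B \<ge> A \<Longrightarrow> \<exists>C. \<forall>t>0. norm (P t) \<le> C * t powr (- B)"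
    unfolding rapid_decay_def by metis
  obtain C where C: "\<And>t. t > 0 \<Longrightarrow> norm (P t) \<le> C * t powr (- max A r)"
    using A[of "max A r"] by auto
  have "C \<ge> 0" using C[of 1] norm_ge_zero[of "P 1"] by (simp del: norm_ge_zero)
  show ?thesis
  proof (rule that)
    fix x :: real assume x: "0 < x" "x \<le> 1"
    have "norm (P (1 / x)) \<le> C * (1 / x) powr (- max A r)" using C[of "1 / x"] x by simp
    also have "(1 / x) powr (- max A r) = x powr max A r"
      using x by (simp add: powr_minus_divide powr_divide)
    also have "C * x powr max A r \<le> C * x powr r"
      using x \<open>C \<ge> 0\<close> by (intro mult_left_mono powr_mono') auto
    finally show "norm (P (1 / x)) \<le> C * x powr r" .
  qed
qed

lemma rapid_decay_continuous_on: "rapid_decay P \<Longrightarrow> continuous_on {0<..} P"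
  by (simp add: rapid_decay_def)

lemma rapid_decay_inverse_continuous_on:
  assumes "rapid_decay P"
  shows "continuous_on {0<..} (\<lambda>x. P (1 / x))"
  by (rule continuous_on_compose2[OF rapid_decay_continuous_on[OF assms]]) (auto intro!: continuous_intros)

lemma rapid_decay_inverse_has_mellin01:
  assumes "rapid_decay P"
  shows "has_mellin01 (\<lambda>x. P (1 / x)) s (mellin01 (\<lambda>x. P (1 / x)) s)"
proof -
  obtain C where C: "\<And>x. 0 < x \<Longrightarrow> x \<le> 1 \<Longrightarrow> norm (P (1 / x)) \<le> C * x powr (1 - Re s)"
    using rapid_decay_inverse_bound[OF assms] by blast
  have "continuous_on {0<..1} (\<lambda>x. P (1 / x))"
    by (rule continuous_on_subset[OF rapid_decay_inverse_continuous_on[OF assms]]) auto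
  from mellin01_bound(1)[OF this C] show ?thesis by (simp add: has_mellin01_def)
qed

text \<open>\<open>P(1/x)\<close> vanishes to infinite order at 0, so the half-plane of holomorphy is arbitrarily large.\<close>

lemma rapid_decay_inverse_mellin01_entire:
  assumes "rapid_decay P"
  shows "mellin01 (\<lambda>x. P (1 / x)) holomorphic_on UNIV"
proof -
  have "mellin01 (\<lambda>x. P (1 / x)) analytic_on {s}" for s
  proof -
    obtain C where C: "\<And>x. 0 < x \<Longrightarrow> x \<le> 1 \<Longrightarrow> norm (P (1 / x)) \<le> C * x powr (1 - Re s)"
      using rapid_decay_inverse_bound[OF assms] by blast
    have "continuous_on {0<..1} (\<lambda>x. P (1 / x))"
      by (rule continuous_on_subset[OF rapid_decay_inverse_continuous_on[OF assms]]) auto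
    from mellin01_holomorphic[OF this C] show ?thesis
      unfolding analytic_at
      by (intro exI[of _ "{z. Re z + (1 - Re s) > 0}"]) (auto intro!: open_Collect_less continuous_intros)
  qed
  then show ?thesis
    by (metis analytic_imp_holomorphic analytic_on_analytic_at)
qed

lemma rapid_decay_inverse_mellin01_bounded:
  assumes "rapid_decay P"
  obtains K where "\<And>s. Re s \<ge> \<sigma> \<Longrightarrow> norm (mellin01 (\<lambda>x. P (1 / x)) s) \<le> K"
proof -
  obtain C where C: "\<And>x. 0 < x \<Longrightarrow> x \<le> 1 \<Longrightarrow> norm (P (1 / x)) \<le> C * x powr (1 - \<sigma>)"
    using rapid_decay_inverse_bound[OF assms] by blast
  have C0: "C \<ge> 0" using C[of 1] norm_ge_zero[of "P 1"] by (simp del: norm_ge_zero)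
  have cont: "continuous_on {0<..1} (\<lambda>x. P (1 / x))"
    by (rule continuous_on_subset[OF rapid_decay_inverse_continuous_on[OF assms]]) auto
  have "norm (mellin01 (\<lambda>x. P (1 / x)) s) \<le> C" if "Re s \<ge> \<sigma>" for s
  proof -
    have "norm (mellin01 (\<lambda>x. P (1 / x)) s) \<le> C / (Re s + (1 - \<sigma>))"
      by (rule mellin01_bound(2)[OF cont C]) (use that in auto)
    also have "\<dots> \<le> C / 1" using C0 that by (intro divide_left_mono) auto
    finally show ?thesis by simp
  qed
  then show ?thesis using that by blast
qed

definition mellin :: "(real \<Rightarrow> complex) \<Rightarrow> complex \<Rightarrow> complex" where
  "mellin P s = (LBINT t:{0<..}. P t * of_real t powr (s - 1))"

text \<open>Substituting \<open>t = 1/x\<close> on \<open>[1, \<infinity>)\<close> folds the half-line onto \<open>(0, 1]\<close>. The folded part is entire, and only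
the part near 0 restricts \<open>s\<close> to a half-plane.\<close>

lemma mellin_split:
  assumes P: "rapid_decay P"
  obtains \<sigma> where "\<And>s. Re s > \<sigma> \<Longrightarrow> has_mellin01 P s (mellin01 P s)"
    "\<And>s. Re s > \<sigma> \<Longrightarrow> set_integrable lborel {0<..} (\<lambda>t. P t * of_real t powr (s - 1))"
    "\<And>s. Re s > \<sigma> \<Longrightarrow> mellin P s = mellin01 P s + mellin01 (\<lambda>x. P (1 / x)) (- s)"
    "mellin01 P holomorphic_on {s. Re s > \<sigma>}"
proof -
  obtain C A where CA: "\<And>t. 0 < t \<Longrightarrow> norm (P t) \<le> C * t powr (- A)"
    using rapid_decay_bound_near_0[OF P] by blast
  have cont: "continuous_on {0<..1} P"
    by (rule continuous_on_subset[OF rapid_decay_continuous_on[OF P]]) auto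
  have i1: "set_integrable lborel {0<..1} (\<lambda>t. P t * of_real t powr (s - 1))" if "Re s > A" for s
    by (rule mellin01_bound(1)[OF cont CA]) (use that in auto)
  have inv: "set_integrable lborel {1..} (\<lambda>t. P t * of_real t powr (s - 1))"
    "(LBINT t:{1..}. P t * of_real t powr (s - 1)) = mellin01 (\<lambda>x. P (1 / x)) (- s)" for s
  proof -
    let ?f = "\<lambda>t. P t * of_real t powr (s - 1)"
    have c: "continuous_on {1..} ?f"
      by (intro continuous_intros continuous_on_subset[OF rapid_decay_continuous_on[OF P]])
         (auto simp: complex_nonpos_Reals_iff)
    have eq: "?f (1 / x) / of_real (x\<^sup>2) = P (1 / x) * of_real x powr (- s - 1)" if "x \<in> {0<..1}" for x
    proof -
      have x: "x > 0" using that by simp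
      have "of_real (1 / x) powr (s - 1) = (of_real x powr (1 - s) :: complex)"
        using x by (simp add: powr_def Ln_of_real ln_div algebra_simps flip: of_real_divide)
      moreover have "of_real x powr (- s - 1) = of_real x powr (1 - s) / (of_real (x\<^sup>2) :: complex)"
      proof -
        have "of_real x powr (- s - 1) = of_real x powr ((1 - s) - of_nat 2)"
          by (rule arg_cong[where f = "\<lambda>w. of_real x powr w"]) simp
        also have "\<dots> = of_real x powr (1 - s) / of_real x powr of_nat 2" by (rule powr_diff)
        also have "of_real x powr of_nat 2 = (of_real (x\<^sup>2) :: complex)"
          using x by (subst powr_nat') auto
        finally show ?thesis .
      qed
      ultimately show ?thesis by simp
    qed
    have "set_integrable lborel {0<..1} (\<lambda>x. P (1 / x) * of_real x powr (- s - 1))"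
      using rapid_decay_inverse_has_mellin01[OF P, of "- s"] by (simp add: has_mellin01_def)
    then have i: "set_integrable lborel {0<..1} (\<lambda>x. ?f (1 / x) / of_real (x\<^sup>2))"
      by (subst set_integrable_cong[OF refl refl eq])
    show "set_integrable lborel {1..} ?f"
      by (rule inversion_integral(1)[OF c i])
    have "(LBINT t:{1..}. ?f t) = (LBINT x:{0<..1}. ?f (1 / x) / of_real (x\<^sup>2))"
      by (rule inversion_integral(2)[OF c i])
    also have "\<dots> = mellin01 (\<lambda>x. P (1 / x)) (- s)"
      unfolding mellin01_def by (rule set_lebesgue_integral_cong) (use eq in auto)
    finally show "(LBINT t:{1..}. ?f t) = mellin01 (\<lambda>x. P (1 / x)) (- s)" .
  qed
  have un: "{0<..} = {0<..<1} \<union> {1::real..}" by auto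
  have un': "{0<..1} = {0<..<1} \<union> {1::real}" by auto
  show ?thesis
  proof (rule that[of A])
    fix s :: complex assume s: "Re s > A"
    let ?f = "\<lambda>t. P t * of_real t powr (s - 1)"
    show "has_mellin01 P s (mellin01 P s)" using i1[OF s] by (simp add: has_mellin01_def)
    have i0: "set_integrable lborel {0<..<1} ?f"
      by (rule set_integrable_subset[OF i1[OF s]]) auto
    show "set_integrable lborel {0<..} ?f"
      unfolding un by (rule set_integrable_Un[OF i0 inv(1)]) auto
    have "mellin P s = (LBINT t:{0<..<1}. ?f t) + (LBINT t:{1..}. ?f t)"
      unfolding mellin_def un by (rule set_integral_Un) (use i0 inv(1) in auto)
    also have "(LBINT t:{0<..<1}. ?f t) = (LBINT t:{0<..1}. ?f t)"
    proof (rule set_integral_cong_set)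
      have "x \<noteq> 1 \<Longrightarrow> (x \<in> {0<..1}) = (x \<in> {0<..<1})" for x :: real by auto
      then show "AE x in lborel. (x \<in> {0<..1}) = (x \<in> {0<..<1::real})"
        using AE_lborel_singleton[of "1::real"] by (auto elim: eventually_mono)
      show "set_borel_measurable lborel {0<..<1} ?f" "set_borel_measurable lborel {0<..1} ?f"
        using i0 i1[OF s] by (auto simp: set_integrable_def set_borel_measurable_def)
    qed
    also have "\<dots> = mellin01 P s" by (simp add: mellin01_def)
    also note inv(2)
    finally show "mellin P s = mellin01 P s + mellin01 (\<lambda>x. P (1 / x)) (- s)" .
  next
    show "mellin01 P holomorphic_on {s. Re s > A}"
      using mellin01_holomorphic[OF cont CA] by (simp add: algebra_simps)
  qed
qed

section \<open>Meromorphic continuation and reflection\<close>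

lemma meromorphic_continuation_cong:
  assumes "\<And>s. Re s > \<sigma> \<Longrightarrow> F s = F' s"
  shows "meromorphic_continuation F G \<longleftrightarrow> meromorphic_continuation F' G"
proof -
  have "\<exists>\<sigma>'::real. \<forall>s. Re s > \<sigma>' \<longrightarrow> G s = F2 s"
    if "\<And>s. Re s > \<sigma> \<Longrightarrow> F1 s = F2 s" "\<exists>\<sigma>'::real. \<forall>s. Re s > \<sigma>' \<longrightarrow> G s = F1 s" for F1 F2
    using that by (metis max_less_iff_conj)
  from this[of F F'] this[of F' F] show ?thesis
    unfolding meromorphic_continuation_def using assms by auto
qed

text \<open>Removing singularities commutes with \<open>s \<mapsto> \<kappa> - s\<close>. This carries functional equations of explicit
expressions over to their continuous extensions at every point, poles included.\<close>

lemma remove_sings_reflect: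
  assumes fg: "\<And>s. f s = c * g (\<kappa> - s)" and c: "c \<noteq> 0"
  shows "remove_sings f s = c * remove_sings g (\<kappa> - s)"
proof -
  have lim: "u \<midarrow>s\<rightarrow> e * l" if "v \<midarrow>\<kappa> - s\<rightarrow> l" "\<And>s. u s = e * v (\<kappa> - s)" for u v :: "complex \<Rightarrow> complex" and e l s
  proof -
    have "filterlim (\<lambda>z. \<kappa> - z) (at (\<kappa> - s)) (at s)"
      by (auto simp: filterlim_at eventually_at_filter intro!: tendsto_intros)
    from tendsto_mult[OF tendsto_const[of e] filterlim_compose[OF that(1) this]]
    show ?thesis unfolding that(2)[symmetric] .
  qed
  show ?thesis
  proof (cases "\<exists>l. g \<midarrow>\<kappa> - s\<rightarrow> l")
    case True
    then obtain l where l: "g \<midarrow>\<kappa> - s\<rightarrow> l" by blast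
    show ?thesis using remove_sings_eqI[OF l] remove_sings_eqI[OF lim[OF l fg]] by simp
  next
    case False
    have gf: "g z = inverse c * f (\<kappa> - z)" for z using fg[of "\<kappa> - z"] c by simp
    have "g \<midarrow>\<kappa> - s\<rightarrow> inverse c * l" if "f \<midarrow>s\<rightarrow> l" for l
      using lim[where v = f and u = g and s = "\<kappa> - s", OF _ gf] that by simp
    then have "\<not> (\<exists>l. f \<midarrow>s\<rightarrow> l)"
      using False by blast
    then show ?thesis using False by (simp add: remove_sings_def)
  qed
qed

text \<open>For suitable constants this is the transform over \<open>(0, 1]\<close> of the four monomials \<open>1\<close>, \<open>x\<^sup>-\<^sup>k\<close>, \<open>x\<^sup>1\<^sup>-\<^sup>k\<close> and \<open>x\<^sup>-\<^sup>1\<close>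
that occur in the defect of a transformation law.\<close>

definition polar_part :: "int \<Rightarrow> complex \<Rightarrow> complex \<Rightarrow> complex \<Rightarrow> complex \<Rightarrow> complex \<Rightarrow> complex" where
  "polar_part k a b a' b' s = a / s + a' / (of_int k - s) + b / (s - of_int k + 1) + b' / (1 - s)"

definition polar_points :: "int \<Rightarrow> complex set" where
  "polar_points k = {0, of_int k, of_int k - 1, 1}"

lemma polar_part_meromorphic: "polar_part k a b a' b' meromorphic_on A"
  unfolding polar_part_def[abs_def] by (intro meromorphic_intros)

lemma polar_part_analytic:
  assumes "s \<notin> polar_points k"
  shows "polar_part k a b a' b' analytic_on {s}"
  unfolding polar_part_def[abs_def]
  by (intro analytic_intros) (use assms in \<open>auto simp: polar_points_def algebra_simps add_eq_0_iff2\<close>)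

lemma polar_part_reflect:
  "\<epsilon> \<noteq> 0 \<Longrightarrow> polar_part k a b (\<epsilon> * a') (\<epsilon> * b') s = \<epsilon> * polar_part k a' b' (a / \<epsilon>) (b / \<epsilon>) (of_int k - s)"
proof -
  assume "\<epsilon> \<noteq> 0"
  moreover have "of_int k - (of_int k - s) = s" "of_int k - s - of_int k + 1 = 1 - s"
    "1 - (of_int k - s) = s - of_int k + 1" by simp_all
  ultimately show ?thesis unfolding polar_part_def by (simp add: distrib_left)
qed

section \<open>Hecke's correspondence\<close>

text \<open>The shape on the imaginary axis of a harmonic Fourier series: the constant term, the term
\<open>v\<^sup>1\<^sup>-\<^sup>k\<close>, and a remainder \<open>P\<close> of rapid decay.\<close>

definition axis_fun :: "int \<Rightarrow> complex \<Rightarrow> complex \<Rightarrow> (real \<Rightarrow> complex) \<Rightarrow> real \<Rightarrow> complex" where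
  "axis_fun k a b P t = a + b * of_real (t powi (1 - k)) + P t"

text \<open>The amount by which the law \<open>F(1/t) = \<epsilon> t\<^sup>k G(t)\<close> fails, written at \<open>x = 1/t\<close>.\<close>

definition defect where
  "defect k \<epsilon> a b P a' b' Q x =
     axis_fun k a b P x - \<epsilon> * of_real (x powi (- k)) * axis_fun k a' b' Q (1 / x)"

lemma defect_expand:
  assumes x: "x > 0"
  shows "defect k \<epsilon> a b P a' b' Q x = a * of_real (x powi 0) + (b * of_real (x powi (1 - k)) + (P x
         + ((- \<epsilon> * a') * of_real (x powi (- k)) + ((- \<epsilon> * b') * of_real (x powi (- 1))
         + (- \<epsilon>) * (of_real (x powi (- k)) * Q (1 / x))))))"
proof -
  have "x powi (- k) * (1 / x) powi (1 - k) = x powi (- 1)"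
    using x by (simp add: power_int_divide_distrib power_int_diff power_int_minus field_simps)
  then have "of_real (x powi (- k)) * of_real ((1 / x) powi (1 - k)) = (of_real (x powi (- 1)) :: complex)"
    by (metis of_real_mult)
  then have e: "of_real (x powi (- k)) * (c * of_real ((1 / x) powi (1 - k))) = c * (of_real (x powi (- 1)) :: complex)" for c
    by (metis mult.left_commute)
  show ?thesis
    unfolding defect_def axis_fun_def distrib_left mult.assoc e by (simp add: algebra_simps)
qed

text \<open>The completed transform without its polar part, as it comes out of Riemann's splitting of the
Mellin integral at 1 when the transformation law holds.\<close>

definition regularized where
  "regularized k \<epsilon> P Q s = mellin01 (\<lambda>x. P (1 / x)) (- s) + \<epsilon> * mellin01 (\<lambda>x. Q (1 / x)) (s - of_int k)"

lemma regularized_reflect: "\<epsilon> \<noteq> 0 \<Longrightarrow> regularized k \<epsilon> P Q s = \<epsilon> * regularized k (1 / \<epsilon>) Q P (of_int k - s)"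
  by (simp add: regularized_def field_simps)

lemma regularized_entire:
  assumes "rapid_decay P" "rapid_decay Q"
  shows "regularized k \<epsilon> P Q holomorphic_on UNIV"
  unfolding regularized_def[abs_def]
  by (intro holomorphic_intros holomorphic_on_compose_gen[OF _ rapid_decay_inverse_mellin01_entire, unfolded o_def] assms) auto

lemma regularized_bounded:
  assumes "rapid_decay P" "rapid_decay Q"
  shows "bounded (regularized k \<epsilon> P Q ` {s. \<sigma> \<le> Re s \<and> Re s \<le> \<sigma>'})"
proof -
  obtain K where K: "\<And>s. Re s \<ge> - \<sigma>' \<Longrightarrow> norm (mellin01 (\<lambda>x. P (1 / x)) s) \<le> K"
    using rapid_decay_inverse_mellin01_bounded[OF assms(1)] by blast
  obtain L where L: "\<And>s. Re s \<ge> \<sigma> - of_int k \<Longrightarrow> norm (mellin01 (\<lambda>x. Q (1 / x)) s) \<le> L"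
    using rapid_decay_inverse_mellin01_bounded[OF assms(2)] by blast
  have "norm (regularized k \<epsilon> P Q s) \<le> K + norm \<epsilon> * L" if "\<sigma> \<le> Re s" "Re s \<le> \<sigma>'" for s
    unfolding regularized_def using that
    by (intro norm_triangle_le add_mono) (auto simp: norm_mult intro!: K mult_left_mono L)
  then show ?thesis unfolding bounded_iff by blast
qed

text \<open>The defect consists of \<open>P(x)\<close>, of \<open>-\<epsilon> x\<^sup>-\<^sup>k Q(1/x)\<close> and of monomials, and each piece is transformed
separately. This identity serves both directions of the correspondence.\<close>

lemma mellin_defect:
  assumes P: "rapid_decay P" and Q: "rapid_decay Q" and k: "k < 0"
  obtains \<sigma> where "\<And>s. Re s > \<sigma> \<Longrightarrow> has_mellin01 (defect k \<epsilon> a b P a' b' Q) s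
    (mellin P s + polar_part k a b (\<epsilon> * a') (\<epsilon> * b') s - regularized k \<epsilon> P Q s)"
    "mellin P holomorphic_on {s. Re s > \<sigma>}" "\<sigma> > 1"
proof -
  obtain \<sigma> where 1: "\<And>s. Re s > \<sigma> \<Longrightarrow> has_mellin01 P s (mellin01 P s)"
    and 2: "\<And>s. Re s > \<sigma> \<Longrightarrow> mellin P s = mellin01 P s + mellin01 (\<lambda>x. P (1 / x)) (- s)"
    and 3: "mellin01 P holomorphic_on {s. Re s > \<sigma>}"
    using mellin_split[OF P] by metis
  show ?thesis
  proof (rule that)
    \<comment> \<open>Right of the abscissa for \<open>P\<close> and of 1, which is the rightmost of the four poles and comes from
      the monomial \<open>x\<^sup>-\<^sup>1\<close>.\<close>
    define \<sigma>' where "\<sigma>' = max \<sigma> 1 + 1"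
    show "\<sigma>' > 1" using k by (simp add: \<sigma>'_def)
    have sub: "{s. Re s > \<sigma>'} \<subseteq> {s. Re s > \<sigma>}" using k by (auto simp: \<sigma>'_def)
    have "(\<lambda>s. mellin01 P s + mellin01 (\<lambda>x. P (1 / x)) (- s)) holomorphic_on {s. Re s > \<sigma>'}"
      by (intro holomorphic_intros holomorphic_on_subset[OF 3 sub]
        holomorphic_on_compose_gen[OF _ rapid_decay_inverse_mellin01_entire, unfolded o_def] P) auto
    then show "mellin P holomorphic_on {s. Re s > \<sigma>'}"
      by (rule holomorphic_transform) (use 2 sub in auto)
    fix s assume s: "Re s > \<sigma>'"
    have s1: "Re s > \<sigma>" "Re s > 1" using s k unfolding \<sigma>'_def by auto
    have m: "has_mellin01 (\<lambda>x. of_real (x powi n)) s (1 / (s + of_int n))" if "n \<ge> -1" for n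
    proof (rule has_mellin01_powi)
      have "real_of_int n \<ge> -1"
        using that by (metis of_int_le_iff of_int_minus of_int_1)
      then show "Re s + of_int n > 0" using s1 by auto
    qed
    have sh: "has_mellin01 (\<lambda>x. of_real (x powi (- k)) * Q (1 / x)) s (mellin01 (\<lambda>x. Q (1 / x)) (s - of_int k))"
    proof -
      have "has_mellin01 (\<lambda>x. of_real x powr (of_int (- k)) * Q (1 / x)) s (mellin01 (\<lambda>x. Q (1 / x)) (s - of_int k))"
        by (rule has_mellin01_shift) (use rapid_decay_inverse_has_mellin01[OF Q, of "s - of_int k"] in simp)
      then show ?thesis
        by (subst has_mellin01_cong[where r' = "\<lambda>x. of_real x powr (of_int (- k)) * Q (1 / x)"])
           (auto simp: complex_powr_of_int simp del: of_int_minus)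
    qed
    have "has_mellin01 (\<lambda>x. a * of_real (x powi 0) + (b * of_real (x powi (1 - k)) + (P x
         + ((- \<epsilon> * a') * of_real (x powi (- k)) + ((- \<epsilon> * b') * of_real (x powi (- 1))
         + (- \<epsilon>) * (of_real (x powi (- k)) * Q (1 / x))))))) s
       (a * (1 / (s + of_int 0)) + (b * (1 / (s + of_int (1 - k))) + (mellin01 P s
         + ((- \<epsilon> * a') * (1 / (s + of_int (- k))) + ((- \<epsilon> * b') * (1 / (s + of_int (- 1)))
         + (- \<epsilon>) * mellin01 (\<lambda>x. Q (1 / x)) (s - of_int k))))))"
      by (intro has_mellin01_add has_mellin01_cmult m sh 1) (use s1 k in auto)
    also have "(a * (1 / (s + of_int 0)) + (b * (1 / (s + of_int (1 - k))) + (mellin01 P s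
         + ((- \<epsilon> * a') * (1 / (s + of_int (- k))) + ((- \<epsilon> * b') * (1 / (s + of_int (- 1)))
         + (- \<epsilon>) * mellin01 (\<lambda>x. Q (1 / x)) (s - of_int k))))))
       = mellin P s + polar_part k a b (\<epsilon> * a') (\<epsilon> * b') s - regularized k \<epsilon> P Q s"
    proof -
      have "of_int k - s = - (s + of_int (- k))" "1 - s = - (s + of_int (- 1))"
        "s - of_int k + 1 = s + of_int (1 - k)" by simp_all
      then show ?thesis
        unfolding polar_part_def regularized_def 2[OF s1(1)] by (simp only: divide_minus_right) (simp add: algebra_simps)
    qed
    finally show "has_mellin01 (defect k \<epsilon> a b P a' b' Q) s
      (mellin P s + polar_part k a b (\<epsilon> * a') (\<epsilon> * b') s - regularized k \<epsilon> P Q s)"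
      by (subst has_mellin01_cong[OF defect_expand]) auto
  qed
qed

lemma defect_bound:
  assumes P: "rapid_decay P" and Q: "rapid_decay Q" and k: "k < 0"
  obtains C A where "\<And>x. 0 < x \<Longrightarrow> x \<le> 1 \<Longrightarrow> norm (defect k \<epsilon> a b P a' b' Q x) \<le> C * x powr (- A)"
proof -
  obtain C A where CA: "\<And>t. 0 < t \<Longrightarrow> norm (P t) \<le> C * t powr (- A)"
    using rapid_decay_bound_near_0[OF P] by blast
  obtain D where D: "\<And>x. 0 < x \<Longrightarrow> x \<le> 1 \<Longrightarrow> norm (Q (1 / x)) \<le> D * x powr 0"
    using rapid_decay_inverse_bound[OF Q] by blast
  define B where "B = max A 1"
  have C0: "C \<ge> 0" "D \<ge> 0"
    using CA[of 1] D[of 1] norm_ge_zero[of "P 1"] norm_ge_zero[of "Q 1"] by (simp_all del: norm_ge_zero)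
  show ?thesis
  proof (rule that)
    fix x :: real assume x: "0 < x" "x \<le> 1"
    have pw: "x powi n \<le> x powr (- B)" if "n \<ge> - 1" for n
    proof -
      have "x powi n = x powr of_int n" using x by (simp add: powr_real_of_int')
      also have "\<dots> \<le> x powr (- B)" 
      proof (rule powr_mono')
        have "real_of_int n \<ge> - 1" using that by (metis of_int_le_iff of_int_minus of_int_1)
        then show "- B \<le> real_of_int n" by (simp add: B_def)
      qed (use x in auto)
      finally show ?thesis .
    qed
    have t: "norm (c * of_real (x powi n)) \<le> norm c * x powr (- B)" if "n \<ge> - 1" for c :: complex and n
      using pw[OF that] x unfolding norm_mult norm_of_real by (intro mult_left_mono) auto
    have tP: "norm (P x) \<le> C * x powr (- B)"
    proof -
      have "C * x powr (- A) \<le> C * x powr (- B)"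
        using x C0 by (intro mult_left_mono powr_mono') (auto simp: B_def)
      then show ?thesis using CA[OF x(1)] by linarith
    qed
    have tQ: "norm (of_real (x powi (- k)) * Q (1 / x)) \<le> x powr (- B) * D"
      using D[OF x] x pw[of "- k"] k unfolding norm_mult norm_of_real by (intro mult_mono) auto
    have "norm (defect k \<epsilon> a b P a' b' Q x) \<le> norm a * x powr (- B) + (norm b * x powr (- B)
        + (C * x powr (- B) + (norm (- \<epsilon> * a') * x powr (- B) + (norm (- \<epsilon> * b') * x powr (- B)
        + norm (- \<epsilon>) * (x powr (- B) * D)))))"
      unfolding defect_expand[OF x(1)] norm_mult[of "- \<epsilon>" "of_real (x powi (- k)) * Q (1 / x)"]
      by (intro norm_triangle_mono t tP mult_left_mono tQ order_eq_refl[OF norm_mult] 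
          order.trans[OF order_eq_refl[OF norm_mult] mult_left_mono[OF tQ]]) (use k in auto)
    then show "norm (defect k \<epsilon> a b P a' b' Q x) \<le> (norm a + norm b + C + norm (- \<epsilon> * a')
        + norm (- \<epsilon> * b') + norm (- \<epsilon>) * D) * x powr (- B)"
      by (simp add: algebra_simps)
  qed
qed

lemma defect_continuous:
  assumes "rapid_decay P" "rapid_decay Q"
  shows "continuous_on {0<..} (defect k \<epsilon> a b P a' b' Q)"
  unfolding defect_def[abs_def] axis_fun_def
  by (intro continuous_intros rapid_decay_continuous_on[OF assms(1)] rapid_decay_inverse_continuous_on[OF assms(2)]) auto

lemma defect_reflect:
  assumes "\<epsilon> \<noteq> 0" "x > 0"
  shows "defect k (1 / \<epsilon>) a' b' Q a b P (1 / x) = - (1 / \<epsilon>) * of_real (x powi k) * defect k \<epsilon> a b P a' b' Q x"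
proof -
  have "of_real (x powi k) * (of_real (x powi (- k)) :: complex) = 1"
    using assms by (simp add: power_int_minus flip: of_real_mult)
  moreover have "(1 / x) powi (- k) = x powi k"
    using assms by (simp add: power_int_minus power_int_divide_distrib)
  ultimately show ?thesis using assms
    unfolding defect_def by (simp add: algebra_simps)
qed

text \<open>The defects of the law and of the inverse law are exchanged by \<open>x \<mapsto> 1/x\<close>, so two statements on
\<open>(0, 1]\<close> cover the whole half-line.\<close>

lemma defect_zero_iff:
  assumes "\<epsilon> \<noteq> 0"
  shows "(\<forall>t>0. axis_fun k a b P (1 / t) = \<epsilon> * of_real (t powi k) * axis_fun k a' b' Q t) \<longleftrightarrow>
    (\<forall>x. 0 < x \<longrightarrow> x \<le> 1 \<longrightarrow> defect k \<epsilon> a b P a' b' Q x = 0) \<and>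
    (\<forall>x. 0 < x \<longrightarrow> x \<le> 1 \<longrightarrow> defect k (1 / \<epsilon>) a' b' Q a b P x = 0)" (is "?L \<longleftrightarrow> ?R1 \<and> ?R2")
proof -
  have "?L \<longleftrightarrow> (\<forall>x>0. defect k \<epsilon> a b P a' b' Q x = 0)" (is "_ \<longleftrightarrow> ?M")
  proof -
    have *: "axis_fun k a b P (1 / t) = \<epsilon> * of_real (t powi k) * axis_fun k a' b' Q t \<longleftrightarrow>
        defect k \<epsilon> a b P a' b' Q (1 / t) = 0" if "t > 0" for t
      using that by (simp add: defect_def power_int_minus power_int_divide_distrib)
    show ?thesis
    proof safe
      fix x :: real assume L: "\<forall>t>0. axis_fun k a b P (1 / t) = \<epsilon> * of_real (t powi k) * axis_fun k a' b' Q t" and "x > 0"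
      then show "defect k \<epsilon> a b P a' b' Q x = 0" using *[of "1 / x"] L[rule_format, of "1 / x"] by simp
    next
      fix t :: real assume "\<forall>x>0. defect k \<epsilon> a b P a' b' Q x = 0" "t > 0"
      then show "axis_fun k a b P (1 / t) = \<epsilon> * of_real (t powi k) * axis_fun k a' b' Q t" using *[of t] by simp
    qed
  qed
  also have "\<dots> \<longleftrightarrow> ?R1 \<and> ?R2"
  proof
    assume M: ?M
    have "defect k (1 / \<epsilon>) a' b' Q a b P x = 0" if "x > 0" for x
      using defect_reflect[OF assms, of "1 / x" k a' b' Q a b P] M that by simp
    then show "?R1 \<and> ?R2" using M by auto
  next
    assume R: "?R1 \<and> ?R2"
    show ?M
    proof (intro allI impI)
      fix x :: real assume x: "x > 0"
      show "defect k \<epsilon> a b P a' b' Q x = 0"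
      proof (cases "x \<le> 1")
        case False
        then have "defect k (1 / \<epsilon>) a' b' Q a b P (1 / x) = 0" using R by simp
        then show ?thesis using defect_reflect[OF assms x, of k a' b' Q a b P] assms x by simp
      qed (use R x in auto)
    qed
  qed
  finally show ?thesis .
qed

text \<open>If the defect vanishes, so does its transform, and \<open>mellin_defect\<close> exhibits the transform of \<open>P\<close> as an
entire function minus the polar part.\<close>

lemma regularized_continuation:
  fixes a b a' b' \<epsilon> :: complex
  assumes P: "rapid_decay P" and Q: "rapid_decay Q" and k: "k < 0"
    and zero: "\<And>x. 0 < x \<Longrightarrow> x \<le> 1 \<Longrightarrow> defect k \<epsilon> a b P a' b' Q x = 0"
  defines "G \<equiv> remove_sings (\<lambda>s. regularized k \<epsilon> P Q s - polar_part k a b (\<epsilon> * a') (\<epsilon> * b') s)"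
  shows "meromorphic_continuation (mellin P) G"
    and "entire_bounded_in_strips (\<lambda>s. G s + polar_part k a b (\<epsilon> * a') (\<epsilon> * b') s)"
proof -
  let ?pol = "polar_part k a b (\<epsilon> * a') (\<epsilon> * b')" and ?S = "regularized k \<epsilon> P Q"
  have S: "?S analytic_on {s}" for s
    using regularized_entire[OF P Q] analytic_on_open[of UNIV] analytic_on_subset by blast
  have ana: "(\<lambda>s. ?S s - ?pol s) analytic_on {s}" if "s \<notin> polar_points k" for s
    by (intro analytic_intros S polar_part_analytic that)
  have G: "G s = ?S s - ?pol s" if "s \<notin> polar_points k" for s
    unfolding G_def using ana[OF that] by simp
  have mer: "(\<lambda>s. ?S s - ?pol s) meromorphic_on UNIV"
    by (intro meromorphic_intros polar_part_meromorphic analytic_on_imp_meromorphic_on)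
       (use S analytic_on_analytic_at in blast)
  show "meromorphic_continuation (mellin P) G"
    unfolding meromorphic_continuation_def
  proof
    show "G nicely_meromorphic_on UNIV"
      unfolding G_def by (rule remove_sings_nicely_meromorphic[OF mer])
    obtain \<sigma> where \<sigma>: "\<And>s. Re s > \<sigma> \<Longrightarrow> has_mellin01 (defect k \<epsilon> a b P a' b' Q) s
        (mellin P s + ?pol s - ?S s)" "\<sigma> > 1"
      using mellin_defect[OF P Q k] by metis
    have "G s = mellin P s" if s: "Re s > \<sigma>" for s
    proof -
      have "has_mellin01 (\<lambda>_. 0) s (mellin P s + ?pol s - ?S s)"
        using \<sigma>(1)[OF s] zero by (subst has_mellin01_cong[where r' = "defect k \<epsilon> a b P a' b' Q"]) auto
      then have "mellin P s + ?pol s - ?S s = 0" by (simp add: has_mellin01_def mellin01_def)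
      moreover have "s \<notin> polar_points k" using s \<sigma>(2) k by (auto simp: polar_points_def)
      ultimately show ?thesis by (metis G add_diff_cancel_right' eq_iff_diff_eq_0)
    qed
    then show "\<exists>\<sigma>. \<forall>s. \<sigma> < Re s \<longrightarrow> G s = mellin P s" by blast
  qed
  have "remove_sings (\<lambda>s. G s + ?pol s) = ?S"
  proof
    fix s
    have "\<forall>\<^sub>F z in at s. z \<notin> polar_points k"
      using eventually_neq_at_within[of 0 s UNIV] eventually_neq_at_within[of "of_int k" s UNIV]
        eventually_neq_at_within[of "of_int k - 1" s UNIV] eventually_neq_at_within[of 1 s UNIV]
      by eventually_elim (simp add: polar_points_def)
    then have ev: "\<forall>\<^sub>F z in at s. ?S z = G z + ?pol z"
      by eventually_elim (simp add: G)
    have "?S \<midarrow>s\<rightarrow> ?S s" by (rule isContD[OF analytic_at_imp_isCont[OF S]])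
    from Lim_transform_eventually[OF this ev] show "remove_sings (\<lambda>s. G s + ?pol s) s = ?S s"
      by (rule remove_sings_eqI)
  qed
  then show "entire_bounded_in_strips (\<lambda>s. G s + ?pol s)"
    unfolding entire_bounded_in_strips_def using regularized_entire[OF P Q] regularized_bounded[OF P Q] by simp
qed

text \<open>Far to the right nothing has to be removed: there the continuation is the holomorphic integral itself and
the polar part is regular, so that \<open>T\<close> takes the values expected from \<open>mellin_defect\<close>.\<close>

lemma continuation_imp_mellin_defect:
  fixes a b a' b' \<epsilon> :: complex
  assumes P: "rapid_decay P" and Q: "rapid_decay Q" and k: "k < 0"
    and G: "meromorphic_continuation (mellin P) G"
  defines "T \<equiv> remove_sings (\<lambda>s. G s + polar_part k a b (\<epsilon> * a') (\<epsilon> * b') s)"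
  obtains \<sigma> where "\<And>s. Re s > \<sigma> \<Longrightarrow> has_mellin01 (defect k \<epsilon> a b P a' b' Q) s (T s - regularized k \<epsilon> P Q s)"
proof -
  let ?pol = "polar_part k a b (\<epsilon> * a') (\<epsilon> * b')"
  obtain \<sigma>1 where 1: "\<And>s. Re s > \<sigma>1 \<Longrightarrow> has_mellin01 (defect k \<epsilon> a b P a' b' Q) s
      (mellin P s + ?pol s - regularized k \<epsilon> P Q s)" "mellin P holomorphic_on {s. Re s > \<sigma>1}" "\<sigma>1 > 1"
    using mellin_defect[OF P Q k] by metis
  obtain \<sigma>2 where 2: "\<And>s. Re s > \<sigma>2 \<Longrightarrow> G s = mellin P s"
    using G unfolding meromorphic_continuation_def by blast
  show ?thesis
  proof (rule that)
    fix s assume s: "Re s > max \<sigma>1 \<sigma>2"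
    have "open {s. Re s > max \<sigma>1 \<sigma>2}" by (rule open_halfspace_Re_gt)
    moreover have "G holomorphic_on {s. Re s > max \<sigma>1 \<sigma>2}"
      by (rule holomorphic_transform[OF holomorphic_on_subset[OF 1(2)]]) (use 2 in auto)
    ultimately have "G analytic_on {s}" using s analytic_at by blast
    moreover have "s \<notin> polar_points k" using s 1(3) k by (auto simp: polar_points_def)
    ultimately have "(\<lambda>s. G s + ?pol s) analytic_on {s}"
      by (intro analytic_intros polar_part_analytic)
    then have "T s = mellin P s + ?pol s" unfolding T_def using 2[of s] s by simp
    then show "has_mellin01 (defect k \<epsilon> a b P a' b' Q) s (T s - regularized k \<epsilon> P Q s)"
      using 1(1)[of s] s by simp
  qed
qed

text \<open>The analytic core of the converse direction: the transform of the defect extends to a bounded entire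
function, which is zero by Liouville's theorem and its decay along the positive reals.\<close>

lemma defect_eq_0:
  assumes P: "rapid_decay P" and Q: "rapid_decay Q" and k: "k < 0" and \<epsilon>: "\<epsilon> \<noteq> 0"
    and G: "meromorphic_continuation (mellin P) G" and H: "meromorphic_continuation (mellin Q) H"
    and GH: "\<And>s. G s = \<epsilon> * H (of_int k - s)"
    and E: "entire_bounded_in_strips (\<lambda>s. G s + polar_part k a b (\<epsilon> * a') (\<epsilon> * b') s)"
    and x: "0 < x" "x \<le> 1"
  shows "defect k \<epsilon> a b P a' b' Q x = 0"
proof -
  let ?r = "defect k \<epsilon> a b P a' b' Q" and ?r' = "defect k (1 / \<epsilon>) a' b' Q a b P"
  define T where "T = remove_sings (\<lambda>s. G s + polar_part k a b (\<epsilon> * a') (\<epsilon> * b') s)"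
  define T' where "T' = remove_sings (\<lambda>s. H s + polar_part k a' b' (1 / \<epsilon> * a) (1 / \<epsilon> * b) s)"
  define h where "h s = T s - regularized k \<epsilon> P Q s" for s
  define h' where "h' s = T' s - regularized k (1 / \<epsilon>) Q P s" for s
  have TT: "T s = \<epsilon> * T' (of_int k - s)" for s
    unfolding T_def T'_def
    by (rule remove_sings_reflect[OF _ \<epsilon>], subst polar_part_reflect[OF \<epsilon>]) (simp add: GH distrib_left)
  have hh: "h s = \<epsilon> * h' (of_int k - s)" for s
    unfolding h_def h'_def TT regularized_reflect[OF \<epsilon>, of k P Q s] by (simp add: right_diff_distrib)
  obtain \<sigma>1 where 1: "\<And>s. Re s > \<sigma>1 \<Longrightarrow> has_mellin01 ?r s (h s)"
    using continuation_imp_mellin_defect[OF P Q k G] unfolding h_def T_def by metis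
  obtain \<sigma>2 where 2: "\<And>s. Re s > \<sigma>2 \<Longrightarrow> has_mellin01 ?r' s (h' s)"
    using continuation_imp_mellin_defect[OF Q P k H] unfolding h'_def T'_def by metis
  obtain C A where CA: "\<And>x. 0 < x \<Longrightarrow> x \<le> 1 \<Longrightarrow> norm (?r x) \<le> C * x powr (- A)"
    using defect_bound[OF P Q k] by metis
  obtain C' A' where CA': "\<And>x. 0 < x \<Longrightarrow> x \<le> 1 \<Longrightarrow> norm (?r' x) \<le> C' * x powr (- A')"
    using defect_bound[OF Q P k] by metis
  have cont: "continuous_on {0<..1} ?r" "continuous_on {0<..1} ?r'"
    by (auto intro!: continuous_on_subset[OF defect_continuous] P Q)
  have C0: "C \<ge> 0" "C' \<ge> 0"
    using CA[of 1] CA'[of 1] norm_ge_zero[of "?r 1"] norm_ge_zero[of "?r' 1"] by (simp_all del: norm_ge_zero)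
  have b1: "norm (h s) \<le> C / (Re s - A)" if "Re s > \<sigma>1" "Re s > A" for s
    using mellin01_bound(2)[OF cont(1) CA, of s] 1[of s] that by (simp add: has_mellin01_def)
  have b2: "norm (h' s) \<le> C' / (Re s - A')" if "Re s > \<sigma>2" "Re s > A'" for s
    using mellin01_bound(2)[OF cont(2) CA', of s] 2[of s] that by (simp add: has_mellin01_def)
  \<comment> \<open>The plane is cut into a right half-plane, where \<open>h\<close> is an integral, a left half-plane, where
    \<open>h(s) = \<epsilon> h'(k - s)\<close> with \<open>h'\<close> an integral, and the strip between.\<close>
  define R where "R = max \<sigma>1 A + 1"
  define L where "L = of_int k - (max \<sigma>2 A' + 1)"
  have right: "norm (h s) \<le> C" if "Re s \<ge> R" for s
  proof -
    have "norm (h s) \<le> C / (Re s - A)" using that by (intro b1) (auto simp: R_def)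
    also have "\<dots> \<le> C / 1" using that C0 by (intro divide_left_mono) (auto simp: R_def)
    finally show ?thesis by simp
  qed
  have left: "norm (h s) \<le> norm \<epsilon> * C'" if "Re s \<le> L" for s
  proof -
    have "norm (h' (of_int k - s)) \<le> C' / (Re (of_int k - s) - A')"
      using that by (intro b2) (auto simp: L_def)
    also have "\<dots> \<le> C' / 1" using that C0 by (intro divide_left_mono) (auto simp: L_def)
    finally show ?thesis unfolding hh[of s] by (simp add: norm_mult mult_left_mono)
  qed
  have "bounded (h ` {s. L \<le> Re s \<and> Re s \<le> R})"
  proof -
    have "bounded (T ` {s. L \<le> Re s \<and> Re s \<le> R})"
      using E unfolding entire_bounded_in_strips_def T_def by blast
    from bounded_minus_comp[OF this regularized_bounded[OF P Q, of k \<epsilon> L R]] show ?thesis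
      by (simp add: h_def[abs_def])
  qed
  then obtain B where B: "\<And>s. L \<le> Re s \<Longrightarrow> Re s \<le> R \<Longrightarrow> norm (h s) \<le> B"
    unfolding bounded_iff by blast
  have bounded: "bounded (range h)"
  proof -
    have "norm (h s) \<le> max C (max (norm \<epsilon> * C') B)" for s
      using right[of s] left[of s] B[of s] by (cases "Re s \<ge> R"; cases "Re s \<le> L") auto
    then show ?thesis unfolding bounded_iff by blast
  qed
  have "h holomorphic_on UNIV"
    unfolding h_def[abs_def] using E regularized_entire[OF P Q]
    by (auto simp: entire_bounded_in_strips_def T_def intro!: holomorphic_intros)
  from Liouville_theorem[OF this bounded] obtain c where c: "\<And>s. h s = c"
    by (auto simp: constant_on_def)
  have "((\<lambda>r. C / (r - A)) \<longlongrightarrow> 0) at_top"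
    by real_asymp
  moreover have "\<forall>\<^sub>F r in at_top. norm c \<le> C / (r - A)"
    using eventually_gt_at_top[of "max \<sigma>1 A"]
  proof eventually_elim
    case (elim r)
    then show ?case using b1[of "of_real r"] c by simp
  qed
  ultimately have "norm c \<le> 0"
    by (intro tendsto_lowerbound) auto
  then have "h s = 0" for s using c by simp
  with 1 have "has_mellin01 ?r s 0" if "Re s > \<sigma>1" for s using that by metis
  from mellin01_eq_0_imp_eq_0[OF defect_continuous[OF P Q] CA this x] show ?thesis .
qed

text \<open>Both directions compare the transform of the defect with the regularized transform. The roles of
\<open>P\<close> and \<open>Q\<close> are symmetric under \<open>\<epsilon> \<mapsto> 1/\<epsilon>\<close>, so each one-sided statement is used twice.\<close>

theorem hecke_correspondence:
  assumes P: "rapid_decay P" and Q: "rapid_decay Q" and k: "k < 0" and \<epsilon>: "\<epsilon> \<noteq> 0"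
  shows "(\<forall>t>0. axis_fun k a b P (1 / t) = \<epsilon> * of_real (t powi k) * axis_fun k a' b' Q t) \<longleftrightarrow>
    (\<exists>G H. meromorphic_continuation (mellin P) G \<and> meromorphic_continuation (mellin Q) H \<and>
      (\<forall>s. G s = \<epsilon> * H (of_int k - s)) \<and>
      entire_bounded_in_strips (\<lambda>s. G s + polar_part k a b (\<epsilon> * a') (\<epsilon> * b') s) \<and>
      entire_bounded_in_strips (\<lambda>s. H s + polar_part k a' b' (a / \<epsilon>) (b / \<epsilon>) s))" (is "?L \<longleftrightarrow> ?R")
proof
  assume ?L
  then have z1: "\<And>x. 0 < x \<Longrightarrow> x \<le> 1 \<Longrightarrow> defect k \<epsilon> a b P a' b' Q x = 0"
    and z2: "\<And>x. 0 < x \<Longrightarrow> x \<le> 1 \<Longrightarrow> defect k (1 / \<epsilon>) a' b' Q a b P x = 0"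
    unfolding defect_zero_iff[OF \<epsilon>] by blast+
  note 1 = regularized_continuation[OF P Q k z1]
  note 2 = regularized_continuation[OF Q P k z2, simplified]
  show ?R
  proof (intro exI conjI allI)
    fix s
    show "remove_sings (\<lambda>s. regularized k \<epsilon> P Q s - polar_part k a b (\<epsilon> * a') (\<epsilon> * b') s) s =
        \<epsilon> * remove_sings (\<lambda>s. regularized k (1 / \<epsilon>) Q P s - polar_part k a' b' (a / \<epsilon>) (b / \<epsilon>) s) (of_int k - s)"
      by (rule remove_sings_reflect[OF _ \<epsilon>], subst regularized_reflect[OF \<epsilon>], subst polar_part_reflect[OF \<epsilon>])
         (rule right_diff_distrib[symmetric])
  qed (use 1 2 in auto)
next
  assume ?R
  then obtain G H where GH: "meromorphic_continuation (mellin P) G" "meromorphic_continuation (mellin Q) H"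
      "\<And>s. G s = \<epsilon> * H (of_int k - s)"
      "entire_bounded_in_strips (\<lambda>s. G s + polar_part k a b (\<epsilon> * a') (\<epsilon> * b') s)"
      "entire_bounded_in_strips (\<lambda>s. H s + polar_part k a' b' (a / \<epsilon>) (b / \<epsilon>) s)"
    by blast
  have \<epsilon>': "1 / \<epsilon> \<noteq> 0" using \<epsilon> by simp
  have HG: "H s = 1 / \<epsilon> * G (of_int k - s)" for s using GH(3)[of "of_int k - s"] \<epsilon> by simp
  have E': "entire_bounded_in_strips (\<lambda>s. H s + polar_part k a' b' (1 / \<epsilon> * a) (1 / \<epsilon> * b) s)"
    using GH(5) by simp
  show ?L
    unfolding defect_zero_iff[OF \<epsilon>]
    using defect_eq_0[OF P Q k \<epsilon> GH(1-4)] defect_eq_0[OF Q P k \<epsilon>' GH(2,1) HG E'] by blast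
qed

section \<open>Exponential series with coefficients of polynomial growth\<close>

lemma power_exp_minus_le:
  assumes "x \<ge> (0::real)"
  shows "x ^ n * exp (- x) \<le> fact n"
proof -
  have "(\<Sum>k\<in>{n}. x ^ k /\<^sub>R fact k) \<le> exp x"
    unfolding exp_def by (rule sum_le_suminf) (use assms summable_exp_generic[of x] in auto)
  then show ?thesis by (simp add: exp_minus field_simps)
qed

lemma powr_exp_minus_le:
  assumes x: "x > (0::real)" and r: "r \<ge> 0"
  shows "x powr r * exp (- x) \<le> 1 + fact (nat \<lceil>r\<rceil>)"
proof (cases "x \<le> 1")
  case True
  have "x powr r * exp (- x) \<le> 1 * 1"
    using True x r by (intro mult_mono powr_le1) auto
  then show ?thesis by (smt (verit) fact_ge_zero)
next
  case False
  have "x powr r \<le> x powr real (nat \<lceil>r\<rceil>)"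
    using False r by (intro powr_mono) linarith+
  then have "x powr r * exp (- x) \<le> x ^ nat \<lceil>r\<rceil> * exp (- x)"
    using x by (simp add: powr_realpow)
  also have "\<dots> \<le> fact (nat \<lceil>r\<rceil>)" using x by (intro power_exp_minus_le) simp
  finally show ?thesis by simp
qed

text \<open>The condition \<open>c(0) = 0\<close> lets series start at 0 while their constant term is treated apart; rapid decay of
exponential sums depends on it.\<close>

definition poly_growth :: "(nat \<Rightarrow> complex) \<Rightarrow> bool" where
  "poly_growth c \<longleftrightarrow> c 0 = 0 \<and> (\<exists>C p. \<forall>n. norm (c n) \<le> C * real n ^ p)"

lemma poly_growth_mult_power:
  assumes "poly_growth c"
  shows "poly_growth (\<lambda>n. of_nat n ^ j * c n)"
proof -
  obtain C p where C: "\<And>n. norm (c n) \<le> C * real n ^ p" using assms by (auto simp: poly_growth_def)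
  have "norm (of_nat n ^ j * c n) \<le> C * real n ^ (j + p)" for n
    using mult_left_mono[OF C[of n], of "real n ^ j"] by (simp add: norm_mult norm_power power_add mult_ac)
  then show ?thesis using assms by (auto simp: poly_growth_def)
qed

definition exp_term :: "real \<Rightarrow> (nat \<Rightarrow> complex) \<Rightarrow> nat \<Rightarrow> real \<Rightarrow> nat \<Rightarrow> complex" where
  "exp_term l c j t n = c n * of_real ((l * real n * t) ^ j * exp (- (l * real n * t)))"

definition exp_sum :: "real \<Rightarrow> (nat \<Rightarrow> complex) \<Rightarrow> nat \<Rightarrow> real \<Rightarrow> complex" where
  "exp_sum l c j t = (\<Sum>n. exp_term l c j t n)"

text \<open>With \<open>y = lnt\<close>, the factor \<open>y\<^sup>j e\<^sup>-\<^sup>y\<close> is \<open>O(y\<^sup>-\<^sup>B)\<close> for every \<open>B\<close>. Taking \<open>B\<close> larger than the growth exponent of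
\<open>c\<close> by at least 2 absorbs \<open>c(n)\<close> and leaves a summable \<open>n\<^sup>-\<^sup>2\<close>. The same estimate gives convergence and rapid
decay of the sum.\<close>

lemma exp_term_bound:
  assumes c: "poly_growth c" and l: "l > 0"
  shows "\<exists>A. \<forall>B\<ge>A. \<exists>D. \<forall>t n. t > 0 \<longrightarrow> norm (exp_term l c j t n) \<le> D * t powr (- B) * (1 / real n ^ 2)"
proof -
  obtain C p where C: "\<And>n. norm (c n) \<le> C * real n ^ p" and c0: "c 0 = 0"
    using c by (auto simp: poly_growth_def)
  have C0: "C \<ge> 0" using C[of 1] norm_ge_zero[of "c 1"] by (simp del: norm_ge_zero)
  have "\<exists>D. \<forall>t n. t > 0 \<longrightarrow> norm (exp_term l c j t n) \<le> D * t powr (- B) * (1 / real n ^ 2)"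
    if B: "B \<ge> real p + 2" for B
  proof (intro exI allI impI)
    define K :: real where "K = 1 + fact (nat \<lceil>B + j\<rceil>)"
    fix t :: real and n :: nat assume t: "t > 0"
    show "norm (exp_term l c j t n) \<le> (C * K * l powr (- B)) * t powr (- B) * (1 / real n ^ 2)"
    proof (cases "n = 0")
      case True
      then show ?thesis by (simp add: exp_term_def c0)
    next
      case False
      then have n: "real n \<ge> 1" by simp
      define x where "x = l * real n * t"
      have x: "x > 0" using l t n by (simp add: x_def)
      have "x ^ j * exp (- x) = x powr (- B) * (x powr (B + j) * exp (- x))"
        using x by (simp add: powr_add powr_minus powr_realpow)
      also have "\<dots> \<le> x powr (- B) * K"
        unfolding K_def using x B by (intro mult_left_mono powr_exp_minus_le) auto
      also have "x powr (- B) = l powr (- B) * real n powr (- B) * t powr (- B)"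
        unfolding x_def using l t by (simp add: powr_mult)
      also have "\<dots> \<le> l powr (- B) * real n powr (- (real p + 2)) * t powr (- B)"
        using n B by (intro mult_left_mono mult_right_mono powr_mono) auto
      also have "real n powr (- (real p + 2)) = 1 / (real n ^ p * real n ^ 2)"
      proof -
        have "real n powr (real p + 2) = real n ^ (p + 2)"
          using powr_realpow[of "real n" "p + 2"] n by (simp only: of_nat_add of_nat_numeral)
        then show ?thesis by (simp only: powr_minus power_add) (simp add: divide_inverse)
      qed
      finally have le: "x ^ j * exp (- x) \<le> l powr (- B) * (1 / (real n ^ p * real n ^ 2)) * t powr (- B) * K"
        by (simp add: K_def mult_right_mono)
      have "norm (exp_term l c j t n) = norm (c n) * (x ^ j * exp (- x))"
        using x by (simp add: exp_term_def norm_mult norm_power abs_mult flip: x_def)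
      also have "\<dots> \<le> (C * real n ^ p) * (l powr (- B) * (1 / (real n ^ p * real n ^ 2)) * t powr (- B) * K)"
        by (rule mult_mono[OF C le]) (use C0 x in auto)
      also have "\<dots> = (C * K * l powr (- B)) * t powr (- B) * (1 / real n ^ 2)"
        using n by simp
      finally show ?thesis .
    qed
  qed
  then show ?thesis by blast
qed

lemma summable_inverse_squares: "summable (\<lambda>n. 1 / real n ^ 2)"
  using inverse_power_summable[of 2, where 'a = real] by (simp add: inverse_eq_divide)

lemma exp_term_summable:
  assumes c: "poly_growth c" and l: "l > 0" and t: "t > 0"
  shows "summable (\<lambda>n. norm (exp_term l c j t n))" "summable (exp_term l c j t)"
proof -
  obtain B D where D: "\<And>n. norm (exp_term l c j t n) \<le> D * t powr (- B) * (1 / real n ^ 2)"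
    using exp_term_bound[OF c l, of j] t by blast
  have "summable (\<lambda>n. D * t powr (- B) * (1 / real n ^ 2))"
    by (intro summable_mult summable_inverse_squares)
  then show s: "summable (\<lambda>n. norm (exp_term l c j t n))"
    by (rule summable_comparison_test') (use D in auto)
  then show "summable (exp_term l c j t)" by (rule summable_norm_cancel)
qed

definition exp_series :: "real \<Rightarrow> (nat \<Rightarrow> complex) \<Rightarrow> complex \<Rightarrow> complex" where
  "exp_series l c z = (\<Sum>n. c n * exp (\<i> * of_real l * of_nat n * z))"

lemma norm_exp_series_term:
  "norm (c n * exp (\<i> * of_real l * of_nat n * z)) = norm (exp_term l c 0 (Im z) n)"
  by (simp add: exp_term_def norm_mult mult_ac)

lemma exp_series_summable:
  assumes "poly_growth c" "l > 0" "Im z > 0"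
  shows "summable (\<lambda>n. norm (c n * exp (\<i> * of_real l * of_nat n * z)))"
    "summable (\<lambda>n. c n * exp (\<i> * of_real l * of_nat n * z))"
proof -
  show "summable (\<lambda>n. norm (c n * exp (\<i> * of_real l * of_nat n * z)))"
    unfolding norm_exp_series_term by (rule exp_term_summable(1)[OF assms])
  then show "summable (\<lambda>n. c n * exp (\<i> * of_real l * of_nat n * z))"
    by (rule summable_norm_cancel)
qed

text \<open>The series is a power series in \<open>q = e\<^sup>i\<^sup>l\<^sup>z\<close>; differentiation multiplies the \<open>n\<close>-th coefficient by
\<open>iln\<close>.\<close>

lemma exp_series_has_field_derivative:
  assumes c: "poly_growth c" and l: "l > 0" and z: "Im z > 0"
  shows "(exp_series l c has_field_derivative
     \<i> * of_real l * exp_series l (\<lambda>n. of_nat n * c n) z) (at z)"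
proof -
  define q where "q z = exp (\<i> * of_real l * z)" for z :: complex
  have pw: "exp (\<i> * of_real l * of_nat n * z) = q z ^ n" for n z
    by (simp add: q_def exp_of_nat_mult[symmetric] mult_ac)
  have es: "exp_series l c z = (\<Sum>n. c n * q z ^ n)" for z c
    by (simp add: exp_series_def pw)
  \<comment> \<open>Each nonzero \<open>w\<close> in the unit disc is a value of \<open>q\<close> on the upper half-plane.\<close>
  have sm: "summable (\<lambda>n. c' n * w ^ n)" if w: "norm w < 1" and c': "poly_growth c'" for w c'
  proof (cases "w = 0")
    case True
    then show ?thesis by simp
  next
    case False
    define z' where "z' = Ln w / (\<i> * of_real l)"
    have "q z' = w" using False l by (simp add: q_def z'_def)
    moreover have "Im z' > 0"
    proof -
      have "norm w = exp (- l * Im z')" using \<open>q z' = w\<close> by (auto simp: q_def)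
      then have "- l * Im z' < 0" using w by simp
      then show ?thesis using l by (simp add: zero_less_mult_iff)
    qed
    ultimately show ?thesis using exp_series_summable(2)[OF c' l, of z'] by (simp add: pw)
  qed
  have q1: "norm (q z) < 1" using z l by (simp add: q_def)
  have "((\<lambda>w. \<Sum>n. c n * w ^ n) has_field_derivative (\<Sum>n. diffs c n * q z ^ n)) (at (q z))"
    by (rule termdiffs_strong'[OF sm[OF _ c] q1])
  moreover have "(q has_field_derivative \<i> * of_real l * q z) (at z)"
    unfolding q_def[abs_def] by (auto intro!: derivative_eq_intros)
  ultimately have D: "(exp_series l c has_field_derivative
      (\<Sum>n. diffs c n * q z ^ n) * (\<i> * of_real l * q z)) (at z)"
    unfolding es[abs_def] by (rule DERIV_chain2)
  have "(\<lambda>n. of_nat n * c n * q z ^ (n - Suc 0)) sums (\<Sum>n. diffs c n * q z ^ n)"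
    by (rule diffs_equiv, rule termdiff_converges[OF q1 sm[OF _ c]]) 
  from sums_mult2[OF this, of "q z"]
  have "(\<lambda>n. of_nat n * c n * q z ^ (n - Suc 0) * q z) sums ((\<Sum>n. diffs c n * q z ^ n) * q z)" .
  moreover have "of_nat n * c n * q z ^ (n - Suc 0) * q z = of_nat n * c n * q z ^ n" for n
    by (cases n) auto
  ultimately have "(\<Sum>n. diffs c n * q z ^ n) * q z = exp_series l (\<lambda>n. of_nat n * c n) z"
    unfolding es by (simp add: sums_unique)
  then have "(\<Sum>n. diffs c n * q z ^ n) * (\<i> * of_real l * q z)
      = \<i> * of_real l * exp_series l (\<lambda>n. of_nat n * c n) z"
    by (metis mult.commute mult.left_commute)
  then show ?thesis using D by (simp only:)
qed

lemma exp_sum_eq_exp_series: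
  assumes c: "poly_growth c" and l: "l > 0" and t: "t > 0"
  shows "exp_sum l c j t = of_real (l * t) ^ j * exp_series l (\<lambda>n. of_nat n ^ j * c n) (\<i> * of_real t)"
proof -
  have "exp_term l c j t n = of_real (l * t) ^ j *
      ((of_nat n ^ j * c n) * exp (\<i> * of_real l * of_nat n * (\<i> * of_real t)))" for n
  proof -
    have "\<i> * of_real l * of_nat n * (\<i> * of_real t) = of_real (- (l * real n * t))"
      by (simp add: complex_eq_iff)
    then show ?thesis
      by (simp only: exp_of_real exp_term_def) (simp add: power_mult_distrib mult_ac)
  qed
  then have eq: "exp_term l c j t = (\<lambda>n. of_real (l * t) ^ j *
      ((of_nat n ^ j * c n) * exp (\<i> * of_real l * of_nat n * (\<i> * of_real t))))" by (rule ext)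
  show ?thesis
    unfolding exp_sum_def exp_series_def eq
    by (rule suminf_mult, rule exp_series_summable(2)[OF poly_growth_mult_power[OF c] l]) (simp add: t)
qed

lemma exp_sum_rapid_decay:
  assumes c: "poly_growth c" and l: "l > 0"
  shows "rapid_decay (exp_sum l c j)"
  unfolding rapid_decay_def
proof
  have es: "continuous_on {z. 0 < Im z} (exp_series l (\<lambda>n. of_nat n ^ j * c n))"
    using exp_series_has_field_derivative[OF poly_growth_mult_power[OF c] l]
    by (intro continuous_at_imp_continuous_on ballI) (auto intro: DERIV_isCont)
  have "continuous_on {0<..} (\<lambda>t. exp_series l (\<lambda>n. of_nat n ^ j * c n) (\<i> * of_real t))"
    by (rule continuous_on_compose2[OF es]) (auto intro!: continuous_intros)
  then have "continuous_on {0<..} (\<lambda>t. of_real (l * t) ^ j * exp_series l (\<lambda>n. of_nat n ^ j * c n) (\<i> * of_real t))"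
    by (intro continuous_intros)
  then show "continuous_on {0<..} (exp_sum l c j)"
    by (rule continuous_on_eq) (simp add: exp_sum_eq_exp_series[OF c l])
  obtain A where A: "\<And>B. B \<ge> A \<Longrightarrow> \<exists>D. \<forall>t n. t > 0 \<longrightarrow> norm (exp_term l c j t n) \<le> D * t powr (- B) * (1 / real n ^ 2)"
    using exp_term_bound[OF c l, of j] by blast
  show "\<exists>A. \<forall>B\<ge>A. \<exists>C. \<forall>t>0. norm (exp_sum l c j t) \<le> C * t powr (- B)"
  proof (rule exI[of _ A], intro allI impI)
    fix B assume "B \<ge> A"
    then obtain D where D: "\<And>t n. t > 0 \<Longrightarrow> norm (exp_term l c j t n) \<le> D * t powr (- B) * (1 / real n ^ 2)"
      using A by blast
    show "\<exists>C. \<forall>t>0. norm (exp_sum l c j t) \<le> C * t powr (- B)"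
    proof (intro exI allI impI)
      fix t :: real assume t: "t > 0"
      have "norm (exp_sum l c j t) \<le> (\<Sum>n. D * t powr (- B) * (1 / real n ^ 2))"
        unfolding exp_sum_def
        by (rule norm_suminf_le[OF D[OF t]], intro summable_mult summable_inverse_squares)
      also have "\<dots> = (D * (\<Sum>n. 1 / real n ^ 2)) * t powr (- B)"
        by (subst suminf_mult[OF summable_inverse_squares]) simp
      finally show "norm (exp_sum l c j t) \<le> (D * (\<Sum>n. 1 / real n ^ 2)) * t powr (- B)" .
    qed
  qed
qed

section \<open>Mellin transforms of exponentials\<close>

definition has_mellin :: "(real \<Rightarrow> complex) \<Rightarrow> complex \<Rightarrow> complex \<Rightarrow> bool" where
  "has_mellin P s v \<longleftrightarrow>
     set_integrable lborel {0<..} (\<lambda>t. P t * of_real t powr (s - 1)) \<and> mellin P s = v"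

lemma has_mellin_add:
  "has_mellin P s v \<Longrightarrow> has_mellin Q s w \<Longrightarrow> has_mellin (\<lambda>t. P t + Q t) s (v + w)"
  unfolding has_mellin_def mellin_def by (auto simp: distrib_right set_integral_add)

lemma has_mellin_cmult:
  "has_mellin P s v \<Longrightarrow> has_mellin (\<lambda>t. c * P t) s (c * v)"
  unfolding has_mellin_def mellin_def by (auto simp: mult.assoc)

lemma has_mellin_0: "has_mellin (\<lambda>_. 0) s 0"
  by (simp add: has_mellin_def mellin_def set_integrable_def set_lebesgue_integral_def)

lemma has_mellin_sum:
  "finite I \<Longrightarrow> (\<And>i. i \<in> I \<Longrightarrow> has_mellin (P i) s (v i)) \<Longrightarrow>
   has_mellin (\<lambda>t. \<Sum>i\<in>I. P i t) s (\<Sum>i\<in>I. v i)"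
  by (induction I rule: finite_induct) (auto intro: has_mellin_0 has_mellin_add)

lemma has_mellin_exp:
  assumes s: "Re s > 0"
  shows "has_mellin (\<lambda>t. of_real (exp (- t))) s (Gamma s)"
proof -
  have eq: "of_real t powr (s - 1) / of_real (exp t) = of_real (exp (- t)) * of_real t powr (s - 1)" for t :: real
    by (simp add: exp_minus field_simps)
  have a: "(\<lambda>t. of_real (exp (- t)) * of_real t powr (s - 1)) absolutely_integrable_on {0<..}"
    using absolutely_integrable_Gamma_integral[OF s, of 1] by (simp add: eq[symmetric])
  have c: "continuous_on {0<..} (\<lambda>t. of_real (exp (- t)) * complex_of_real t powr (s - 1))"
    by (intro continuous_intros) (auto simp: complex_nonpos_Reals_iff)
  have i: "set_integrable lborel {0<..} (\<lambda>t. of_real (exp (- t)) * complex_of_real t powr (s - 1))"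
    using a unfolding set_integrable_def
    by (subst (asm) integrable_completion)
       (use borel_measurable_continuous_on_indicator[OF _ c] in simp_all)
  have "((\<lambda>t. of_real (exp (- t)) * of_real t powr (s - 1)) has_integral Gamma s) {0<..}"
  proof (rule iffD1[OF has_integral_spike_set_eq Gamma_integral_complex[OF s, unfolded eq]])
    let ?f = "\<lambda>t. of_real (exp (- t)) * complex_of_real t powr (s - 1)"
    have "{t \<in> {0..} - {0<..}. ?f t \<noteq> 0} \<subseteq> {0}" by auto
    then show "negligible {t \<in> {0..} - {0<..}. ?f t \<noteq> 0}"
      by (rule negligible_subset[OF negligible_sing])
    have "{t \<in> {0<..} - {0..}. ?f t \<noteq> 0} = {}" by auto
    then show "negligible {t \<in> {0<..} - {0..}. ?f t \<noteq> 0}" by (simp only: negligible_empty)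
  qed
  then show ?thesis
    using i set_borel_integral_eq_integral(2)[OF i]
    by (simp add: has_mellin_def mellin_def integral_unique)
qed

lemma has_mellin_scale:
  assumes P: "has_mellin P s v" and a: "a > 0"
  shows "has_mellin (\<lambda>t. P (a * t)) s (of_real a powr (- s) * v)"
proof -
  let ?f = "\<lambda>t. indicator {0<..} t *\<^sub>R (P t * of_real t powr (s - 1))"
  have i: "integrable lborel ?f" and v: "v = (\<integral>t. ?f t \<partial>lborel)"
    using P by (auto simp: has_mellin_def mellin_def set_integrable_def set_lebesgue_integral_def)
  have eq: "?f (0 + a * t) = of_real a powr (s - 1) *
      (indicator {0<..} t *\<^sub>R (P (a * t) * of_real t powr (s - 1)))" for t
    using a by (auto simp: indicator_def powr_times_real zero_less_mult_iff)
  have a0: "of_real a powr (s - 1) \<noteq> (0::complex)" using a by simp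
  have i': "set_integrable lborel {0<..} (\<lambda>t. P (a * t) * of_real t powr (s - 1))"
  proof -
    have "set_integrable lborel {0<..}
        (\<lambda>t. of_real a powr (s - 1) * (P (a * t) * of_real t powr (s - 1)))"
      using lborel_integrable_real_affine[OF i, of a 0, unfolded eq] a
      by (simp add: set_integrable_def)
    from set_integrable_mult_right[OF this, of "inverse (of_real a powr (s - 1))"] show ?thesis
      using a0 by (simp add: mult.assoc[symmetric])
  qed
  have "v = of_real a * (of_real a powr (s - 1) * mellin (\<lambda>t. P (a * t)) s)"
    unfolding v using lborel_integral_real_affine[of a ?f 0, unfolded eq] a
    by (simp add: mellin_def set_lebesgue_integral_def scaleR_conv_of_real)
  also have "\<dots> = of_real a powr s * mellin (\<lambda>t. P (a * t)) s"
    using a by (simp add: powr_diff)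
  finally have "mellin (\<lambda>t. P (a * t)) s = of_real a powr (- s) * v"
    using a by (simp add: powr_minus)
  then show ?thesis using i' by (simp add: has_mellin_def)
qed

lemma has_mellin_power_exp:
  assumes s: "Re s > 0"
  shows "has_mellin (\<lambda>t. of_real (t ^ j * exp (- t))) s (Gamma (s + of_nat j))"
proof -
  have e: "has_mellin (\<lambda>t. of_real (exp (- t))) (s + of_nat j) (Gamma (s + of_nat j))"
    by (rule has_mellin_exp) (use s in simp)
  have eq: "of_real (t ^ j * exp (- t)) * of_real t powr (s - 1) =
      of_real (exp (- t)) * (of_real t powr (s + of_nat j - 1) :: complex)" if "t \<in> {0<..}" for t
  proof -
    have "of_real t powr (s + of_nat j - 1) = (of_real t powr (s - 1 + of_nat j) :: complex)"
      by (simp add: algebra_simps)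
    also have "\<dots> = of_real t powr (s - 1) * of_real t ^ j"
      using that by (simp add: powr_add powr_nat')
    finally show ?thesis by (simp add: mult_ac)
  qed
  have "set_integrable lborel {0<..} (\<lambda>t. of_real (t ^ j * exp (- t)) * complex_of_real t powr (s - 1))"
    using e by (subst set_integrable_cong[OF refl refl eq]) (auto simp: has_mellin_def)
  moreover have "mellin (\<lambda>t. of_real (t ^ j * exp (- t))) s = mellin (\<lambda>t. of_real (exp (- t))) (s + of_nat j)"
    unfolding mellin_def by (rule set_lebesgue_integral_cong) (use eq in auto)
  ultimately show ?thesis using e by (simp add: has_mellin_def)
qed


section \<open>The incomplete gamma function at positive integers\<close>

lemma inc_Gamma_nat:
  assumes x: "x > 0"
  shows "inc_Gamma (of_nat (Suc m)) x = of_real (fact m * exp (- x) * (\<Sum>j\<le>m. x ^ j / fact j))"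
proof -
  define F where "F t = - (fact m * exp (- t) * (\<Sum>j\<le>m. t ^ j / fact j))" for t :: real
  have d: "((\<lambda>t. exp (- t) * (\<Sum>j\<le>n. t ^ j / fact j)) has_real_derivative - (exp (- t) * (t ^ n / fact n))) (at t)"
    for n and t :: real
  proof (induction n)
    case 0
    then show ?case by (auto intro!: derivative_eq_intros)
  next
    case (Suc n)
    have "((\<lambda>t. t ^ Suc n / fact (Suc n)) has_real_derivative t ^ n / fact n) (at t)"
      using DERIV_cdivide[OF DERIV_pow[of "Suc n" t], of "fact (Suc n)"] by (simp del: of_nat_Suc power_Suc)
    then have "((\<lambda>t. exp (- t) * (t ^ Suc n / fact (Suc n))) has_real_derivative
        (exp (- t) * (- 1)) * (t ^ Suc n / fact (Suc n)) + (t ^ n / fact n) * exp (- t)) (at t)"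
      by (intro DERIV_mult) (auto intro!: derivative_eq_intros)
    from DERIV_add[OF Suc this] show ?case by (simp add: algebra_simps)
  qed
  have dF: "(F has_real_derivative t ^ m * exp (- t)) (at t)" for t
    unfolding F_def[abs_def] using DERIV_cmult[OF d[of m t], of "- fact m"] by (simp add: mult_ac)
  have lim: "(F \<longlongrightarrow> 0) at_top"
  proof -
    have "((\<lambda>t. - (fact m * (\<Sum>j\<le>m. (t ^ j / exp t) / fact j))) \<longlongrightarrow> - (fact m * (\<Sum>j\<le>m. (0::real) / fact j))) at_top"
      by (intro tendsto_intros tendsto_power_div_exp_0) auto
    then show ?thesis
      unfolding F_def[abs_def] by (simp add: sum_distrib_left exp_minus field_simps)
  qed
  have nn: "(\<integral>\<^sup>+t. ennreal (t ^ m * exp (- t)) * indicator {x..} t \<partial>lborel) = ennreal (0 - F x)"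
    by (rule nn_integral_FTC_atLeast[OF _ dF _ lim]) (use x in auto)
  have "has_bochner_integral lborel (\<lambda>t. t ^ m * exp (- t) * indicator {x..} t) (- F x)"
  proof (rule has_bochner_integral_nn_integral)
    show "AE t in lborel. 0 \<le> t ^ m * exp (- t) * indicator {x..} t"
      using x by (intro AE_I2) (auto simp: indicator_def)
    show "0 \<le> - F x" using x by (auto simp: F_def intro!: mult_nonneg_nonneg sum_nonneg)
    show "(\<integral>\<^sup>+t. ennreal (t ^ m * exp (- t) * indicator {x..} t) \<partial>lborel) = ennreal (- F x)"
      using nn by (subst nn_integral_cong[where v = "\<lambda>t. ennreal (t ^ m * exp (- t)) * indicator {x..} t"])
        (auto split: split_indicator)
  qed auto
  then have I: "(LBINT t:{x..}. t ^ m * exp (- t)) = - F x"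
    by (simp add: has_bochner_integral_iff set_lebesgue_integral_def mult_ac)
  have "inc_Gamma (of_nat (Suc m)) x = (LBINT t:{x..}. of_real (t ^ m * exp (- t)))"
    unfolding inc_Gamma_def
  proof (rule set_lebesgue_integral_cong)
    show "\<forall>t. t \<in> {x..} \<longrightarrow> of_real (exp (- t)) * of_real t powr (of_nat (Suc m) - 1) = (of_real (t ^ m * exp (- t)) :: complex)"
      using x by (auto simp: powr_nat' mult_ac)
  qed auto
  also have "\<dots> = of_real (LBINT t:{x..}. t ^ m * exp (- t))"
    by (rule set_integral_complex_of_real)
  finally show ?thesis using I by (simp add: F_def)
qed

text \<open>\<open>\<Gamma>(m + 1, 2x) e\<^sup>x\<close> is \<open>e\<^sup>-\<^sup>x\<close> times a polynomial, so the non-holomorphic part of the Fourier series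
contributes ordinary gamma factors.\<close>

lemma W_nat:
  assumes s: "Re s > 0"
  shows "W (of_nat (Suc m)) s = (\<Sum>j\<le>m. of_real (fact m * 2 ^ j / fact j) * Gamma (s + of_nat j))"
proof -
  have h: "has_mellin (\<lambda>t. \<Sum>j\<le>m. of_real (fact m * 2 ^ j / fact j) * of_real (t ^ j * exp (- t))) s
      (\<Sum>j\<le>m. of_real (fact m * 2 ^ j / fact j) * Gamma (s + of_nat j))"
    by (intro has_mellin_sum has_mellin_cmult has_mellin_power_exp s) auto
  have "W (of_nat (Suc m)) s = mellin (\<lambda>t. \<Sum>j\<le>m. of_real (fact m * 2 ^ j / fact j) * of_real (t ^ j * exp (- t))) s"
    unfolding W_def mellin_def
  proof (rule set_lebesgue_integral_cong)
    have "inc_Gamma (of_nat (Suc m)) (2 * x) * of_real (exp x) * of_real x powr s / of_real x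
      = (\<Sum>j\<le>m. of_real (fact m * 2 ^ j / fact j) * of_real (x ^ j * exp (- x))) * of_real x powr (s - 1)"
      if x: "x > 0" for x
    proof -
      have "fact m * exp (- (2 * x)) * (\<Sum>j\<le>m. (2 * x) ^ j / fact j) * exp x
        = (\<Sum>j\<le>m. fact m * 2 ^ j / fact j * (x ^ j * (exp (- (2 * x)) * exp x)))"
        by (simp add: sum_distrib_left sum_distrib_right power_mult_distrib mult_ac)
      also have "exp (- (2 * x)) * exp x = exp (- x)" by (simp flip: exp_add)
      finally have eq: "fact m * exp (- (2 * x)) * (\<Sum>j\<le>m. (2 * x) ^ j / fact j) * exp x
        = (\<Sum>j\<le>m. fact m * 2 ^ j / fact j * (x ^ j * exp (- x)))" .
      have i: "inc_Gamma (of_nat (Suc m)) (2 * x)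
          = of_real (fact m * exp (- (2 * x)) * (\<Sum>j\<le>m. (2 * x) ^ j / fact j))"
        by (rule inc_Gamma_nat) (use x in simp)
      have e: "inc_Gamma (of_nat (Suc m)) (2 * x) * of_real (exp x) =
          of_real (\<Sum>j\<le>m. fact m * 2 ^ j / fact j * (x ^ j * exp (- x)))"
        unfolding i eq[symmetric] by (rule of_real_mult[symmetric])
      have "of_real x powr (s - 1) = of_real x powr s / (of_real x :: complex)"
        using x by (simp add: powr_diff)
      then show ?thesis unfolding e by simp
    qed
    then show "\<forall>x. x \<in> {0<..} \<longrightarrow> inc_Gamma (of_nat (Suc m)) (2 * x) * of_real (exp x) * of_real x powr s / of_real x
      = (\<Sum>j\<le>m. of_real (fact m * 2 ^ j / fact j) * of_real (x ^ j * exp (- x))) * of_real x powr (s - 1)"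
      by simp
  qed auto
  then show ?thesis using h by (simp add: has_mellin_def)
qed

section \<open>Dirichlet series as Mellin transforms\<close>

lemma dirichlet_summable:
  assumes c: "poly_growth c"
  obtains \<sigma> where "\<sigma> > 0" "\<And>s. Re s > \<sigma> \<Longrightarrow> summable (\<lambda>n. norm (c n * of_nat n powr (- s)))"
proof -
  obtain C p where C: "\<And>n. norm (c n) \<le> C * real n ^ p" and c0: "c 0 = 0"
    using c by (auto simp: poly_growth_def)
  have C0: "C \<ge> 0" using C[of 1] norm_ge_zero[of "c 1"] by (simp del: norm_ge_zero)
  show ?thesis
  proof (rule that[of "real p + 2"])
    fix s assume s: "Re s > real p + 2"
    have "norm (c n * of_nat n powr (- s)) \<le> C * (1 / real n ^ 2)" for n
    proof (cases "n = 0")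
      case False
      then have n: "real n \<ge> 1" by simp
      have "norm (of_nat n powr (- s) :: complex) = real n powr (- Re s)"
        using n norm_powr_real_powr[of "of_nat n" "- s"] by simp
      also have "\<dots> \<le> real n powr (- (real p + 2))" using n s by (intro powr_mono) auto
      also have "\<dots> = 1 / (real n ^ p * real n ^ 2)"
      proof -
        have "real n powr (real p + 2) = real n ^ (p + 2)"
          using powr_realpow[of "real n" "p + 2"] n by (simp only: of_nat_add of_nat_numeral)
        then show ?thesis by (simp only: powr_minus power_add) (simp add: divide_inverse)
      qed
      finally have "norm (c n * of_nat n powr (- s)) \<le> (C * real n ^ p) * (1 / (real n ^ p * real n ^ 2))"
        unfolding norm_mult by (intro mult_mono[OF C]) (use C0 in auto)
      then show ?thesis using n by simp
    qed (simp add: c0)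
    then show "summable (\<lambda>n. norm (c n * of_nat n powr (- s)))"
      by (intro summable_comparison_test'[OF summable_mult[OF summable_inverse_squares, of C]]) auto
  qed simp
qed

text \<open>Termwise integration; it is legitimate because the integrals of the absolute values are the same
terms with \<open>s\<close> replaced by its real part, and these are summable for \<open>Re s\<close> large.\<close>

lemma has_mellin_exp_sum:
  assumes c: "poly_growth c" and l: "l > 0"
  obtains \<sigma> where "\<sigma> > 0" "\<And>s. Re s > \<sigma> \<Longrightarrow> has_mellin (exp_sum l c j) s
    (Gamma (s + of_nat j) * of_real l powr (- s) * (\<Sum>n. c n * of_nat n powr (- s)))"
proof -
  obtain \<sigma> where \<sigma>: "\<sigma> > 0" "\<And>s. Re s > \<sigma> \<Longrightarrow> summable (\<lambda>n. norm (c n * of_nat n powr (- s)))"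
    using dirichlet_summable[OF c] by blast
  have c0: "c 0 = 0" using c by (simp add: poly_growth_def)
  show ?thesis
  proof (rule that[OF \<sigma>(1)])
    fix s assume s: "Re s > \<sigma>"
    define f where "f n t = indicator {0<..} t *\<^sub>R (exp_term l c j t n * of_real t powr (s - 1))" for n and t :: real
    have single: "has_mellin (\<lambda>t. exp_term l c' j t n) w
        (c' n * (of_nat n powr (- w) * of_real l powr (- w) * Gamma (w + of_nat j)))"
      if w: "Re w > 0" and c': "c' 0 = 0" for n w c'
    proof (cases "n = 0")
      case True
      then show ?thesis using has_mellin_0 c' by (simp add: exp_term_def)
    next
      case False
      have "has_mellin (\<lambda>t. c' n * of_real (((l * real n) * t) ^ j * exp (- ((l * real n) * t)))) w
         (c' n * (of_real (l * real n) powr (- w) * Gamma (w + of_nat j)))"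
        using l False by (intro has_mellin_cmult has_mellin_scale[OF has_mellin_power_exp[OF w]]) simp
      also have "of_real (l * real n) powr (- w) = of_nat n powr (- w) * (of_real l powr (- w) :: complex)"
        using l powr_times_real[of "of_nat n" "of_real l" "- w"] by (simp add: mult.commute)
      finally show ?thesis by (simp add: exp_term_def mult_ac)
    qed
    have s0: "Re s > 0" using s \<sigma>(1) by simp
    have i: "integrable lborel (f n)" and v: "(\<integral>t. f n t \<partial>lborel) =
        c n * (of_nat n powr (- s) * of_real l powr (- s) * Gamma (s + of_nat j))" for n
      using single[where c' = c, OF s0 c0, of n] unfolding has_mellin_def mellin_def set_integrable_def set_lebesgue_integral_def f_def
      by auto
    have nv: "(\<integral>t. norm (f n t) \<partial>lborel) =
        norm (c n) * Re (of_nat n powr (- of_real (Re s)) * of_real l powr (- of_real (Re s)) * Gamma (of_real (Re s) + of_nat j))" for n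
    proof (cases "n = 0")
      case False
      \<comment> \<open>With unit coefficients and a real argument, the formula for a single term evaluates the integral
        of the absolute value.\<close>
      let ?w = "of_real (Re s) :: complex" and ?c = "\<lambda>k. if k = 0 then 0 else 1 :: complex"
      have t: "has_mellin (\<lambda>t. exp_term l ?c j t n) ?w
          (of_nat n powr (- ?w) * of_real l powr (- ?w) * Gamma (?w + of_nat j))"
        using single[where w = ?w and c' = ?c and n = n] s0 False by simp
      define F where "F t = indicator {0<..} t *\<^sub>R (exp_term l ?c j t n * of_real t powr (?w - 1))" for t
      have iF: "integrable lborel F" and vF: "(\<integral>t. F t \<partial>lborel)
          = of_nat n powr (- ?w) * of_real l powr (- ?w) * Gamma (?w + of_nat j)"
        using t unfolding has_mellin_def mellin_def set_integrable_def set_lebesgue_integral_def F_def[symmetric]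
        by auto
      have "norm (f n t) = norm (c n) * Re (F t)" for t
      proof (cases "t > 0")
        case True
        have "of_real t powr (?w - 1) = of_real (t powr (Re s - 1))"
          using True powr_of_real[of t "Re s - 1"] by simp
        then show ?thesis using True l False
          by (simp add: F_def f_def exp_term_def norm_mult norm_power norm_powr_real_powr abs_mult flip: of_real_power of_real_mult)
      qed (simp add: f_def F_def)
      then have "(\<integral>t. norm (f n t) \<partial>lborel) = (\<integral>t. norm (c n) * Re (F t) \<partial>lborel)" by (simp only:)
      also have "\<dots> = norm (c n) * Re (\<integral>t. F t \<partial>lborel)"
        using integral_Re[OF iF] by simp
      also note vF
      finally show ?thesis .
    qed (simp add: f_def exp_term_def c0)
    have sn: "summable (\<lambda>n. \<integral>t. norm (f n t) \<partial>lborel)"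
    proof -
      let ?w = "of_real (Re s) :: complex"
      have "summable (\<lambda>n. norm (c n * of_nat n powr (- ?w)))" using \<sigma>(2)[of ?w] s by simp
      then have "summable (\<lambda>n. norm (c n * of_nat n powr (- ?w)) * norm (of_real l powr (- ?w) * Gamma (?w + of_nat j)))"
        by (rule summable_mult2)
      then show ?thesis
      proof (rule summable_comparison_test')
        fix n :: nat
        have b: "norm (norm (c n) * Re z) \<le> norm (c n) * norm z" for z
          by (simp add: abs_mult mult_left_mono abs_Re_le_cmod)
        show "norm (\<integral>t. norm (f n t) \<partial>lborel) \<le> norm (c n * of_nat n powr (- ?w)) * norm (of_real l powr (- ?w) * Gamma (?w + of_nat j))"
          unfolding nv by (rule order_trans[OF b]) (simp add: norm_mult mult.assoc)
      qed
    qed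
    have ae: "AE t in lborel. summable (\<lambda>n. norm (f n t))"
    proof (intro AE_I2)
      fix t :: real
      show "summable (\<lambda>n. norm (f n t))"
      proof (cases "t > 0")
        case True
        then show ?thesis
          using summable_mult2[OF exp_term_summable(1)[OF c l True, of j], of "norm (of_real t powr (s - 1) :: complex)"]
          by (simp add: f_def norm_mult)
      qed (simp add: f_def)
    qed
    have fs: "(\<Sum>n. f n t) = indicator {0<..} t *\<^sub>R (exp_sum l c j t * of_real t powr (s - 1))" for t
    proof (cases "t > 0")
      case True
      then show ?thesis
        using suminf_mult2[OF exp_term_summable(2)[OF c l True, of j], of "of_real t powr (s - 1)"]
        by (simp add: f_def exp_sum_def)
    qed (simp add: f_def)
    have "mellin (exp_sum l c j) s = (\<Sum>n. c n * (of_nat n powr (- s) * of_real l powr (- s) * Gamma (s + of_nat j)))"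
      using integral_suminf[OF i ae sn] unfolding fs v by (simp add: mellin_def set_lebesgue_integral_def)
    also have "\<dots> = (\<Sum>n. (Gamma (s + of_nat j) * of_real l powr (- s)) * (c n * of_nat n powr (- s)))"
      by (simp add: mult_ac)
    also have "\<dots> = Gamma (s + of_nat j) * of_real l powr (- s) * (\<Sum>n. c n * of_nat n powr (- s))"
      by (rule suminf_mult[OF summable_norm_cancel[OF \<sigma>(2)[OF s]]])
    finally show "has_mellin (exp_sum l c j) s
        (Gamma (s + of_nat j) * of_real l powr (- s) * (\<Sum>n. c n * of_nat n powr (- s)))"
      using integrable_suminf[OF i ae sn] unfolding fs by (simp add: has_mellin_def set_integrable_def)
  qed
qed

section \<open>Vanishing from Cauchy data on the imaginary axis\<close>

lemma has_field_derivative_eq_0_if_zero_on_reals: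
  assumes h: "(h has_field_derivative d) (at (of_real r))" and e: "e > 0"
    and zero: "\<And>x. \<bar>x - r\<bar> < e \<Longrightarrow> h (complex_of_real x) = 0"
  shows "d = 0"
proof -
  have "((\<lambda>x. h (of_real x)) has_vector_derivative d) (at r)"
    using h by (rule has_vector_derivative_real_field)
  then have "((\<lambda>_. 0) has_vector_derivative d) (at r)"
    by (rule has_vector_derivative_transform_within_open[of _ _ _ "ball r e"])
       (use zero e in \<open>auto simp: dist_real_def abs_minus_commute\<close>)
  then show ?thesis
    using vector_derivative_unique_at has_vector_derivative_const by blast
qed

lemma holomorphic_zero_on_imaginary_ray:
  assumes f: "f holomorphic_on S" "open S" "connected S" and ray: "\<And>t. t > 0 \<Longrightarrow> u * of_real t \<in> S"
    and u: "u \<noteq> 0" and zero: "\<And>t. t > 0 \<Longrightarrow> f (u * of_real t) = 0" and w: "w \<in> S"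
  shows "f w = 0"
proof (rule analytic_continuation[OF f])
  let ?U = "(\<lambda>t. u * of_real t) ` {0<..}"
  show "?U \<subseteq> S" "u \<in> S" using ray ray[of 1] by auto
  show "u islimpt ?U"
    unfolding islimpt_approachable
  proof (intro allI impI)
    fix e :: real assume e: "e > 0"
    define r where "r = e / (2 * norm u)"
    have r: "r > 0" using e u by (simp add: r_def)
    have eq: "u * of_real (1 + r) - u = u * of_real r" by (simp add: algebra_simps)
    have "dist (u * of_real (1 + r)) u = norm u * \<bar>r\<bar>"
      unfolding dist_norm eq by (simp add: norm_mult)
    then have "dist (u * of_real (1 + r)) u = e / 2"
      using u r e by (simp add: r_def)
    then have "u * of_real (1 + r) \<noteq> u \<and> dist (u * of_real (1 + r)) u < e" using e by auto
    then show "\<exists>x'\<in>?U. x' \<noteq> u \<and> dist x' u < e"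
      by (rule bexI) (rule imageI, use r in simp)
  qed
qed (use zero w in auto)

text \<open>The assumption on derivatives says that \<open>D(z, w)\<close> has derivative \<open>Du\<close> in the direction \<open>(1, 1)\<close>, which is the
direction of real translation of \<open>z\<close> when \<open>w\<close> is its conjugate, and \<open>(z - w)\<^sup>m B(w)\<close> in the direction \<open>(0, 1)\<close>.
It is stated along curves with a complex parameter, so that the axis and horizontal lines can
both be inserted. Vanishing of \<open>D\<close> along the axis gives a second linear relation between the two derivatives,
which forces \<open>B\<close> to vanish on a ray.\<close>

lemma vanishing_criterion:
  fixes D Du :: "complex \<Rightarrow> complex \<Rightarrow> complex" and B :: "complex \<Rightarrow> complex"
  assumes chain: "\<And>\<zeta> \<omega> x z' w'. (\<zeta> has_field_derivative z') (at x) \<Longrightarrow> (\<omega> has_field_derivative w') (at x) \<Longrightarrow>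
      Im (\<zeta> x) > 0 \<Longrightarrow> Im (\<omega> x) < 0 \<Longrightarrow>
      ((\<lambda>x. D (\<zeta> x) (\<omega> x)) has_field_derivative
        Du (\<zeta> x) (\<omega> x) * z' + (\<zeta> x - \<omega> x) ^ m * B (\<omega> x) * (w' - z')) (at x)"
    and B: "B holomorphic_on {w. Im w < 0}"
  shows "(\<forall>z. Im z > 0 \<longrightarrow> D z (cnj z) = 0) \<longleftrightarrow>
    (\<forall>t>0. D (\<i> * of_real t) (- \<i> * of_real t) = 0) \<and> (\<forall>t>0. Du (\<i> * of_real t) (- \<i> * of_real t) = 0)"
    (is "?L \<longleftrightarrow> ?R1 \<and> ?R2")
proof
  assume L: ?L
  have ?R1
  proof (intro allI impI)
    fix t :: real assume "t > 0"
    then show "D (\<i> * of_real t) (- \<i> * of_real t) = 0" using L[rule_format, of "\<i> * of_real t"] by simp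
  qed
  moreover have ?R2
  proof (intro allI impI)
    fix t :: real assume t: "t > 0"
    \<comment> \<open>Horizontal translation: \<open>w\<close> remains the conjugate of \<open>z\<close> for real \<open>x\<close>.\<close>
    let ?z = "\<lambda>x. \<i> * of_real t + x" and ?w = "\<lambda>x. - \<i> * of_real t + x"
    have "((\<lambda>x. D (?z x) (?w x)) has_field_derivative
        Du (?z (of_real 0)) (?w (of_real 0)) * 1 + (?z (of_real 0) - ?w (of_real 0)) ^ m * B (?w (of_real 0)) * (1 - 1)) (at (of_real 0))"
      by (rule chain) (auto intro!: derivative_eq_intros simp: t)
    then have "Du (?z (of_real 0)) (?w (of_real 0)) * 1 + (?z (of_real 0) - ?w (of_real 0)) ^ m * B (?w (of_real 0)) * (1 - 1) = 0"
    proof (rule has_field_derivative_eq_0_if_zero_on_reals[where e = 1])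
      fix x :: real
      show "D (?z (of_real x)) (?w (of_real x)) = 0"
        using L[rule_format, of "?z (of_real x)"] t by simp
    qed simp
    then show "Du (\<i> * of_real t) (- \<i> * of_real t) = 0" by simp
  qed
  ultimately show "?R1 \<and> ?R2" ..
next
  assume R: "?R1 \<and> ?R2"
  have B0: "B (- \<i> * of_real t) = 0" if t: "t > 0" for t
  proof -
    \<comment> \<open>Motion along the axis, with velocity \<open>(i, -i)\<close>.\<close>
    let ?z = "\<lambda>x. \<i> * x" and ?w = "\<lambda>x. - \<i> * x"
    let ?d = "Du (?z (of_real t)) (?w (of_real t)) * \<i> + (?z (of_real t) - ?w (of_real t)) ^ m * B (?w (of_real t)) * (- \<i> - \<i>)"
    have "((\<lambda>x. D (?z x) (?w x)) has_field_derivative ?d) (at (of_real t))"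
      by (rule chain) (auto intro!: derivative_eq_intros simp: t)
    then have "?d = 0"
    proof (rule has_field_derivative_eq_0_if_zero_on_reals[OF _ t])
      fix x :: real assume "\<bar>x - t\<bar> < t"
      then have "x > 0" by linarith
      then show "D (?z (of_real x)) (?w (of_real x)) = 0" using R by blast
    qed
    moreover have "Du (?z (of_real t)) (?w (of_real t)) = 0" using R t by blast
    moreover have "?z (of_real t) - ?w (of_real t) \<noteq> 0" using t by simp
    ultimately show ?thesis by simp
  qed
  have Bz: "B w = 0" if w: "Im w < 0" for w
    by (rule holomorphic_zero_on_imaginary_ray[OF B, of "- \<i>"])
       (use B0 w in \<open>auto simp: open_halfspace_Im_lt convex_connected convex_halfspace_Im_lt\<close>)
  have const: "D z w = D z w'" if "Im z > 0" "Im w < 0" "Im w' < 0" for z w w'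
  proof -
    have "\<exists>c. \<forall>w\<in>{w. Im w < 0}. D z w = c"
    proof (rule has_field_derivative_zero_constant)
      show "convex {w. Im w < 0}" by (rule convex_halfspace_Im_lt)
      fix w assume "w \<in> {w. Im w < 0}"
      then have "((\<lambda>x. D z x) has_field_derivative Du z w * 0 + (z - w) ^ m * B w * (1 - 0)) (at w)"
        using \<open>Im z > 0\<close> by (intro chain[of "\<lambda>_. z" 0 w "\<lambda>x. x" 1]) auto
      then show "((\<lambda>x. D z x) has_field_derivative 0) (at w within {w. Im w < 0})"
        using Bz \<open>w \<in> _\<close> by (auto intro: has_field_derivative_at_within)
    qed
    then show ?thesis using that by auto
  qed
  show ?L
  proof (intro allI impI)
    fix z assume z: "Im z > 0"
    have "D z (- \<i>) = 0"
    proof (rule holomorphic_zero_on_imaginary_ray[of "\<lambda>z. D z (- \<i>)" "{z. Im z > 0}" \<i>])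
      show "(\<lambda>z. D z (- \<i>)) holomorphic_on {z. Im z > 0}"
        unfolding holomorphic_on_def
      proof
        fix z assume "z \<in> {z. Im z > 0}"
        then have "((\<lambda>z. D z (- \<i>)) has_field_derivative Du z (- \<i>) * 1 + (z - (- \<i>)) ^ m * B (- \<i>) * (0 - 1)) (at z)"
          by (intro chain[of "\<lambda>z. z" 1 z "\<lambda>_. - \<i>" 0]) auto
        then show "(\<lambda>z. D z (- \<i>)) field_differentiable at z within {z. Im z > 0}"
          unfolding field_differentiable_def by (blast intro: has_field_derivative_at_within)
      qed
      fix t :: real assume t: "t > 0"
      have "D (\<i> * of_real t) (- \<i>) = D (\<i> * of_real t) (- \<i> * of_real t)"
        by (rule const) (use t in auto)
      then show "D (\<i> * of_real t) (- \<i>) = 0" using R t by simp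
    qed (use z in \<open>auto simp: open_halfspace_Im_gt convex_connected convex_halfspace_Im_gt\<close>)
    then show "D z (cnj z) = 0" using const[OF z, of "cnj z" "- \<i>"] z by simp
  qed
qed

section \<open>Harmonic Fourier series in two independent variables\<close>

text \<open>The harmonic Fourier series with the conjugate of \<open>z\<close> replaced by an independent variable \<open>w\<close> of the lower
half-plane. Here \<open>Im z\<close> becomes \<open>(z - w)/2i\<close>, and the polynomial factor of the incomplete gamma function becomes
the sum over \<open>j\<close>. The scaled variable \<open>z = \<surd>N \<tau>\<close> and \<open>l = 2\<pi>/\<surd>N\<close> turn \<open>\<omega>(N)\<close> into \<open>z \<mapsto> -1/z\<close>.\<close>

definition polarized :: "real \<Rightarrow> nat \<Rightarrow> complex \<Rightarrow> complex \<Rightarrow> (nat \<Rightarrow> complex) \<Rightarrow> (nat \<Rightarrow> complex) \<Rightarrow> complex \<Rightarrow> complex \<Rightarrow> complex" where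
  "polarized l m a b c d z w = a + b * ((z - w) / (2 * \<i>)) ^ Suc m + exp_series l c z
    + (\<Sum>j\<le>m. of_real (fact m / fact j) * (- \<i> * of_real l * (z - w)) ^ j
        * exp_series l (\<lambda>n. of_nat n ^ j * d n) (- w))"

text \<open>The derivative in the direction \<open>(1, 1)\<close>: the difference \<open>z - w\<close> is constant there, so only the
exponentials are differentiated.\<close>

definition polarized_u :: "real \<Rightarrow> nat \<Rightarrow> (nat \<Rightarrow> complex) \<Rightarrow> (nat \<Rightarrow> complex) \<Rightarrow> complex \<Rightarrow> complex \<Rightarrow> complex" where
  "polarized_u l m c d z w = \<i> * of_real l * exp_series l (\<lambda>n. of_nat n * c n) z
    - \<i> * of_real l * (\<Sum>j\<le>m. of_real (fact m / fact j) * (- \<i> * of_real l * (z - w)) ^ j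
        * exp_series l (\<lambda>n. of_nat n ^ Suc j * d n) (- w))"

text \<open>The derivative in \<open>w\<close> divided by \<open>(z - w)\<^sup>m\<close>. That the quotient is free of \<open>z\<close> is the form taken by
harmonicity.\<close>

definition polarized_w :: "real \<Rightarrow> nat \<Rightarrow> complex \<Rightarrow> (nat \<Rightarrow> complex) \<Rightarrow> complex \<Rightarrow> complex" where
  "polarized_w l m b d w = - of_nat (Suc m) * b / (2 * \<i>) ^ Suc m
    + (- \<i> * of_real l) ^ Suc m * exp_series l (\<lambda>n. of_nat n ^ Suc m * d n) (- w)"

text \<open>Differentiating \<open>X\<^sup>j/j!\<close> lowers \<open>j\<close>, while differentiating the series that multiplies it raises the power of
\<open>n\<close>; the two contributions cancel except in the top degree.\<close>

lemma sum_telescope_fact: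
  fixes X :: complex and g :: "nat \<Rightarrow> complex"
  shows "(\<Sum>j\<le>M. of_real (K / fact j) * (of_nat j * X ^ (j - 1)) * g j)
    = (\<Sum>j\<le>M. of_real (K / fact j) * X ^ j * g (Suc j)) - of_real (K / fact M) * X ^ M * g (Suc M)"
proof (induction M)
  case (Suc M)
  have "of_real (K / fact (Suc M)) * (of_nat (Suc M) * X ^ (Suc M - 1)) = of_real (K / fact M) * X ^ M"
    by (simp add: field_simps del: of_nat_Suc)
  then show ?case using Suc by (simp del: of_nat_Suc)
qed simp

text \<open>The terms below top degree cancel by \<open>sum_telescope_fact\<close>; the survivor carries the factor
\<open>(z - w)\<^sup>m\<close>.\<close>

lemma polarized_chain:
  assumes c: "poly_growth c" and d: "poly_growth d" and l: "l > 0"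
    and \<zeta>: "(\<zeta> has_field_derivative z') (at x)" and \<omega>: "(\<omega> has_field_derivative w') (at x)"
    and z: "Im (\<zeta> x) > 0" and w: "Im (\<omega> x) < 0"
  shows "((\<lambda>x. polarized l m a b c d (\<zeta> x) (\<omega> x)) has_field_derivative
      polarized_u l m c d (\<zeta> x) (\<omega> x) * z' + (\<zeta> x - \<omega> x) ^ m * polarized_w l m b d (\<omega> x) * (w' - z')) (at x)"
proof -
  define g where "g j = exp_series l (\<lambda>n. of_nat n ^ j * d n) (- \<omega> x)" for j
  define X where "X = - \<i> * of_real l * (\<zeta> x - \<omega> x)"
  have w': "((\<lambda>x. - \<omega> x) has_field_derivative - w') (at x)" by (rule DERIV_minus[OF \<omega>])
  have g': "((\<lambda>x. exp_series l (\<lambda>n. of_nat n ^ j * d n) (- \<omega> x)) has_field_derivative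
      \<i> * of_real l * g (Suc j) * (- w')) (at x)" for j
  proof -
    have "(exp_series l (\<lambda>n. of_nat n ^ j * d n) has_field_derivative
        \<i> * of_real l * exp_series l (\<lambda>n. of_nat n * (of_nat n ^ j * d n)) (- \<omega> x)) (at (- \<omega> x))"
      by (rule exp_series_has_field_derivative[OF poly_growth_mult_power[OF d] l]) (use w in simp)
    from DERIV_chain2[OF this w'] show ?thesis by (simp add: g_def mult.assoc)
  qed
  have c': "((\<lambda>x. exp_series l c (\<zeta> x)) has_field_derivative
      \<i> * of_real l * exp_series l (\<lambda>n. of_nat n * c n) (\<zeta> x) * z') (at x)"
    by (rule DERIV_chain2[OF exp_series_has_field_derivative[OF c l z] \<zeta>])
  have X': "((\<lambda>x. (- \<i> * of_real l * (\<zeta> x - \<omega> x)) ^ j) has_field_derivative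
      of_nat j * X ^ (j - 1) * (- \<i> * of_real l * (z' - w'))) (at x)" for j
  proof -
    have "((\<lambda>x. - \<i> * of_real l * (\<zeta> x - \<omega> x)) has_field_derivative - \<i> * of_real l * (z' - w')) (at x)"
      by (rule DERIV_cmult[OF DERIV_diff[OF \<zeta> \<omega>]])
    from DERIV_power[OF this, of j] show ?thesis by (simp add: X_def mult_ac)
  qed
  have b': "((\<lambda>x. b * ((\<zeta> x - \<omega> x) / (2 * \<i>)) ^ Suc m) has_field_derivative
      b * (of_nat (Suc m) * ((\<zeta> x - \<omega> x) / (2 * \<i>)) ^ m * ((z' - w') / (2 * \<i>)))) (at x)"
  proof -
    have "((\<lambda>x. (\<zeta> x - \<omega> x) / (2 * \<i>)) has_field_derivative (z' - w') / (2 * \<i>)) (at x)"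
      by (rule DERIV_cdivide[OF DERIV_diff[OF \<zeta> \<omega>]])
    from DERIV_cmult[OF DERIV_power[OF this, of "Suc m"], of b] show ?thesis
      by (simp add: mult_ac del: of_nat_Suc power_Suc)
  qed
  let ?T = "\<Sum>j\<le>m. of_real (fact m / fact j) * X ^ j * g (Suc j)"
  have s': "((\<lambda>x. \<Sum>j\<le>m. of_real (fact m / fact j) * (- \<i> * of_real l * (\<zeta> x - \<omega> x)) ^ j
        * exp_series l (\<lambda>n. of_nat n ^ j * d n) (- \<omega> x)) has_field_derivative
      (\<Sum>j\<le>m. of_real (fact m / fact j) *
         (of_nat j * X ^ (j - 1) * (- \<i> * of_real l * (z' - w')) * g j + \<i> * of_real l * g (Suc j) * (- w') * X ^ j))) (at x)"
  proof (rule DERIV_sum)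
    fix j
    show "((\<lambda>x. of_real (fact m / fact j) * (- \<i> * of_real l * (\<zeta> x - \<omega> x)) ^ j
        * exp_series l (\<lambda>n. of_nat n ^ j * d n) (- \<omega> x)) has_field_derivative
      of_real (fact m / fact j) *
         (of_nat j * X ^ (j - 1) * (- \<i> * of_real l * (z' - w')) * g j + \<i> * of_real l * g (Suc j) * (- w') * X ^ j)) (at x)"
      using DERIV_cmult[OF DERIV_mult[OF X' g'], of "of_real (fact m / fact j)" j j]
      unfolding X_def g_def mult.assoc .
  qed
  have "(\<Sum>j\<le>m. of_real (fact m / fact j) *
         (of_nat j * X ^ (j - 1) * (- \<i> * of_real l * (z' - w')) * g j + \<i> * of_real l * g (Suc j) * (- w') * X ^ j))
     = \<i> * of_real l * (w' - z') * (\<Sum>j\<le>m. of_real (fact m / fact j) * (of_nat j * X ^ (j - 1)) * g j)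
       - \<i> * of_real l * w' * ?T"
  proof -
    have "K * (n * Y * (- \<i> * L * (z' - w')) * g1 + \<i> * L * g2 * (- w') * Z)
        = \<i> * L * (w' - z') * (K * (n * Y) * g1) - \<i> * L * w' * (K * Z * g2)" for K n Y L g1 g2 Z :: complex
      by (simp add: algebra_simps)
    then show ?thesis unfolding sum_distrib_left sum_subtractf[symmetric] by (intro sum.cong refl)
  qed
  also have "\<dots> = - \<i> * of_real l * ?T * z' + (w' - z') * (- \<i> * of_real l * X ^ m * g (Suc m))"
    unfolding sum_telescope_fact by (simp add: algebra_simps)
  also have "- \<i> * of_real l * X ^ m * g (Suc m) = (\<zeta> x - \<omega> x) ^ m * ((- \<i> * of_real l) ^ Suc m * g (Suc m))"
    unfolding X_def by (simp only: power_mult_distrib power_Suc mult_ac)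
  finally have S: "(\<Sum>j\<le>m. of_real (fact m / fact j) *
         (of_nat j * X ^ (j - 1) * (- \<i> * of_real l * (z' - w')) * g j + \<i> * of_real l * g (Suc j) * (- w') * X ^ j))
     = - \<i> * of_real l * ?T * z' + (w' - z') * ((\<zeta> x - \<omega> x) ^ m * ((- \<i> * of_real l) ^ Suc m * g (Suc m)))" .
  have bb: "b * (of_nat (Suc m) * ((\<zeta> x - \<omega> x) / (2 * \<i>)) ^ m * ((z' - w') / (2 * \<i>)))
      = (w' - z') * ((\<zeta> x - \<omega> x) ^ m * (- of_nat (Suc m) * b / (2 * \<i>) ^ Suc m))"
    by (simp add: power_divide field_simps del: of_nat_Suc)
  have "((\<lambda>x. polarized l m a b c d (\<zeta> x) (\<omega> x)) has_field_derivative
      0 + (w' - z') * ((\<zeta> x - \<omega> x) ^ m * (- of_nat (Suc m) * b / (2 * \<i>) ^ Suc m))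
      + \<i> * of_real l * exp_series l (\<lambda>n. of_nat n * c n) (\<zeta> x) * z'
      + (- \<i> * of_real l * ?T * z' + (w' - z') * ((\<zeta> x - \<omega> x) ^ m * ((- \<i> * of_real l) ^ Suc m * g (Suc m))))) (at x)"
    unfolding polarized_def
    by (intro DERIV_add DERIV_const b'[unfolded bb] c' s'[unfolded S])
  also have "0 + (w' - z') * ((\<zeta> x - \<omega> x) ^ m * (- of_nat (Suc m) * b / (2 * \<i>) ^ Suc m))
      + \<i> * of_real l * exp_series l (\<lambda>n. of_nat n * c n) (\<zeta> x) * z'
      + (- \<i> * of_real l * ?T * z' + (w' - z') * ((\<zeta> x - \<omega> x) ^ m * ((- \<i> * of_real l) ^ Suc m * g (Suc m))))
    = polarized_u l m c d (\<zeta> x) (\<omega> x) * z' + (\<zeta> x - \<omega> x) ^ m * polarized_w l m b d (\<omega> x) * (w' - z')"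
  proof -
    have "0 + W * (P * A) + U * Z + (- \<i> * L * T * Z + W * (P * B)) = (U - \<i> * L * T) * Z + P * (A + B) * W"
      for W P A U Z T B L :: complex by (simp add: algebra_simps)
    then show ?thesis
      unfolding polarized_u_def polarized_w_def g_def[symmetric] X_def[symmetric] by this
  qed
  finally show ?thesis .
qed

section \<open>Invariance tested on the imaginary axis\<close>

definition axis_part :: "real \<Rightarrow> nat \<Rightarrow> (nat \<Rightarrow> complex) \<Rightarrow> (nat \<Rightarrow> complex) \<Rightarrow> real \<Rightarrow> complex" where
  "axis_part l m c d t = exp_sum l c 0 t + (\<Sum>j\<le>m. of_real (fact m * 2 ^ j / fact j) * exp_sum l d j t)"

text \<open>The restriction to the axis of \<open>(t/i) \<partial>/\<partial>u\<close>, as \<open>polarized_u_axis\<close> shows; it has no monomials because these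
depend on \<open>z - w\<close> only.\<close>

definition axis_part_u :: "real \<Rightarrow> nat \<Rightarrow> (nat \<Rightarrow> complex) \<Rightarrow> (nat \<Rightarrow> complex) \<Rightarrow> real \<Rightarrow> complex" where
  "axis_part_u l m c d t = exp_sum l c 1 t + - 1 * (\<Sum>j\<le>m. of_real (fact m * 2 ^ j / fact j) * exp_sum l d (Suc j) t)"

lemma polarized_axis:
  assumes c: "poly_growth c" and d: "poly_growth d" and l: "l > 0" and t: "t > 0"
  shows "polarized l m a b c d (\<i> * of_real t) (- \<i> * of_real t) = axis_fun (- int m) a b (axis_part l m c d) t"
proof -
  have X: "- \<i> * of_real l * (\<i> * of_real t - - \<i> * of_real t) = 2 * of_real (l * t)"
    by (simp add: algebra_simps)
  have j: "of_real (fact m / fact j) * (2 * of_real (l * t)) ^ j * exp_series l (\<lambda>n. of_nat n ^ j * d n) (- (- \<i> * of_real t))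
      = of_real (fact m * 2 ^ j / fact j) * exp_sum l d j t" for j
    unfolding exp_sum_eq_exp_series[OF d l t] by (simp add: power_mult_distrib)
  have t1: "t powi (1 - - int m) = t ^ Suc m"
    using power_int_of_nat[of t "Suc m"] by simp
  have "((\<i> * of_real t - - \<i> * of_real t) / (2 * \<i>)) = of_real t" by simp
  then show ?thesis
    unfolding polarized_def X j axis_fun_def axis_part_def t1 using exp_sum_eq_exp_series[OF c l t, of 0] by simp
qed

lemma polarized_u_axis:
  assumes c: "poly_growth c" and d: "poly_growth d" and l: "l > 0" and t: "t > 0"
  shows "of_real t * polarized_u l m c d (\<i> * of_real t) (- \<i> * of_real t) = \<i> * axis_part_u l m c d t"
proof -
  have X: "- \<i> * of_real l * (\<i> * of_real t - - \<i> * of_real t) = 2 * of_real (l * t)"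
    by (simp add: algebra_simps)
  have j: "of_real (l * t) * (of_real (fact m / fact j) * (2 * of_real (l * t)) ^ j * exp_series l (\<lambda>n. of_nat n ^ Suc j * d n) (- (- \<i> * of_real t)))
      = of_real (fact m * 2 ^ j / fact j) * exp_sum l d (Suc j) t" for j
    unfolding exp_sum_eq_exp_series[OF d l t] by (simp add: power_mult_distrib)
  have "of_real t * polarized_u l m c d (\<i> * of_real t) (- \<i> * of_real t) =
      \<i> * (of_real (l * t) * exp_series l (\<lambda>n. of_nat n * c n) (\<i> * of_real t)
       - of_real (l * t) * (\<Sum>j\<le>m. of_real (fact m / fact j) * (2 * of_real (l * t)) ^ j * exp_series l (\<lambda>n. of_nat n ^ Suc j * d n) (- (- \<i> * of_real t))))"
    unfolding polarized_u_def X by (simp only: of_real_mult algebra_simps)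
  also have "\<dots> = \<i> * axis_part_u l m c d t"
    unfolding sum_distrib_left j axis_part_u_def using exp_sum_eq_exp_series[OF c l t, of 1] by (simp add: sum_negf)
  finally show ?thesis .
qed

lemma Im_minus_inverse:
  "Im (- 1 / z) > 0 \<longleftrightarrow> Im z > 0" "Im (- 1 / z) < 0 \<longleftrightarrow> Im z < 0"
proof -
  have e: "Im (- 1 / z) = Im z / (norm z)\<^sup>2"
    by (simp add: Im_divide cmod_power2)
  show "Im (- 1 / z) > 0 \<longleftrightarrow> Im z > 0" "Im (- 1 / z) < 0 \<longleftrightarrow> Im z < 0"
    unfolding e by (cases "z = 0"; simp add: zero_less_divide_iff divide_less_0_iff)+
qed

lemma polarized_w_holomorphic:
  assumes d: "poly_growth d" and l: "l > 0"
  shows "polarized_w l m b d holomorphic_on {w. Im w < 0}"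
proof -
  have e: "exp_series l (\<lambda>n. of_nat n ^ Suc m * d n) holomorphic_on {z. Im z > 0}"
    unfolding holomorphic_on_def field_differentiable_def
    using exp_series_has_field_derivative[OF poly_growth_mult_power[OF d] l] has_field_derivative_at_within by blast
  have "(\<lambda>w. exp_series l (\<lambda>n. of_nat n ^ Suc m * d n) (- w)) holomorphic_on {w. Im w < 0}"
    by (rule holomorphic_on_compose_gen[OF _ e, unfolded o_def]) (auto intro!: holomorphic_intros)
  then show ?thesis
    unfolding polarized_w_def[abs_def] by (intro holomorphic_intros)
qed

text \<open>The derivative of the slashed function has the same shape as in \<open>polarized_chain\<close> because
\<open>-1/z + 1/w = (z - w)/(zw)\<close>. Besides the expected terms, the \<open>u\<close>-derivative contains a correction with the
factor \<open>1/w\<^sup>2 - 1/z\<^sup>2\<close>, which is zero on the axis.\<close>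

lemma slash_chain:
  assumes c: "poly_growth c" and d: "poly_growth d" and l: "l > 0"
    and \<zeta>: "(\<zeta> has_field_derivative z') (at x)" and \<omega>: "(\<omega> has_field_derivative w') (at x)"
    and z: "Im (\<zeta> x) > 0" and w: "Im (\<omega> x) < 0"
  shows "((\<lambda>x. \<zeta> x ^ m * polarized l m a b c d (- 1 / \<zeta> x) (- 1 / \<omega> x)) has_field_derivative
      (of_nat m * \<zeta> x ^ (m - 1) * polarized l m a b c d (- 1 / \<zeta> x) (- 1 / \<omega> x)
        + \<zeta> x ^ m * polarized_u l m c d (- 1 / \<zeta> x) (- 1 / \<omega> x) / \<zeta> x ^ 2
        + (\<zeta> x - \<omega> x) ^ m / \<omega> x ^ m * polarized_w l m b d (- 1 / \<omega> x) * (1 / \<omega> x ^ 2 - 1 / \<zeta> x ^ 2)) * z'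
      + (\<zeta> x - \<omega> x) ^ m * (polarized_w l m b d (- 1 / \<omega> x) / \<omega> x ^ (m + 2)) * (w' - z')) (at x)"
proof -
  have z0: "\<zeta> x \<noteq> 0" and w0: "\<omega> x \<noteq> 0" using z w by auto
  have 1: "((\<lambda>x. - 1 / \<zeta> x) has_field_derivative z' / \<zeta> x ^ 2) (at x)"
    using z0 by (auto intro!: derivative_eq_intros \<zeta> simp: power2_eq_square)
  have 2: "((\<lambda>x. - 1 / \<omega> x) has_field_derivative w' / \<omega> x ^ 2) (at x)"
    using w0 by (auto intro!: derivative_eq_intros \<omega> simp: power2_eq_square)
  note h = polarized_chain[OF c d l 1 2, of m a b, unfolded Im_minus_inverse, OF z w]
  have p: "((\<lambda>x. \<zeta> x ^ m) has_field_derivative of_nat m * \<zeta> x ^ (m - 1) * z') (at x)"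
    using DERIV_power[OF \<zeta>, of m] by (simp add: mult_ac)
  have zw: "\<zeta> x ^ m * (- 1 / \<zeta> x - - 1 / \<omega> x) ^ m = (\<zeta> x - \<omega> x) ^ m / \<omega> x ^ m"
  proof -
    have "\<zeta> x * (- 1 / \<zeta> x - - 1 / \<omega> x) = (\<zeta> x - \<omega> x) / \<omega> x"
      using z0 w0 by (simp add: field_simps)
    then show ?thesis by (metis power_divide power_mult_distrib)
  qed
  have d: "w' / \<omega> x ^ 2 - z' / \<zeta> x ^ 2 = (w' - z') / \<omega> x ^ 2 + z' * (1 / \<omega> x ^ 2 - 1 / \<zeta> x ^ 2)"
    by (simp add: diff_divide_distrib algebra_simps)
  have "of_nat m * \<zeta> x ^ (m - 1) * z' * H + (U * (z' / \<zeta> x ^ 2) + (- 1 / \<zeta> x - - 1 / \<omega> x) ^ m * B * (w' / \<omega> x ^ 2 - z' / \<zeta> x ^ 2)) * \<zeta> x ^ m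
    = (of_nat m * \<zeta> x ^ (m - 1) * H + \<zeta> x ^ m * U / \<zeta> x ^ 2 + (\<zeta> x - \<omega> x) ^ m / \<omega> x ^ m * B * (1 / \<omega> x ^ 2 - 1 / \<zeta> x ^ 2)) * z'
      + (\<zeta> x - \<omega> x) ^ m * (B / \<omega> x ^ (m + 2)) * (w' - z')" for H U B
  proof -
    have "(- 1 / \<zeta> x - - 1 / \<omega> x) ^ m * B * (w' / \<omega> x ^ 2 - z' / \<zeta> x ^ 2) * \<zeta> x ^ m
      = (\<zeta> x ^ m * (- 1 / \<zeta> x - - 1 / \<omega> x) ^ m) * B * (w' / \<omega> x ^ 2 - z' / \<zeta> x ^ 2)" by (simp add: mult_ac)
    also have "\<dots> = (\<zeta> x - \<omega> x) ^ m / \<omega> x ^ m * B * (1 / \<omega> x ^ 2 - 1 / \<zeta> x ^ 2) * z'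
      + (\<zeta> x - \<omega> x) ^ m * (B / \<omega> x ^ (m + 2)) * (w' - z')"
      unfolding zw d by (simp add: distrib_left power_add power2_eq_square mult_ac)
    finally show ?thesis unfolding distrib_right by (simp add: mult_ac)
  qed
  with DERIV_mult[OF p h] show ?thesis by simp
qed

text \<open>Let \<open>F\<close>, \<open>G\<close> be the restrictions to the axis of the functions with coefficients \<open>c\<close>, \<open>d\<close> and \<open>c'\<close>, \<open>d'\<close>, and
\<open>F\<^sub>1\<close>, \<open>G\<^sub>1\<close> those of their images under \<open>(t/i) \<partial>/\<partial>u\<close>. By \<open>vanishing_criterion\<close> it suffices to compare both sides and
their \<open>u\<close>-derivatives on the axis. The first comparison is the law for \<open>F\<close>, and given this, the second is the
law for \<open>-2F\<^sub>1 + kF\<close>. The combination is chosen such that the term with \<open>F\<close> arising from differentiating the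
factor \<open>z\<^sup>m\<close> is distributed evenly: \<open>G\<^sub>1 = (it)\<^sup>m (kF - F\<^sub>1)\<close>, with \<open>F\<close>, \<open>F\<^sub>1\<close> at \<open>1/t\<close>, becomes a pure sign.\<close>

lemma invariance_criterion:
  fixes l :: real and m :: nat and a b a' b' :: complex and c d c' d' :: "nat \<Rightarrow> complex"
  defines "k \<equiv> - int m"
  defines "P \<equiv> axis_part l m c d" and "Q \<equiv> axis_part l m c' d'"
  defines "Pu \<equiv> (\<lambda>t. - 2 * axis_part_u l m c d t + of_int k * axis_part l m c d t)"
    and "Qu \<equiv> (\<lambda>t. - 2 * axis_part_u l m c' d' t + of_int k * axis_part l m c' d' t)"
  assumes c: "poly_growth c" and d: "poly_growth d" and c': "poly_growth c'" and d': "poly_growth d'" and l: "l > 0"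
  shows "(\<forall>z. Im z > 0 \<longrightarrow> polarized l m a' b' c' d' z (cnj z) = z ^ m * polarized l m a b c d (- 1 / z) (- 1 / cnj z)) \<longleftrightarrow>
    (\<forall>t>0. axis_fun k a b P (1 / t) = \<i> powi k * of_real (t powi k) * axis_fun k a' b' Q t) \<and>
    (\<forall>t>0. axis_fun k (of_int k * a) (of_int k * b) Pu (1 / t) =
      - (\<i> powi k) * of_real (t powi k) * axis_fun k (of_int k * a') (of_int k * b') Qu t)"
proof -
  define D where "D z w = polarized l m a' b' c' d' z w - z ^ m * polarized l m a b c d (- 1 / z) (- 1 / w)" for z w
  define Du where "Du z w = polarized_u l m c' d' z w - (of_nat m * z ^ (m - 1) * polarized l m a b c d (- 1 / z) (- 1 / w)
        + z ^ m * polarized_u l m c d (- 1 / z) (- 1 / w) / z ^ 2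
        + (z - w) ^ m / w ^ m * polarized_w l m b d (- 1 / w) * (1 / w ^ 2 - 1 / z ^ 2))" for z w
  define B where "B w = polarized_w l m b' d' w - polarized_w l m b d (- 1 / w) / w ^ (m + 2)" for w
  have crit: "(\<forall>z. Im z > 0 \<longrightarrow> D z (cnj z) = 0) \<longleftrightarrow>
    (\<forall>t>0. D (\<i> * of_real t) (- \<i> * of_real t) = 0) \<and> (\<forall>t>0. Du (\<i> * of_real t) (- \<i> * of_real t) = 0)"
  proof (rule vanishing_criterion)
    fix \<zeta> \<omega> x z' w'
    assume A: "(\<zeta> has_field_derivative z') (at x)" "(\<omega> has_field_derivative w') (at x)"
      "Im (\<zeta> x) > 0" "Im (\<omega> x) < 0"
    have e: "U * z' + p * b1 * (w' - z') - (V * z' + p * b2 * (w' - z')) = (U - V) * z' + p * (b1 - b2) * (w' - z')"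
      for U V p b1 b2 :: complex by (simp add: algebra_simps)
    show "((\<lambda>x. D (\<zeta> x) (\<omega> x)) has_field_derivative
        Du (\<zeta> x) (\<omega> x) * z' + (\<zeta> x - \<omega> x) ^ m * B (\<omega> x) * (w' - z')) (at x)"
      using DERIV_diff[OF polarized_chain[OF c' d' l A, where m = m and a = a' and b = b']
          slash_chain[OF c d l A, where m = m and a = a and b = b], unfolded e]
      unfolding D_def Du_def B_def .
  next
    have "(\<lambda>w. polarized_w l m b d (- 1 / w)) holomorphic_on {w. Im w < 0}"
    proof (rule holomorphic_on_compose_gen[OF _ polarized_w_holomorphic[OF d l], unfolded o_def])
      show "(\<lambda>w. - 1 / w) holomorphic_on {w. Im w < 0}" by (intro holomorphic_intros) auto
      show "(\<lambda>w. - 1 / w) ` {w. Im w < 0} \<subseteq> {w. Im w < 0}" using Im_minus_inverse(2) by blast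
    qed
    then show "B holomorphic_on {w. Im w < 0}"
      unfolding B_def[abs_def]
      by (intro holomorphic_intros polarized_w_holomorphic d' l) auto
  qed
  have inv: "- 1 / (\<i> * of_real t) = \<i> * of_real (1 / t)" "- 1 / (- \<i> * of_real t) = - \<i> * of_real (1 / t)" for t :: real
    by (simp_all add: divide_inverse)
  have Im: "(\<i> * of_real t) ^ m * (\<i> powi k * of_real (t powi k)) = 1" if "t > 0" for t
    using that unfolding k_def
    by (simp add: power_int_minus power_mult_distrib field_simps)
  have axis: "D (\<i> * of_real t) (- \<i> * of_real t) = 0 \<longleftrightarrow>
      axis_fun k a b P (1 / t) = \<i> powi k * of_real (t powi k) * axis_fun k a' b' Q t" (is ?th1)
    and axis_u: "D (\<i> * of_real t) (- \<i> * of_real t) = 0 \<Longrightarrow> Du (\<i> * of_real t) (- \<i> * of_real t) = 0 \<longleftrightarrow>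
      axis_fun k (of_int k * a) (of_int k * b) Pu (1 / t) =
      - (\<i> powi k) * of_real (t powi k) * axis_fun k (of_int k * a') (of_int k * b') Qu t" (is "_ \<Longrightarrow> ?th2")
    if t: "t > 0" for t
  proof -
    define y where "y = \<i> * of_real t"
    define u where "u = \<i> powi k * of_real (t powi k)"
    have y0: "y \<noteq> 0" using t by (simp add: y_def)
    \<comment> \<open>\<open>u = (it)\<^sup>k\<close> is the automorphy factor, inverse to \<open>y\<^sup>m\<close>.\<close>
    have yu: "y ^ m * u = 1" using Im[OF t] by (simp add: y_def u_def)
    let ?F = "axis_fun k a b P (1 / t)" and ?G = "axis_fun k a' b' Q t"
    let ?F1 = "axis_part_u l m c d (1 / t)" and ?G1 = "axis_part_u l m c' d' t"
    have t': "1 / t > 0" using t by simp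
    have D: "D (\<i> * of_real t) (- \<i> * of_real t) = ?G - y ^ m * ?F"
      unfolding D_def inv polarized_axis[OF c' d' l t] polarized_axis[OF c d l t'] y_def k_def P_def Q_def ..
    show ?th1
    proof -
      have "G - p * F = 0 \<longleftrightarrow> F = u * G" if "p * u = 1" for p u F G :: complex
        using that by (metis eq_iff_diff_eq_0 mult.assoc mult.commute mult_1)
      from this[OF yu] show ?thesis unfolding D u_def .
    qed
    have sq: "(- \<i> * of_real t) ^ 2 = (\<i> * of_real t) ^ 2" by (simp add: power_mult_distrib)
    have hf: "polarized_u l m c d (\<i> * of_real (1 / t)) (- \<i> * of_real (1 / t)) = y * ?F1"
      using polarized_u_axis[OF c d l t', of m] t by (simp add: y_def field_simps)
    have "of_real t * Du (\<i> * of_real t) (- \<i> * of_real t) = of_real t * polarized_u l m c' d' (\<i> * of_real t) (- \<i> * of_real t)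
       - of_real t * (of_nat m * y ^ (m - 1) * ?F + y ^ m * (y * ?F1) / y ^ 2)"
      unfolding Du_def inv polarized_axis[OF c d l t'] sq hf
      by (simp add: y_def k_def P_def right_diff_distrib)
    also have "\<dots> = \<i> * (?G1 + (of_nat m * y ^ m * ?F + y ^ m * ?F1))"
    proof -
      have ty: "of_real t = - \<i> * y" by (simp add: y_def)
      have "y * (of_nat m * y ^ (m - 1)) = of_nat m * y ^ m" by (cases m) auto
      moreover have "y * (y ^ m * (y * ?F1) / y ^ 2) = y ^ m * ?F1"
        using y0 by (simp add: power2_eq_square)
      moreover have "\<i> * G1 - (- \<i> * y) * (q * F + Z) = \<i> * (G1 + (y * q * F + y * Z))" for G1 q F Z
        by (simp add: algebra_simps)
      ultimately show ?thesis
        unfolding polarized_u_axis[OF c' d' l t] unfolding ty by (simp only:)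
    qed
    finally have tDu: "of_real t * Du (\<i> * of_real t) (- \<i> * of_real t) = \<i> * (?G1 + (of_nat m * y ^ m * ?F + y ^ m * ?F1))" .
    have Du: "Du (\<i> * of_real t) (- \<i> * of_real t) = 0 \<longleftrightarrow> ?G1 = - (y ^ m) * (of_nat m * ?F + ?F1)"
    proof -
      have "X = 0 \<longleftrightarrow> G1 = - p * (n * F + F1)"
        if "T * X = \<i> * (G1 + (n * p * F + p * F1))" "T \<noteq> 0" for T X G1 n p F F1 :: complex
      proof -
        have "X = 0 \<longleftrightarrow> G1 + (n * p * F + p * F1) = 0"
          using that by (metis mult_eq_0_iff complex_i_not_zero)
        then show ?thesis by (simp add: algebra_simps eq_neg_iff_add_eq_0)
      qed
      from this[OF tDu] show ?thesis using t by simp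
    qed
    have Ff: "axis_fun k (of_int k * a) (of_int k * b) Pu x = - 2 * axis_part_u l m c d x + of_int k * axis_fun k a b P x"
      and Gf: "axis_fun k (of_int k * a') (of_int k * b') Qu x = - 2 * axis_part_u l m c' d' x + of_int k * axis_fun k a' b' Q x" for x
      by (simp_all add: axis_fun_def Pu_def Qu_def P_def Q_def algebra_simps)
    show ?th2 if "D (\<i> * of_real t) (- \<i> * of_real t) = 0"
    proof -
      have G: "?G = y ^ m * ?F" using that D by simp
      have k: "(of_int k :: complex) = - of_nat m" by (simp add: k_def)
      have "axis_fun k (of_int k * a) (of_int k * b) Pu (1 / t) =
          - (\<i> powi k) * of_real (t powi k) * axis_fun k (of_int k * a') (of_int k * b') Qu t
          \<longleftrightarrow> - 2 * ?F1 - of_nat m * ?F = - u * (- 2 * ?G1 - of_nat m * ?G)"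
        unfolding Ff Gf by (simp add: k u_def)
      also have "\<dots> \<longleftrightarrow> y ^ m * (- 2 * ?F1 - of_nat m * ?F) = y ^ m * (- u * (- 2 * ?G1 - of_nat m * ?G))"
        by (rule mult_left_cancel[symmetric]) (use y0 in simp)
      also have "y ^ m * (- u * (- 2 * ?G1 - of_nat m * ?G)) = - (y ^ m * u) * (- 2 * ?G1 - of_nat m * ?G)"
        by (simp only: mult_minus_left mult_minus_right mult_ac)
      also have "y ^ m * (- 2 * ?F1 - of_nat m * ?F) = - (y ^ m * u) * (- 2 * ?G1 - of_nat m * ?G) \<longleftrightarrow>
          2 * ?G1 = 2 * (- (y ^ m) * (of_nat m * ?F + ?F1))"
        unfolding yu G by (auto simp: algebra_simps)
      also have "\<dots> \<longleftrightarrow> Du (\<i> * of_real t) (- \<i> * of_real t) = 0" unfolding Du by simp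
      finally show ?thesis by (rule sym)
    qed
  qed
  have "(\<forall>z. Im z > 0 \<longrightarrow> polarized l m a' b' c' d' z (cnj z) = z ^ m * polarized l m a b c d (- 1 / z) (- 1 / cnj z)) \<longleftrightarrow>
      (\<forall>z. Im z > 0 \<longrightarrow> D z (cnj z) = 0)"
    by (simp add: D_def)
  then show ?thesis unfolding crit using axis axis_u by blast
qed

section \<open>Fourier series and completed Dirichlet series\<close>

text \<open>The coefficients are reindexed by natural numbers and set to 0 at \<open>n = 0\<close>, where the constant term and the term
\<open>v\<^sup>1\<^sup>-\<^sup>k\<close> are kept apart.\<close>

definition pos_coeffs :: "(int \<Rightarrow> complex) \<Rightarrow> nat \<Rightarrow> complex" where
  "pos_coeffs cp n = (if n = 0 then 0 else cp (int n))"

definition neg_coeffs :: "(int \<Rightarrow> complex) \<Rightarrow> nat \<Rightarrow> complex" where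
  "neg_coeffs cm = pos_coeffs (\<lambda>n. cm (- n))"

lemma poly_growth_pos_coeffs:
  assumes "(\<lambda>n. norm (cp n)) \<in> O[at_top](\<lambda>n. \<bar>real_of_int n\<bar> powr \<alpha>)"
  shows "poly_growth (pos_coeffs cp)"
proof -
  obtain c where c: "c > 0" "\<forall>\<^sub>F n in at_top. norm (norm (cp n)) \<le> c * norm (\<bar>real_of_int n\<bar> powr \<alpha>)"
    using landau_o.bigE[OF assms] by blast
  then obtain M where M: "\<And>n. n \<ge> M \<Longrightarrow> norm (cp n) \<le> c * \<bar>real_of_int n\<bar> powr \<alpha>"
    unfolding eventually_at_top_linorder by auto
  define p where "p = nat \<lceil>\<alpha>\<rceil>"
  define S where "S = (\<Sum>i<nat M. norm (pos_coeffs cp i))"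
  have S0: "S \<ge> 0" by (simp add: S_def sum_nonneg)
  have "norm (pos_coeffs cp n) \<le> (c + S) * real n ^ p" for n
  proof (cases "n = 0")
    case True
    then show ?thesis using c S0 by (simp add: pos_coeffs_def)
  next
    case False
    then have n1: "real n \<ge> 1" by simp
    then have np: "real n ^ p \<ge> 1" by (rule one_le_power)
    show ?thesis
    proof (cases "int n \<ge> M")
      case True
      have "norm (pos_coeffs cp n) \<le> c * real n powr \<alpha>"
        using M[OF True] False by (simp add: pos_coeffs_def)
      also have "real n powr \<alpha> \<le> real n powr real p"
        using n1 by (intro powr_mono) (auto simp: p_def real_nat_ceiling_ge)
      also have "real n powr real p = real n ^ p" using n1 by (simp add: powr_realpow)
      finally have "norm (pos_coeffs cp n) \<le> c * real n ^ p" using c by simp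
      also have "\<dots> \<le> (c + S) * real n ^ p" using S0 by (intro mult_right_mono) auto
      finally show ?thesis .
    next
      case nM: False
      have "norm (pos_coeffs cp n) \<le> S"
        unfolding S_def by (rule member_le_sum) (use nM in auto)
      also have "\<dots> \<le> (c + S) * 1" using c by simp
      also have "\<dots> \<le> (c + S) * real n ^ p" using np c S0 by (intro mult_left_mono) auto
      finally show ?thesis .
    qed
  qed
  then have "\<exists>C p. \<forall>n. norm (pos_coeffs cp n) \<le> C * real n ^ p" by blast
  moreover have "pos_coeffs cp 0 = 0" by (simp add: pos_coeffs_def)
  ultimately show ?thesis by (simp only: poly_growth_def simp_thms)
qed

lemma poly_growth_neg_coeffs:
  assumes "(\<lambda>n. norm (cm n)) \<in> O[at_bot](\<lambda>n. \<bar>real_of_int n\<bar> powr \<alpha>)"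
  shows "poly_growth (neg_coeffs cm)"
proof -
  have "filterlim (\<lambda>n::int. - n) at_bot at_top"
    unfolding filterlim_at_bot eventually_at_top_linorder by (metis neg_le_iff_le minus_minus)
  from landau_o.big.compose[OF assms this]
  have "(\<lambda>n. norm (cm (- n))) \<in> O[at_top](\<lambda>n. \<bar>real_of_int n\<bar> powr \<alpha>)" by simp
  then show ?thesis unfolding neg_coeffs_def by (rule poly_growth_pos_coeffs)
qed

lemma has_sum_image_positive_nat:
  fixes g :: "'a \<Rightarrow> complex"
  assumes s: "summable (\<lambda>n. norm (G n))" and G0: "G 0 = 0" and h: "inj h"
    and gG: "\<And>n. n > 0 \<Longrightarrow> g (h n) = G n"
  shows "(g has_sum (\<Sum>n. G n)) (h ` {1..})"
proof -
  have "(G has_sum (\<Sum>n. G n)) UNIV"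
    by (rule norm_summable_imp_has_sum[OF s summable_sums[OF summable_norm_cancel[OF s]]])
  then have "(G has_sum (\<Sum>n. G n)) {1..}"
    by (rule has_sum_cong_neutral[THEN iffD1, rotated -1]) (auto simp: G0 not_le)
  then have "((g \<circ> h) has_sum (\<Sum>n. G n)) {1..}"
    by (rule has_sum_cong[THEN iffD1, rotated]) (simp add: gG)
  then show ?thesis
    by (subst has_sum_reindex) (use h in \<open>auto intro: inj_on_subset\<close>)
qed

lemma int_image_positive: "int ` {1..} = {1..}" "(\<lambda>n. - int n) ` {1..} = {..<0}"
proof -
  show e: "int ` {1..} = {1..}"
  proof (intro equalityI subsetI)
    fix n :: int assume "n \<in> {1..}"
    then show "n \<in> int ` {1..}" by (intro image_eqI[of _ _ "nat n"]) auto
  qed auto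
  show "(\<lambda>n. - int n) ` {1..} = {..<0}"
  proof (intro equalityI subsetI)
    fix n :: int assume "n \<in> {..<0}"
    then show "n \<in> (\<lambda>n. - int n) ` {1..}" by (intro image_eqI[of _ _ "nat (- n)"]) auto
  qed auto
qed

text \<open>The factor \<open>e\<^sup>-\<^sup>4\<^sup>\<pi>\<^sup>n\<^sup>v\<close> of the incomplete gamma function turns \<open>q\<^sup>-\<^sup>n\<close> into an exponential in the conjugate
of \<open>\<tau>\<close>, which makes the polarization possible.\<close>

lemma inc_Gamma_exp:
  assumes n: "n > 0" and v: "Im \<tau> > 0"
  shows "inc_Gamma (of_nat (Suc m)) (4 * pi * of_nat n * Im \<tau>) * exp (2 * of_real pi * \<i> * \<tau>) powi (- int n)
    = (\<Sum>j\<le>m. of_real (fact m / fact j) * of_real (4 * pi * Im \<tau>) ^ j * of_nat n ^ j)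
        * exp (- (2 * of_real pi * \<i> * of_nat n * cnj \<tau>))"
proof -
  define X where "X = 4 * pi * of_nat n * Im \<tau>"
  have X: "X > 0" using n v by (simp add: X_def)
  have "exp (2 * of_real pi * \<i> * \<tau>) powi (- int n) = exp (- (of_nat n * (2 * of_real pi * \<i> * \<tau>)))"
    by (simp add: power_int_minus exp_of_nat_mult exp_minus)
  moreover have "of_real (exp (- X)) * exp (- (of_nat n * (2 * of_real pi * \<i> * \<tau>)))
      = exp (- (2 * of_real pi * \<i> * of_nat n * cnj \<tau>))"
  proof -
    have "complex_of_real (- X) + - (of_nat n * (2 * of_real pi * \<i> * \<tau>)) = - (2 * of_real pi * \<i> * of_nat n * cnj \<tau>)"
      by (simp add: complex_eq_iff X_def)
    then show ?thesis by (simp only: exp_of_real[symmetric] exp_add[symmetric])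
  qed
  moreover have "of_real (fact m * exp (- X) * (\<Sum>j\<le>m. X ^ j / fact j))
      = (\<Sum>j\<le>m. of_real (fact m / fact j) * of_real (4 * pi * Im \<tau>) ^ j * of_nat n ^ j) * complex_of_real (exp (- X))"
  proof -
    have eq: "fact m * exp (- X) * (\<Sum>j\<le>m. X ^ j / fact j) = (\<Sum>j\<le>m. fact m / fact j * (4 * pi * Im \<tau>) ^ j * real n ^ j) * exp (- X)"
      by (simp add: X_def sum_distrib_left sum_distrib_right power_mult_distrib mult_ac)
    show ?thesis unfolding eq
      by (simp only: of_real_mult of_real_sum of_real_power of_real_of_nat_eq)
  qed
  ultimately show ?thesis
    unfolding X_def[symmetric] inc_Gamma_nat[OF X] by (simp only: mult.assoc)
qed

lemma fourier_series_eq_polarized: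
  assumes c: "poly_growth (pos_coeffs cp)" and d: "poly_growth (neg_coeffs cm)" and N: "N > 0" and \<tau>: "Im \<tau> > 0"
  shows "fourier_series (- int m) cp cm \<tau> =
    polarized (2 * pi / sqrt (real N)) m (cp 0) (cm 0 / of_real (real N powr (of_int (1 - (- int m)) / 2)))
      (pos_coeffs cp) (neg_coeffs cm) (of_real (sqrt (real N)) * \<tau>) (of_real (sqrt (real N)) * cnj \<tau>)"
proof -
  define l where "l = 2 * pi / sqrt (real N)"
  define z where "z = of_real (sqrt (real N)) * \<tau>"
  define w where "w = of_real (sqrt (real N)) * cnj \<tau>"
  have l: "l > 0" using N by (simp add: l_def)
  have z: "Im z > 0" and w: "Im (- w) > 0" using N \<tau> by (simp_all add: z_def w_def)
  have lr: "l * sqrt (real N) = 2 * pi" using N by (simp add: l_def)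
  have lN: "complex_of_real l * of_real (sqrt (real N)) = 2 * of_real pi"
    unfolding of_real_mult[symmetric] lr by simp
  define q where "q = exp (2 * of_real pi * \<i> * \<tau>)"
  have qn: "exp (\<i> * of_real l * of_nat n * z) = q ^ n" for n
  proof -
    have "\<i> * of_real l * of_nat n * z = of_nat n * (2 * of_real pi * \<i> * \<tau>)"
      unfolding z_def lN[symmetric] by (simp add: mult_ac)
    then show ?thesis by (simp only: q_def exp_of_nat_mult)
  qed
  have en: "exp (\<i> * of_real l * of_nat n * (- w)) = exp (- (2 * of_real pi * \<i> * of_nat n * cnj \<tau>))" for n
    unfolding w_def lN[symmetric] by (simp add: mult_ac)
  have 1: "(\<Sum>\<^sub>\<infinity>n\<in>{0..}. cp n * q powi n) = cp 0 + exp_series l (pos_coeffs cp) z"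
  proof -
    have "((\<lambda>n. cp n * q powi n) has_sum (\<Sum>n. pos_coeffs cp n * q ^ n)) (int ` {1..})"
      by (rule has_sum_image_positive_nat)
         (use exp_series_summable(1)[OF c l z] in \<open>auto simp: qn pos_coeffs_def\<close>)
    then have h: "((\<lambda>n. cp n * q powi n) has_sum exp_series l (pos_coeffs cp) z) {1..}"
      unfolding int_image_positive exp_series_def qn .
    have "((\<lambda>n. cp n * q powi n) has_sum (cp 0 * q powi 0 + exp_series l (pos_coeffs cp) z)) (insert 0 {1..})"
      by (rule has_sum_insert[OF _ h]) simp
    moreover have "insert 0 {1..} = {0::int..}" by auto
    ultimately show ?thesis using infsumI by force
  qed
  define X where "X = - \<i> * of_real l * (z - w)"
  have Xv: "X = of_real (4 * pi * Im \<tau>)"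
  proof -
    have "X = - \<i> * (of_real l * of_real (sqrt (real N))) * (\<tau> - cnj \<tau>)"
      by (simp add: X_def z_def w_def algebra_simps)
    also have "\<dots> = of_real (4 * pi * Im \<tau>)"
      unfolding lN complex_diff_cnj by (simp add: algebra_simps)
    finally show ?thesis .
  qed
  define G where "G n = (\<Sum>j\<le>m. of_real (fact m / fact j) * X ^ j
      * ((of_nat n ^ j * neg_coeffs cm n) * exp (\<i> * of_real l * of_nat n * (- w))))" for n
  note sm = exp_series_summable[OF poly_growth_mult_power[OF d] l w]
  have Gs: "summable (\<lambda>n. norm (G n))"
  proof (rule summable_comparison_test')
    show "summable (\<lambda>n. \<Sum>j\<le>m. norm (of_real (fact m / fact j) * X ^ j) *
        norm ((of_nat n ^ j * neg_coeffs cm n) * exp (\<i> * of_real l * of_nat n * (- w))))"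
      by (intro summable_sum summable_mult sm)
    show "norm (norm (G n)) \<le> (\<Sum>j\<le>m. norm (of_real (fact m / fact j) * X ^ j) *
        norm ((of_nat n ^ j * neg_coeffs cm n) * exp (\<i> * of_real l * of_nat n * (- w))))" for n
      unfolding G_def real_norm_def abs_norm_cancel by (rule order_trans[OF norm_sum]) (simp only: norm_mult order.refl)
  qed
  have 2: "(\<Sum>\<^sub>\<infinity>n\<in>{..<0}. cm n * inc_Gamma (of_nat (Suc m)) (- 4 * pi * of_int n * Im \<tau>) * q powi n)
     = (\<Sum>j\<le>m. of_real (fact m / fact j) * X ^ j * exp_series l (\<lambda>n. of_nat n ^ j * neg_coeffs cm n) (- w))"
  proof -
    have "((\<lambda>n. cm n * inc_Gamma (of_nat (Suc m)) (- 4 * pi * of_int n * Im \<tau>) * q powi n) has_sum (\<Sum>n. G n))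
       ((\<lambda>n. - int n) ` {1..})"
    proof (rule has_sum_image_positive_nat[OF Gs])
      show "G 0 = 0" by (simp add: G_def neg_coeffs_def pos_coeffs_def)
      show "inj (\<lambda>n. - int n)" by (simp add: inj_def)
      fix n :: nat assume n: "n > 0"
      have "cm (- int n) * inc_Gamma (of_nat (Suc m)) (4 * pi * of_nat n * Im \<tau>) * q powi (- int n)
          = cm (- int n) * ((\<Sum>j\<le>m. of_real (fact m / fact j) * X ^ j * of_nat n ^ j) * exp (\<i> * of_real l * of_nat n * (- w)))"
        unfolding mult.assoc[of "cm (- int n)"] q_def inc_Gamma_exp[OF n \<tau>] en Xv ..
      also have "\<dots> = G n"
        using n by (simp add: G_def sum_distrib_left sum_distrib_right neg_coeffs_def pos_coeffs_def mult_ac)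
      finally show "cm (- int n) * inc_Gamma (of_nat (Suc m)) (- 4 * pi * of_int (- int n) * Im \<tau>) * q powi (- int n) = G n"
        by simp
    qed
    then have "(\<Sum>\<^sub>\<infinity>n\<in>{..<0}. cm n * inc_Gamma (of_nat (Suc m)) (- 4 * pi * of_int n * Im \<tau>) * q powi n) = (\<Sum>n. G n)"
      unfolding int_image_positive by (rule infsumI)
    also have "\<dots> = (\<Sum>j\<le>m. \<Sum>n. of_real (fact m / fact j) * X ^ j
      * ((of_nat n ^ j * neg_coeffs cm n) * exp (\<i> * of_real l * of_nat n * (- w))))"
      unfolding G_def by (intro suminf_sum summable_mult sm)
    also have "\<dots> = (\<Sum>j\<le>m. of_real (fact m / fact j) * X ^ j * exp_series l (\<lambda>n. of_nat n ^ j * neg_coeffs cm n) (- w))"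
      unfolding exp_series_def by (intro sum.cong refl suminf_mult sm)
    finally show ?thesis .
  qed
  have 3: "cm 0 * of_real (Im \<tau> powi (1 - (- int m)))
      = cm 0 / of_real (real N powr (of_int (1 - (- int m)) / 2)) * ((z - w) / (2 * \<i>)) ^ Suc m"
  proof -
    have "(z - w) / (2 * \<i>) = of_real (sqrt (real N) * Im \<tau>)"
      by (simp add: z_def w_def complex_eq_iff flip: right_diff_distrib complex_diff_cnj)
    moreover have "real N powr (of_int (1 - (- int m)) / 2) = sqrt (real N) ^ Suc m"
    proof -
      have "sqrt (real N) ^ Suc m = (real N powr (1/2)) powr real (Suc m)"
        using N by (simp add: powr_half_sqrt powr_realpow del: of_nat_Suc power_Suc)
      then show ?thesis by (simp add: powr_powr)
    qed
    moreover have "Im \<tau> powi (1 - (- int m)) = Im \<tau> ^ Suc m"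
      using power_int_of_nat[of "Im \<tau>" "Suc m"] by simp
    ultimately show ?thesis using N by (simp add: power_mult_distrib del: power_Suc)
  qed
  have k: "(of_int (1 - (- int m)) :: complex) = of_nat (Suc m)" by simp
  show ?thesis
    unfolding fourier_series_def Let_def k q_def[symmetric] 1 2 3 polarized_def
      l_def[symmetric] z_def[symmetric] w_def[symmetric] X_def[symmetric]
    by (simp only: add_ac)
qed

text \<open>In the variable \<open>z = \<surd>N \<tau>\<close> the factor \<open>N\<^sup>k\<^sup>/\<^sup>2 (N\<tau>)\<^sup>-\<^sup>k\<close> becomes \<open>z\<^sup>-\<^sup>k\<close>, and no trace of \<open>N\<close> remains in the
transformation.\<close>

lemma slash_omega_iff_polarized:
  assumes c: "poly_growth (pos_coeffs cp)" and d: "poly_growth (neg_coeffs cm)"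
    and c': "poly_growth (pos_coeffs cp')" and d': "poly_growth (neg_coeffs cm')" and N: "N > 0"
    and f: "\<And>\<tau>. Im \<tau> > 0 \<Longrightarrow> f \<tau> = fourier_series (- int m) cp cm \<tau>"
    and g: "\<And>\<tau>. Im \<tau> > 0 \<Longrightarrow> g \<tau> = fourier_series (- int m) cp' cm' \<tau>"
  defines "l \<equiv> 2 * pi / sqrt (real N)" and "M \<equiv> complex_of_real (real N powr (of_int (1 - (- int m)) / 2))"
  shows "(\<forall>\<tau>. Im \<tau> > 0 \<longrightarrow> g \<tau> = slash_omega (- int m) N f \<tau>) \<longleftrightarrow>
    (\<forall>z. Im z > 0 \<longrightarrow> polarized l m (cp' 0) (cm' 0 / M) (pos_coeffs cp') (neg_coeffs cm') z (cnj z) =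
      z ^ m * polarized l m (cp 0) (cm 0 / M) (pos_coeffs cp) (neg_coeffs cm) (- 1 / z) (- 1 / cnj z))"
proof -
  let ?r = "complex_of_real (sqrt (real N))"
  have r0: "?r \<noteq> 0" and rr: "?r * ?r = of_nat N" using N by (simp_all flip: of_real_mult)
  have G: "g \<tau> = polarized l m (cp' 0) (cm' 0 / M) (pos_coeffs cp') (neg_coeffs cm') (?r * \<tau>) (cnj (?r * \<tau>))"
    if "Im \<tau> > 0" for \<tau>
    using fourier_series_eq_polarized[OF c' d' N that, of m] g[OF that] by (simp add: l_def M_def)
  have F: "slash_omega (- int m) N f \<tau> = (?r * \<tau>) ^ m *
      polarized l m (cp 0) (cm 0 / M) (pos_coeffs cp) (neg_coeffs cm) (- 1 / (?r * \<tau>)) (- 1 / cnj (?r * \<tau>))"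
    if \<tau>: "Im \<tau> > 0" for \<tau>
  proof -
    have N\<tau>: "Im (of_nat N * \<tau>) > 0" using N \<tau> by simp
    then have I: "Im (- 1 / (of_nat N * \<tau>)) > 0" by (simp only: Im_minus_inverse)
    have \<tau>0: "\<tau> \<noteq> 0" using \<tau> by auto
    have e: "?r * (- 1 / (of_nat N * \<tau>)) = - 1 / (?r * \<tau>)"
      using r0 \<tau>0 unfolding rr[symmetric] by (simp add: field_simps)
    have "?r * cnj (- 1 / (of_nat N * \<tau>)) = cnj (?r * (- 1 / (of_nat N * \<tau>)))" by simp
    also have "\<dots> = - 1 / cnj (?r * \<tau>)" unfolding e by simp
    finally have e': "?r * cnj (- 1 / (of_nat N * \<tau>)) = - 1 / cnj (?r * \<tau>)" .
    have fe: "f (- 1 / (of_nat N * \<tau>)) = polarized l m (cp 0) (cm 0 / M) (pos_coeffs cp) (neg_coeffs cm) (- 1 / (?r * \<tau>)) (- 1 / cnj (?r * \<tau>))"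
      unfolding f[OF I] fourier_series_eq_polarized[OF c d N I] e e' l_def M_def ..
    have "real N powr (of_int (- int m) / 2) = 1 / sqrt (real N) ^ m"
    proof -
      have "real N powr (of_int (- int m) / 2) = (real N powr (1/2)) powr (- real m)"
        unfolding powr_powr by simp
      then show ?thesis using N by (simp add: powr_half_sqrt powr_realpow powr_minus_divide)
    qed
    then have "of_real (real N powr (of_int (- int m) / 2)) * (of_nat N * \<tau>) powi (- (- int m)) = (?r * \<tau>) ^ m"
      unfolding rr[symmetric] using r0 by (simp add: power_mult_distrib)
    then show ?thesis unfolding slash_omega_def fe by (simp only:)
  qed
  show ?thesis
  proof (intro iffI allI impI)
    fix z assume L: "\<forall>\<tau>. Im \<tau> > 0 \<longrightarrow> g \<tau> = slash_omega (- int m) N f \<tau>" and z: "Im z > 0"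
    define \<tau> where "\<tau> = z / ?r"
    have z\<tau>: "?r * \<tau> = z" using r0 by (simp add: \<tau>_def)
    have "Im \<tau> > 0" using z N by (simp add: \<tau>_def)
    from L[rule_format, OF this] show "polarized l m (cp' 0) (cm' 0 / M) (pos_coeffs cp') (neg_coeffs cm') z (cnj z) =
      z ^ m * polarized l m (cp 0) (cm 0 / M) (pos_coeffs cp) (neg_coeffs cm) (- 1 / z) (- 1 / cnj z)"
      unfolding G[OF \<open>Im \<tau> > 0\<close>] F[OF \<open>Im \<tau> > 0\<close>] z\<tau> .
  next
    fix \<tau> assume R: "\<forall>z. Im z > 0 \<longrightarrow> polarized l m (cp' 0) (cm' 0 / M) (pos_coeffs cp') (neg_coeffs cm') z (cnj z) =
      z ^ m * polarized l m (cp 0) (cm 0 / M) (pos_coeffs cp) (neg_coeffs cm) (- 1 / z) (- 1 / cnj z)" and \<tau>: "Im \<tau> > 0"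
    have "Im (?r * \<tau>) > 0" using \<tau> N by simp
    from R[rule_format, OF this] show "g \<tau> = slash_omega (- int m) N f \<tau>"
      unfolding G[OF \<tau>] F[OF \<tau>] .
  qed
qed

lemma axis_part_rapid_decay:
  assumes "poly_growth c" "poly_growth d" "l > 0"
  shows "rapid_decay (axis_part l m c d)" "rapid_decay (axis_part_u l m c d)"
  unfolding axis_part_def[abs_def] axis_part_u_def[abs_def]
  by (intro rapid_decay_add rapid_decay_cmult rapid_decay_sum exp_sum_rapid_decay assms finite_atMost)+

lemma L_series:
  assumes c: "poly_growth (pos_coeffs cp)"
  obtains \<sigma> where "\<And>s. Re s > \<sigma> \<Longrightarrow> L_plus cp s = (\<Sum>n. pos_coeffs cp n * of_nat n powr (- s))"
proof -
  obtain \<sigma> where \<sigma>: "\<And>s. Re s > \<sigma> \<Longrightarrow> summable (\<lambda>n. norm (pos_coeffs cp n * of_nat n powr (- s)))"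
    using dirichlet_summable[OF c] by metis
  show ?thesis
  proof (rule that)
    fix s assume s: "Re s > \<sigma>"
    have "((\<lambda>n. cp n * of_int n powr (- s)) has_sum (\<Sum>n. pos_coeffs cp n * of_nat n powr (- s))) (int ` {1..})"
      by (rule has_sum_image_positive_nat[OF \<sigma>[OF s]]) (auto simp: pos_coeffs_def)
    then show "L_plus cp s = (\<Sum>n. pos_coeffs cp n * of_nat n powr (- s))"
      unfolding L_plus_def int_image_positive by (rule infsumI)
  qed
qed

lemma L_minus_eq_L_plus: "L_minus cm = L_plus (\<lambda>n. cm (- n))"
  by (simp add: L_minus_def L_plus_def fun_eq_iff)

text \<open>The gamma factors and \<open>W\<close> come from \<open>has_mellin_exp_sum\<close> and \<open>W_nat\<close>; for \<open>\<Xi>\<close> the extra factor \<open>lnt\<close> from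
differentiation shifts \<open>s\<close> to \<open>s + 1\<close>, and the sign of the second term comes from the opposite
sign of the frequencies there.\<close>

lemma completed_functions_are_mellin:
  assumes c: "poly_growth (pos_coeffs cp)" and d: "poly_growth (neg_coeffs cm)" and N: "N > 0"
  defines "l \<equiv> 2 * pi / sqrt (real N)"
  shows "\<exists>\<sigma>. \<forall>s. Re s > \<sigma> \<longrightarrow>
    Lambda (- int m) N cp cm s = mellin (axis_part l m (pos_coeffs cp) (neg_coeffs cm)) s \<and>
    Omega (- int m) N cp cm s = mellin (\<lambda>t. - 2 * axis_part_u l m (pos_coeffs cp) (neg_coeffs cm) t
        + of_int (- int m) * axis_part l m (pos_coeffs cp) (neg_coeffs cm) t) s"
proof -
  have l: "l > 0" using N by (simp add: l_def)
  obtain \<sigma>p where p: "\<And>s. Re s > \<sigma>p \<Longrightarrow> L_plus cp s = (\<Sum>n. pos_coeffs cp n * of_nat n powr (- s))"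
    using L_series[OF c] by metis
  obtain \<sigma>m where m: "\<And>s. Re s > \<sigma>m \<Longrightarrow> L_minus cm s = (\<Sum>n. neg_coeffs cm n * of_nat n powr (- s))"
    using L_series[OF d[unfolded neg_coeffs_def]] unfolding L_minus_eq_L_plus neg_coeffs_def by metis
  have "\<exists>\<sigma>. \<forall>s. Re s > \<sigma> \<longrightarrow> has_mellin (exp_sum l (pos_coeffs cp) j) s
      (Gamma (s + of_nat j) * of_real l powr (- s) * (\<Sum>n. pos_coeffs cp n * of_nat n powr (- s)))" for j
    using has_mellin_exp_sum[OF c l, of j] by metis
  then obtain \<sigma>1 where 1: "\<And>j s. Re s > \<sigma>1 j \<Longrightarrow> has_mellin (exp_sum l (pos_coeffs cp) j) s
      (Gamma (s + of_nat j) * of_real l powr (- s) * (\<Sum>n. pos_coeffs cp n * of_nat n powr (- s)))" by metis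
  have "\<exists>\<sigma>. \<forall>s. Re s > \<sigma> \<longrightarrow> has_mellin (exp_sum l (neg_coeffs cm) j) s
      (Gamma (s + of_nat j) * of_real l powr (- s) * (\<Sum>n. neg_coeffs cm n * of_nat n powr (- s)))" for j
    using has_mellin_exp_sum[OF d l, of j] by metis
  then obtain \<sigma>2 where 2: "\<And>j s. Re s > \<sigma>2 j \<Longrightarrow> has_mellin (exp_sum l (neg_coeffs cm) j) s
      (Gamma (s + of_nat j) * of_real l powr (- s) * (\<Sum>n. neg_coeffs cm n * of_nat n powr (- s)))" by metis
  define \<sigma> where "\<sigma> = Max (insert 0 (insert \<sigma>p (insert \<sigma>m ((\<sigma>1 ` {..Suc m}) \<union> (\<sigma>2 ` {..Suc m})))))"
  have le: "0 \<le> \<sigma>" "\<sigma>p \<le> \<sigma>" "\<sigma>m \<le> \<sigma>" "\<And>j. j \<le> Suc m \<Longrightarrow> \<sigma>1 j \<le> \<sigma>" "\<And>j. j \<le> Suc m \<Longrightarrow> \<sigma>2 j \<le> \<sigma>"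
    unfolding \<sigma>_def by (rule Max_ge; simp)+
  have k: "(of_int (1 - (- int m)) :: complex) = of_nat (Suc m)" by simp
  have key: "Lambda (- int m) N cp cm s = mellin (axis_part l m (pos_coeffs cp) (neg_coeffs cm)) s \<and>
      Omega (- int m) N cp cm s = mellin (\<lambda>t. - 2 * axis_part_u l m (pos_coeffs cp) (neg_coeffs cm) t
        + of_int (- int m) * axis_part l m (pos_coeffs cp) (neg_coeffs cm) t) s" if s: "Re s > \<sigma>" for s
  proof -
    let ?A = "L_plus cp s" and ?B = "L_minus cm s"
    have s0: "Re s > 0" "Re (s + 1) > 0" using s le(1) by simp_all
    have A: "?A = (\<Sum>n. pos_coeffs cp n * of_nat n powr (- s))" by (rule p) (use s le(2) in linarith)
    have B: "?B = (\<Sum>n. neg_coeffs cm n * of_nat n powr (- s))" by (rule m) (use s le(3) in linarith)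
    have h1: "has_mellin (exp_sum l (pos_coeffs cp) j) s (Gamma (s + of_nat j) * of_real l powr (- s) * ?A)"
      if "j \<le> Suc m" for j unfolding A by (rule 1) (use s le(4)[OF that] in linarith)
    have h2: "has_mellin (exp_sum l (neg_coeffs cm) j) s (Gamma (s + of_nat j) * of_real l powr (- s) * ?B)"
      if "j \<le> Suc m" for j unfolding B by (rule 2) (use s le(5)[OF that] in linarith)
    have ls: "of_real (sqrt (real N) / (2 * pi)) powr s = (of_real l powr (- s) :: complex)"
    proof -
      have "of_real (sqrt (real N) / (2 * pi)) = inverse (complex_of_real l)"
        by (simp add: l_def flip: of_real_inverse)
      moreover have "inverse (complex_of_real l) powr s = of_real l powr (- s)"
        using l by (simp add: powr_def Ln_of_real ln_inverse flip: of_real_inverse)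
      ultimately show ?thesis by simp
    qed
    have P: "has_mellin (axis_part l m (pos_coeffs cp) (neg_coeffs cm)) s (Lambda (- int m) N cp cm s)"
    proof -
      have "has_mellin (axis_part l m (pos_coeffs cp) (neg_coeffs cm)) s
         (Gamma (s + of_nat 0) * of_real l powr (- s) * ?A
          + (\<Sum>j\<le>m. of_real (fact m * 2 ^ j / fact j) * (Gamma (s + of_nat j) * of_real l powr (- s) * ?B)))"
        unfolding axis_part_def[abs_def]
        by (intro has_mellin_add has_mellin_sum has_mellin_cmult h1 h2) auto
      also have "Gamma (s + of_nat 0) * of_real l powr (- s) * ?A
          + (\<Sum>j\<le>m. of_real (fact m * 2 ^ j / fact j) * (Gamma (s + of_nat j) * of_real l powr (- s) * ?B))
        = Lambda (- int m) N cp cm s"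
        unfolding Lambda_def k W_nat[OF s0(1)] ls
        by (simp add: distrib_left sum_distrib_left sum_distrib_right mult_ac)
      finally show ?thesis .
    qed
    have U: "has_mellin (axis_part_u l m (pos_coeffs cp) (neg_coeffs cm)) s (Xi (- int m) N cp cm s)"
    proof -
      have "has_mellin (axis_part_u l m (pos_coeffs cp) (neg_coeffs cm)) s
         (Gamma (s + of_nat 1) * of_real l powr (- s) * ?A
          + - 1 * (\<Sum>j\<le>m. of_real (fact m * 2 ^ j / fact j) * (Gamma (s + of_nat (Suc j)) * of_real l powr (- s) * ?B)))"
        unfolding axis_part_u_def[abs_def]
        by (intro has_mellin_add has_mellin_sum has_mellin_cmult h1 h2) auto
      also have "Gamma (s + of_nat 1) * of_real l powr (- s) * ?A
          + - 1 * (\<Sum>j\<le>m. of_real (fact m * 2 ^ j / fact j) * (Gamma (s + of_nat (Suc j)) * of_real l powr (- s) * ?B))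
        = Xi (- int m) N cp cm s"
        unfolding Xi_def k W_nat[OF s0(2)] ls
        by (simp add: right_diff_distrib sum_distrib_left sum_distrib_right sum_negf mult_ac add_ac)
      finally show ?thesis .
    qed
    have O: "has_mellin (\<lambda>t. - 2 * axis_part_u l m (pos_coeffs cp) (neg_coeffs cm) t
        + of_int (- int m) * axis_part l m (pos_coeffs cp) (neg_coeffs cm) t) s (Omega (- int m) N cp cm s)"
      unfolding Omega_def by (intro has_mellin_add has_mellin_cmult P U)
    show ?thesis using P O by (simp only: has_mellin_def simp_thms)
  qed
  show ?thesis by (intro exI[of _ \<sigma>] allI impI) (rule key)
qed

section \<open>The converse theorem\<close>

text \<open>The invariance is tested on the axis, and each of the two laws obtained there is an instance of Hecke's
correspondence: \<open>\<epsilon> = i\<^sup>k\<close> for \<open>f\<close> and \<open>\<epsilon> = -i\<^sup>k\<close>, with constants multiplied by \<open>k\<close>, for the combination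
with \<open>\<partial>f/\<partial>u\<close>.\<close>

theorem theorem4p5:
  fixes k :: int and N :: nat and \<alpha> :: real
    and f g :: "complex \<Rightarrow> complex"
    and cfp cfm cgp cgm :: "int \<Rightarrow> complex"
  assumes "k < 0" and "N > 0" and "\<alpha> \<ge> 0"
    and "\<And>\<tau>. Im \<tau> > 0 \<Longrightarrow> f \<tau> = fourier_series k cfp cfm \<tau>"
    and "\<And>\<tau>. Im \<tau> > 0 \<Longrightarrow> g \<tau> = fourier_series k cgp cgm \<tau>"
    and "(\<lambda>n. norm (cfp n)) \<in> O[at_top](\<lambda>n. \<bar>real_of_int n\<bar> powr \<alpha>)"
    and "(\<lambda>n. norm (cfm n)) \<in> O[at_bot](\<lambda>n. \<bar>real_of_int n\<bar> powr \<alpha>)"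
    and "(\<lambda>n. norm (cgp n)) \<in> O[at_top](\<lambda>n. \<bar>real_of_int n\<bar> powr \<alpha>)"
    and "(\<lambda>n. norm (cgm n)) \<in> O[at_bot](\<lambda>n. \<bar>real_of_int n\<bar> powr \<alpha>)"
  shows "(\<forall>\<tau>. Im \<tau> > 0 \<longrightarrow> g \<tau> = slash_omega k N f \<tau>) \<longleftrightarrow>
    (\<exists>\<Lambda>f \<Lambda>g \<Omega>f \<Omega>g.
      meromorphic_continuation (Lambda k N cfp cfm) \<Lambda>f \<and>
      meromorphic_continuation (Lambda k N cgp cgm) \<Lambda>g \<and>
      meromorphic_continuation (Omega k N cfp cfm) \<Omega>f \<and>
      meromorphic_continuation (Omega k N cgp cgm) \<Omega>g \<and>
      (\<forall>s. \<Lambda>f s = \<i> powi k * \<Lambda>g (of_int k - s)) \<and>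
      (\<forall>s. \<Omega>f s = - (\<i> powi k) * \<Omega>g (of_int k - s)) \<and>
      entire_bounded_in_strips (\<lambda>s. \<Lambda>f s
        + cfp 0 / s
        + cgp 0 * \<i> powi k / (of_int k - s)
        + cfm 0 / of_real (real N powr (of_int (1 - k) / 2)) * (1 / (s - of_int k + 1))
        + cgm 0 * \<i> powi k / of_real (real N powr (of_int (1 - k) / 2)) * (1 / (1 - s))) \<and>
      entire_bounded_in_strips (\<lambda>s. \<Lambda>g s
        + cgp 0 / s
        + cfp 0 * \<i> powi (- k) / (of_int k - s)
        + cgm 0 / of_real (real N powr (of_int (1 - k) / 2)) * (1 / (s - of_int k + 1))
        + cfm 0 * \<i> powi (- k) / of_real (real N powr (of_int (1 - k) / 2)) * (1 / (1 - s))) \<and>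
      entire_bounded_in_strips (\<lambda>s. \<Omega>f s + of_int k *
       (cfp 0 / s
        - cgp 0 * \<i> powi k / (of_int k - s)
        + cfm 0 / of_real (real N powr (of_int (1 - k) / 2)) * (1 / (s - of_int k + 1))
        - cgm 0 * \<i> powi k / of_real (real N powr (of_int (1 - k) / 2)) * (1 / (1 - s)))) \<and>
      entire_bounded_in_strips (\<lambda>s. \<Omega>g s + of_int k *
       (cgp 0 / s
        - cfp 0 * \<i> powi (- k) / (of_int k - s)
        + cgm 0 / of_real (real N powr (of_int (1 - k) / 2)) * (1 / (s - of_int k + 1))
        - cfm 0 * \<i> powi (- k) / of_real (real N powr (of_int (1 - k) / 2)) * (1 / (1 - s)))))"
proof -
  define m where "m = nat (- k)"
  have k: "k = - int m" using \<open>k < 0\<close> by (simp add: m_def)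
  define l where "l = 2 * pi / sqrt (real N)"
  have l: "l > 0" using \<open>N > 0\<close> by (simp add: l_def)
  define M where "M = complex_of_real (real N powr (of_int (1 - k) / 2))"
  define \<epsilon> where "\<epsilon> = \<i> powi k"
  have \<epsilon>: "\<epsilon> \<noteq> 0" "- \<epsilon> \<noteq> 0" "\<i> powi (- k) = 1 / \<epsilon>"
    by (simp_all add: \<epsilon>_def power_int_minus divide_inverse)
  note c = poly_growth_pos_coeffs[OF assms(6)] and d = poly_growth_neg_coeffs[OF assms(7)]
    and c' = poly_growth_pos_coeffs[OF assms(8)] and d' = poly_growth_neg_coeffs[OF assms(9)]
  let ?c = "pos_coeffs cfp" and ?d = "neg_coeffs cfm" and ?c' = "pos_coeffs cgp" and ?d' = "neg_coeffs cgm"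
  define P where "P = axis_part l m ?c ?d"
  define Q where "Q = axis_part l m ?c' ?d'"
  define Pu where "Pu = (\<lambda>t. - 2 * axis_part_u l m ?c ?d t + of_int k * axis_part l m ?c ?d t)"
  define Qu where "Qu = (\<lambda>t. - 2 * axis_part_u l m ?c' ?d' t + of_int k * axis_part l m ?c' ?d' t)"
  have rapid_decay: "rapid_decay P" "rapid_decay Q" "rapid_decay Pu" "rapid_decay Qu"
    unfolding P_def Q_def Pu_def Qu_def
    by (intro rapid_decay_add rapid_decay_cmult axis_part_rapid_decay c d c' d' l)+
  have "\<exists>\<sigma>. \<forall>s. Re s > \<sigma> \<longrightarrow> Lambda k N cfp cfm s = mellin P s \<and> Omega k N cfp cfm s = mellin Pu s"
    unfolding P_def Pu_def l_def k by (rule completed_functions_are_mellin[OF c d \<open>N > 0\<close>])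
  then obtain \<sigma> where \<sigma>: "\<And>s. Re s > \<sigma> \<Longrightarrow> Lambda k N cfp cfm s = mellin P s"
      "\<And>s. Re s > \<sigma> \<Longrightarrow> Omega k N cfp cfm s = mellin Pu s"
    by blast
  have "\<exists>\<sigma>. \<forall>s. Re s > \<sigma> \<longrightarrow> Lambda k N cgp cgm s = mellin Q s \<and> Omega k N cgp cgm s = mellin Qu s"
    unfolding Q_def Qu_def l_def k by (rule completed_functions_are_mellin[OF c' d' \<open>N > 0\<close>])
  then obtain \<sigma>' where \<sigma>': "\<And>s. Re s > \<sigma>' \<Longrightarrow> Lambda k N cgp cgm s = mellin Q s"
      "\<And>s. Re s > \<sigma>' \<Longrightarrow> Omega k N cgp cgm s = mellin Qu s"
    by blast
  have mc: "meromorphic_continuation (Lambda k N cfp cfm) = meromorphic_continuation (mellin P)"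
      "meromorphic_continuation (Omega k N cfp cfm) = meromorphic_continuation (mellin Pu)"
      "meromorphic_continuation (Lambda k N cgp cgm) = meromorphic_continuation (mellin Q)"
      "meromorphic_continuation (Omega k N cgp cgm) = meromorphic_continuation (mellin Qu)"
    by (intro ext meromorphic_continuation_cong; fact \<sigma> \<sigma>')+
  have "(\<forall>\<tau>. Im \<tau> > 0 \<longrightarrow> g \<tau> = slash_omega k N f \<tau>) \<longleftrightarrow>
      (\<forall>z. Im z > 0 \<longrightarrow> polarized l m (cgp 0) (cgm 0 / M) ?c' ?d' z (cnj z) =
        z ^ m * polarized l m (cfp 0) (cfm 0 / M) ?c ?d (- 1 / z) (- 1 / cnj z))"
    unfolding M_def l_def k by (rule slash_omega_iff_polarized[OF c d c' d' \<open>N > 0\<close>]) (use assms(4,5) k in auto)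
  also have "\<dots> \<longleftrightarrow>
    (\<forall>t>0. axis_fun k (cfp 0) (cfm 0 / M) P (1 / t) = \<epsilon> * of_real (t powi k) * axis_fun k (cgp 0) (cgm 0 / M) Q t) \<and>
    (\<forall>t>0. axis_fun k (of_int k * cfp 0) (of_int k * (cfm 0 / M)) Pu (1 / t) =
      - \<epsilon> * of_real (t powi k) * axis_fun k (of_int k * cgp 0) (of_int k * (cgm 0 / M)) Qu t)"
    unfolding P_def Q_def Pu_def Qu_def \<epsilon>_def k by (rule invariance_criterion[OF c d c' d' l])
  finally have crit0: "(\<forall>\<tau>. Im \<tau> > 0 \<longrightarrow> g \<tau> = slash_omega k N f \<tau>) \<longleftrightarrow>
    (\<forall>t>0. axis_fun k (cfp 0) (cfm 0 / M) P (1 / t) = \<epsilon> * of_real (t powi k) * axis_fun k (cgp 0) (cgm 0 / M) Q t) \<and>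
    (\<forall>t>0. axis_fun k (of_int k * cfp 0) (of_int k * (cfm 0 / M)) Pu (1 / t) =
      - \<epsilon> * of_real (t powi k) * axis_fun k (of_int k * cgp 0) (of_int k * (cgm 0 / M)) Qu t)" .
  note crit = crit0[unfolded hecke_correspondence[OF rapid_decay(1,2) \<open>k < 0\<close> \<epsilon>(1)]
      hecke_correspondence[OF rapid_decay(3,4) \<open>k < 0\<close> \<epsilon>(2)]]
  have pol: "polar_part k (cfp 0) (cfm 0 / M) (\<epsilon> * cgp 0) (\<epsilon> * (cgm 0 / M)) s =
      cfp 0 / s + cgp 0 * \<i> powi k / (of_int k - s) + cfm 0 / M * (1 / (s - of_int k + 1))
      + cgm 0 * \<i> powi k / M * (1 / (1 - s))"
    "polar_part k (cgp 0) (cgm 0 / M) (cfp 0 / \<epsilon>) (cfm 0 / M / \<epsilon>) s =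
      cgp 0 / s + cfp 0 * \<i> powi (- k) / (of_int k - s) + cgm 0 / M * (1 / (s - of_int k + 1))
      + cfm 0 * \<i> powi (- k) / M * (1 / (1 - s))"
    "polar_part k (of_int k * cfp 0) (of_int k * (cfm 0 / M)) (- \<epsilon> * (of_int k * cgp 0)) (- \<epsilon> * (of_int k * (cgm 0 / M))) s =
      of_int k * (cfp 0 / s - cgp 0 * \<i> powi k / (of_int k - s) + cfm 0 / M * (1 / (s - of_int k + 1))
      - cgm 0 * \<i> powi k / M * (1 / (1 - s)))"
    "polar_part k (of_int k * cgp 0) (of_int k * (cgm 0 / M)) (of_int k * cfp 0 / - \<epsilon>) (of_int k * (cfm 0 / M) / - \<epsilon>) s =
      of_int k * (cgp 0 / s - cfp 0 * \<i> powi (- k) / (of_int k - s) + cgm 0 / M * (1 / (s - of_int k + 1))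
      - cfm 0 * \<i> powi (- k) / M * (1 / (1 - s)))" for s
    unfolding \<epsilon>(3) \<epsilon>_def[symmetric] polar_part_def
    by (simp_all add: distrib_left right_diff_distrib mult_ac)
  show ?thesis
    unfolding crit unfolding pol unfolding mc M_def \<epsilon>_def add.assoc
    by (intro iffI; elim exE conjE; intro exI conjI; assumption)
qed

end
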